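(* There is a polynomial time algorithm that, for any $\Delta$-regular graph $G=(V,E)$ with $n$ vertices, any $\delta>0$, and any feasible solution $\lambda,\mathbf{x},\mathbf{y}$ of SDP 1 (with parameter $\delta$), returns a set $S\subseteq V$ of size $|S|\geq 3\delta n/8$ and spectral expansion $$\lambda_2(L_{G[S]})\gtrsim \frac{\lambda}{\log^2\delta\cdot\exp(O(\Delta/\lambda))}.$$
   Context: $G$ is an undirected, unweighted, $\Delta$-regular graph on vertex set $V$, $n=|V|$. For vertices $u,v$ let $\mathbf{1}_{u,v}\in\mathbb{R}^V$ be $1$ at $v$, $-1$ at $u$, $0$ elsewhere, $L_{u,v}=\mathbf{1}_{u,v}\mathbf{1}_{u,v}^\intercal$, and for an edge $e=\{u,v\}$, $L_e=L_{u,v}$. The Laplacian of a graph $H$ is $L_H=\sum_{\{u,v\}\in E(H)}L_{u,v}$, $\lambda_2(L_H)$ its second smallest eigenvalue, and $G[S]$ the induced subgraph on $S$. For symmetric matrices, $A\succeq B$ means $A-B$ is positive semidefinite. SDP 1 (parameter $\delta$): variables $\lambda$, $\mathbf{x}=(x_e)_{e\in E}$, $\mathbf{y}=(y_{\{u,v\}})_{u,v\in V}$; maximize $\lambda$ subject to (1) $\sum_{e\in E}x_eL_e\succeq\lambda\sum_{u,v\in V}y_{\{u,v\}}L_{u,v}$; (2) $\sum_{v}y_{\{u,v\}}\geq\max_{e\ni u}x_e$ for all $u\in V$; (3) $\delta n\cdot y_{\{u,v\}}\leq\sum_{w}y_{\{u,w\}}$ for all $u,v\in V$; (4) $\mathbf{x},\mathbf{y}\geq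 0$, $\mathbf{x}\neq 0$. The paper takes feasible solutions with $\lambda>0$. $\log^2\delta=(\log\delta)^2$; $A\gtrsim B$ means $A\geq cB$ for an absolute constant $c>0$, and $O(\cdot)$ hides an absolute constant.
   Formalization: log²δ is replaced by max(1, log²δ), since the literal bound fails as δ→1 (complete graphs, δ=(n−1)/n); y is indexed by pairs of distinct vertices, as y_{u,u} would make it false; the algorithm takes rational input, with existence of S shown for all real solutions. *)

theory Defs
  imports
    Complex_Main
    "HOL-Computational_Algebra.Computational_Algebra"
    "HOL-Library.Log_Nat"
    "Jordan_Normal_Form.Char_Poly"
begin

section \<open>Regular graphs and Laplacians\<close>

text \<open>
  Graphs have vertex set \<open>{..<n}\<close>, and an edge is a two-element set of vertices.
\<close>

definition pairs :: "nat set \<Rightarrow> nat set set" where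
  "pairs V = {e. e \<subseteq> V \<and> card e = 2}"

definition regular_graph :: "nat \<Rightarrow> nat set set \<Rightarrow> nat \<Rightarrow> bool" where
  "regular_graph n E \<Delta> \<longleftrightarrow>
     E \<subseteq> pairs {..<n} \<and> (\<forall>v<n. card {e \<in> E. v \<in> e} = \<Delta>)"

definition induced_edges :: "nat set set \<Rightarrow> nat set \<Rightarrow> nat set set" where
  "induced_edges E S = {e \<in> E. e \<subseteq> S}"

text \<open>
  Matrices indexed by a set of vertices are functions of two vertices, with the index set given
  separately.
\<close>

definition pair_vec :: "nat \<Rightarrow> nat \<Rightarrow> nat \<Rightarrow> real" where
  "pair_vec u v a = (if a = v then 1 else if a = u then -1 else 0)"

definition pair_mat :: "nat \<Rightarrow> nat \<Rightarrow> nat \<Rightarrow> nat \<Rightarrow> real" where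
  "pair_mat u v a b = pair_vec u v a * pair_vec u v b"

text \<open>
  The matrix of an edge does not depend on the orientation, so any naming of the two endpoints
  will do.
\<close>

definition edge_mat :: "nat set \<Rightarrow> nat \<Rightarrow> nat \<Rightarrow> real" where
  "edge_mat e = pair_mat (Min e) (Max e)"

lemma edge_mat_doubleton: "u \<noteq> v \<Longrightarrow> edge_mat {u, v} = pair_mat u v"
  by (intro ext) (auto simp: edge_mat_def pair_mat_def pair_vec_def min_def max_def)

definition weighted_laplacian :: "nat set set \<Rightarrow> (nat set \<Rightarrow> real) \<Rightarrow> nat \<Rightarrow> nat \<Rightarrow> real" where
  "weighted_laplacian F w a b = (\<Sum>e\<in>F. w e * edge_mat e a b)"

definition laplacian :: "nat set set \<Rightarrow> nat \<Rightarrow> nat \<Rightarrow> real" where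
  "laplacian F a b = (\<Sum>e\<in>F. edge_mat e a b)"

text \<open>The order \<open>A \<succeq> B\<close> on symmetric matrices indexed by \<open>V\<close>.\<close>

definition loewner_ge ::
    "nat set \<Rightarrow> (nat \<Rightarrow> nat \<Rightarrow> real) \<Rightarrow> (nat \<Rightarrow> nat \<Rightarrow> real) \<Rightarrow> bool" where
  "loewner_ge V A B \<longleftrightarrow>
     (\<forall>z :: nat \<Rightarrow> real. 0 \<le> (\<Sum>a\<in>V. \<Sum>b\<in>V. z a * (A a b - B a b) * z b))"

definition matrix_on :: "nat set \<Rightarrow> (nat \<Rightarrow> nat \<Rightarrow> real) \<Rightarrow> real mat" where
  "matrix_on S A = mat (card S) (card S)
     (\<lambda>(i, j). A (sorted_list_of_set S ! i) (sorted_list_of_set S ! j))"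

text \<open>
  The second smallest eigenvalue, counted with multiplicity. It is meaningful only for symmetric
  matrices (whose characteristic polynomial splits over the reals) of dimension at least 2.
\<close>

definition lambda2 :: "nat set \<Rightarrow> (nat \<Rightarrow> nat \<Rightarrow> real) \<Rightarrow> real" where
  "lambda2 S A = sorted_list_of_multiset (proots (char_poly (matrix_on S A))) ! 1"


section \<open>The semidefinite program\<close>

text \<open>
  The variables \<open>y\<close> are indexed by pairs of distinct vertices, and each unordered pair
  contributes once to the right-hand side of the matrix inequality.
\<close>

definition sdp_feasible ::
    "nat \<Rightarrow> nat set set \<Rightarrow> real \<Rightarrow> real \<Rightarrow> (nat set \<Rightarrow> real) \<Rightarrow> (nat set \<Rightarrow> real) \<Rightarrow> bool" where
  "sdp_feasible n E \<delta> lam x y \<longleftrightarrow>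
     loewner_ge {..<n} (weighted_laplacian E x)
       (\<lambda>a b. lam * weighted_laplacian (pairs {..<n}) y a b) \<and>
     (\<forall>u<n. (\<Sum>v\<in>{..<n} - {u}. y {u, v}) \<ge> Max (x ` {e \<in> E. u \<in> e})) \<and>
     (\<forall>u<n. \<forall>v<n. u \<noteq> v \<longrightarrow> \<delta> * real n * y {u, v} \<le> (\<Sum>w\<in>{..<n} - {u}. y {u, w})) \<and>
     (\<forall>e\<in>E. 0 \<le> x e) \<and> (\<forall>p\<in>pairs {..<n}. 0 \<le> y p) \<and> (\<exists>e\<in>E. x e \<noteq> 0)"

text \<open>
  The factor \<open>max 1 ((ln \<delta>)\<^sup>2)\<close> stands for \<open>log\<^sup>2 \<delta>\<close>. Feasibility forces \<open>\<delta> < 1\<close>, and the two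
  agree up to a constant as long as \<open>\<delta>\<close> stays away from 1; as \<open>\<delta>\<close> tends to 1, however,
  \<open>log\<^sup>2 \<delta>\<close> tends to 0, and the bound without the maximum fails (complete graphs with
  \<open>\<delta> = (n - 1) / n\<close>). The set must have two vertices for a second eigenvalue to exist.
\<close>

definition good_set ::
    "real \<Rightarrow> real \<Rightarrow> nat \<Rightarrow> nat set set \<Rightarrow> nat \<Rightarrow> real \<Rightarrow> real \<Rightarrow> nat set \<Rightarrow> bool" where
  "good_set c C n E \<Delta> \<delta> lam S \<longleftrightarrow>
     S \<subseteq> {..<n} \<and> 2 \<le> card S \<and> real (card S) \<ge> 3 * \<delta> * real n / 8 \<and>
     lambda2 S (laplacian (induced_edges E S))
       \<ge> c * (lam / (max 1 ((ln \<delta>)\<^sup>2) * exp (C * (real \<Delta> / lam))))"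


section \<open>Algorithms: random access machine with logarithmic cost\<close>

text \<open>
  Programs work on integer arrays with integer indices. Every evaluation of a subexpression is
  charged the bit length of its value, so running times are polynomially related to those of
  Turing machines.
\<close>

type_synonym memory = "nat \<Rightarrow> int \<Rightarrow> int"

datatype aexp =
    Const int
  | Get nat aexp
  | Add aexp aexp
  | Sub aexp aexp
  | Mul aexp aexp
  | Div aexp aexp

datatype com =
    Skip
  | Store nat aexp aexp
  | Seq com com
  | IfLess aexp aexp com com
  | WhileLess aexp aexp com

fun aval :: "aexp \<Rightarrow> memory \<Rightarrow> int" where
  "aval (Const k) m = k"
| "aval (Get a i) m = m a (aval i m)"
| "aval (Add e f) m = aval e m + aval f m"
| "aval (Sub e f) m = aval e m - aval f m"
| "aval (Mul e f) m = aval e m * aval f m"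
| "aval (Div e f) m = aval e m div aval f m"

definition bits :: "int \<Rightarrow> nat" where
  "bits k = 1 + floorlog 2 (nat \<bar>k\<bar>)"

fun acost :: "aexp \<Rightarrow> memory \<Rightarrow> nat" where
  "acost (Const k) m = bits k"
| "acost (Get a i) m = acost i m + bits (m a (aval i m))"
| "acost (Add e f) m = acost e m + acost f m + bits (aval e m + aval f m)"
| "acost (Sub e f) m = acost e m + acost f m + bits (aval e m - aval f m)"
| "acost (Mul e f) m = acost e m + acost f m + bits (aval e m * aval f m)"
| "acost (Div e f) m = acost e m + acost f m + bits (aval e m div aval f m)"

text \<open>
  \<open>exec P m t m'\<close>: started in memory \<open>m\<close>, the program \<open>P\<close> halts in memory \<open>m'\<close> after time \<open>t\<close>.
\<close>

inductive exec :: "com \<Rightarrow> memory \<Rightarrow> nat \<Rightarrow> memory \<Rightarrow> bool" where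
  Skip: "exec Skip m 1 m"
| Store: "exec (Store a i e) m (1 + acost i m + acost e m)
            (m(a := (m a)(aval i m := aval e m)))"
| Seq: "exec P m s m' \<Longrightarrow> exec Q m' t m'' \<Longrightarrow> exec (Seq P Q) m (s + t) m''"
| IfTrue: "aval e m < aval f m \<Longrightarrow> exec P m t m' \<Longrightarrow>
            exec (IfLess e f P Q) m (1 + acost e m + acost f m + t) m'"
| IfFalse: "\<not> aval e m < aval f m \<Longrightarrow> exec Q m t m' \<Longrightarrow>
            exec (IfLess e f P Q) m (1 + acost e m + acost f m + t) m'"
| WhileTrue: "aval e m < aval f m \<Longrightarrow> exec P m s m' \<Longrightarrow> exec (WhileLess e f P) m' t m'' \<Longrightarrow>
            exec (WhileLess e f P) m (1 + acost e m + acost f m + s + t) m''"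
| WhileFalse: "\<not> aval e m < aval f m \<Longrightarrow>
            exec (WhileLess e f P) m (1 + acost e m + acost f m) m"


section \<open>Encoding of the input and the output\<close>

definition numer :: "rat \<Rightarrow> int" where
  "numer q = fst (quotient_of q)"

definition denom :: "rat \<Rightarrow> int" where
  "denom q = snd (quotient_of q)"

text \<open>
  A symmetric \<open>n \<times> n\<close> array is stored row by row, with \<open>d\<close> at the positions that do not correspond
  to an element of \<open>F\<close>.
\<close>

definition pair_array :: "nat \<Rightarrow> nat set set \<Rightarrow> (nat set \<Rightarrow> int) \<Rightarrow> int \<Rightarrow> int \<Rightarrow> int" where
  "pair_array n F f d i =
     (if 0 \<le> i \<and> i < int n * int n \<and> {nat i div n, nat i mod n} \<in> F
      then f {nat i div n, nat i mod n} else d)"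

definition input_memory ::
    "nat \<Rightarrow> nat set set \<Rightarrow> rat \<Rightarrow> rat \<Rightarrow> (nat set \<Rightarrow> rat) \<Rightarrow> (nat set \<Rightarrow> rat) \<Rightarrow> memory" where
  "input_memory n E \<delta> lam x y =
     (\<lambda>_ _. 0)
       (0 := (\<lambda>_. 0)(0 := int n, 1 := numer \<delta>, 2 := denom \<delta>, 3 := numer lam, 4 := denom lam),
        1 := pair_array n E (\<lambda>_. 1) 0,
        2 := pair_array n E (\<lambda>e. numer (x e)) 0,
        3 := pair_array n E (\<lambda>e. denom (x e)) 0,
        4 := pair_array n (pairs {..<n}) (\<lambda>p. numer (y p)) 0,
        5 := pair_array n (pairs {..<n}) (\<lambda>p. denom (y p)) 0)"

definition input_size ::
    "nat \<Rightarrow> nat set set \<Rightarrow> rat \<Rightarrow> rat \<Rightarrow> (nat set \<Rightarrow> rat) \<Rightarrow> (nat set \<Rightarrow> rat) \<Rightarrow> nat" where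
  "input_size n E \<delta> lam x y =
     (\<Sum>i<5. bits (input_memory n E \<delta> lam x y 0 (int i))) +
     (\<Sum>a\<in>{1..5}. \<Sum>i<n * n. bits (input_memory n E \<delta> lam x y a (int i)))"

definition output_set :: "nat \<Rightarrow> memory \<Rightarrow> nat set" where
  "output_set n m = {v. v < n \<and> m 6 (int v) \<noteq> 0}"

end

theory Submission
  imports Defs
begin

text \<open>
  Let \<open>w u = (\<Sum>v. y {u, v})\<close>. Constraint (3) says that a set \<open>A\<close> of at most \<open>s \<delta> n\<close> vertices sends a
  fraction \<open>1 - s\<close> of its weight \<open>w(A)\<close> to the outside, so (1), tested on indicator vectors only, gives
  \<open>x(\<partial>A) \<ge> \<lambda> (1 - s) w(A)\<close>. Since \<open>x e \<le> min (w u) (w v)\<close> for an edge \<open>e = {u, v}\<close>, an average over windows of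
  \<open>O(\<Delta> / \<lambda>)\<close> consecutive dyadic levels of \<open>w\<close> produces a window \<open>B\<close> with \<open>x(\<partial>B) \<le> \<lambda> w(B) / 8\<close>; on it \<open>w\<close>
  varies only by a factor \<open>K = exp(O(\<Delta> / \<lambda>))\<close>. Cut \<open>B\<close> repeatedly along sparse cuts. One of the two sides of each
  cut does not increase the potential \<open>x(\<partial>S) / w(S) + \<kappa> ln w(S)\<close>, and as long as the potential is at most that of
  \<open>B\<close>, \<open>x(\<partial>S) \<le> 5 \<lambda> w(S) / 8\<close> and hence \<open>|S| \<ge> 3 \<delta> n / 8\<close>. This branch ends in a set whose cuts all have at
  least \<open>h\<close> edges per vertex of the smaller side, where \<open>h\<close> is about \<open>\<lambda> / (K (log(1/\<delta>) + \<Delta> / \<lambda>))\<close>, and Cheeger's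
  inequality turns \<open>h\<close> into \<open>h\<^sup>2 / (4 \<Delta>)\<close>; the quadratic loss in \<open>\<lambda> / \<Delta>\<close> is absorbed by \<open>exp(O(\<Delta> / \<lambda>))\<close>.

  The algorithm needs neither \<open>\<lambda>\<close> nor the thresholds. For all windows spanned by two vertices and all branches, it
  cuts along the best sweep cut of the vectors \<open>(2 n + 1 - L) ^ k e\<^sub>i\<close> with \<open>k = n ^ 6\<close>, and it returns the large set
  whose best sweep cut is densest. If all these sweep cuts are dense, then every such vector, made orthogonal to the
  constants, has a large Rayleigh quotient for \<open>L\<close>, and log-convexity of the moments \<open>k \<mapsto> z \<bullet> (2 n + 1 - L) ^ k z\<close>
  carries this over to all vectors orthogonal to the constants.
\<close>

text \<open>A sparsest cut is hard to find, so each set meets an alternative: either some sweep cut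
  is sparse, and any sparse cut serves the potential argument, or all sweep cuts are dense, and this
  alone certifies the spectral gap. Sparseness counts vertices whereas the program (1)-(4) controls
  volumes \<open>w(S)\<close>. Inside a window the two measures differ by a factor of at most
  \<open>K\<close>; this is why a window is isolated before any cutting. The logarithm in the
  potential pays for the edges cut: the lighter part of a split has at most half of the volume, so
  the split gains a constant multiple of that part. All sets followed keep a volume of at least
  \<open>3 \<delta> / (16 K)\<close> times that of \<open>B\<close>, so for suitable
  \<open>h\<close> the logarithm contributes at most \<open>\<lambda> / 2\<close>. Then
  \<open>\<lambda> / 8 + \<lambda> / 2 = 5 \<lambda> / 8\<close>, and the remaining 3/8 is the
  constant of the size bound. The squared logarithm of \<open>\<delta>\<close> stems from the square
  of \<open>h\<close> in Cheeger's inequality. As \<open>h\<close> is built from transcendental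
  quantities, the program maximizes the sweep density instead of testing it: one candidate of
  density \<open>h\<close> forces the maximum to be at least \<open>h\<close>.\<close>

section \<open>The second eigenvalue of a symmetric matrix\<close>

lemma real_rooted_factorization:
  fixes p :: "real poly"
  assumes "p \<noteq> 0" and "\<And>z :: complex. poly (map_poly of_real p) z = 0 \<Longrightarrow> z \<in> \<real>"
  shows "p = Polynomial.smult (lead_coeff p) (\<Prod>x\<in>#proots p. [:- x, 1:]) \<and> size (proots p) = degree p"
  using assms
proof (induction "degree p" arbitrary: p)
  case 0
  then obtain c where c: "p = [:c:]" by (metis degree_eq_zeroE)
  then show ?case using 0 by auto
next
  case (Suc d)
  let ?q = "map_poly complex_of_real p"
  have "degree ?q = Suc d" using Suc by (simp add: degree_map_poly)
  then have "\<not> constant (poly ?q)" using constant_degree[of ?q] by simp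
  then obtain z where z: "poly ?q z = 0" using fundamental_theorem_of_algebra by blast
  then obtain r where r: "z = of_real r" using Suc.prems(2) Reals_cases by blast
  have "poly p r = 0" using z unfolding r by simp
  then obtain q where q: "p = [:- r, 1:] * q" using poly_eq_0_iff_dvd by blast
  have q0: "q \<noteq> 0" using Suc.prems(1) q by auto
  have d: "degree p = Suc (degree q)" unfolding q using q0 by (subst degree_mult_eq) auto
  have qq: "?q = [:- of_real r, 1:] * map_poly of_real q"
    unfolding q by (intro poly_eqI) (simp add: coeff_map_poly coeff_pCons split: nat.split)
  have "z' \<in> \<real>" if "poly (map_poly of_real q) z' = 0" for z' :: complex
    using Suc.prems(2)[of z'] that unfolding qq by simp
  then have IH: "q = Polynomial.smult (lead_coeff q) (\<Prod>x\<in>#proots q. [:- x, 1:])" "size (proots q) = degree q"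
    using Suc.hyps(1)[of q] Suc.hyps(2) d q0 by auto
  have pr: "proots p = add_mset r (proots q)"
    unfolding q by (subst proots_mult) (use q0 in auto)
  have lc: "lead_coeff p = lead_coeff q" unfolding q lead_coeff_mult by simp
  have "p = [:- r, 1:] * Polynomial.smult (lead_coeff q) (\<Prod>x\<in>#proots q. [:- x, 1:])" using q IH(1) by simp
  also have "\<dots> = Polynomial.smult (lead_coeff p) (\<Prod>x\<in>#proots p. [:- x, 1:])"
    unfolding lc pr by (simp only: image_mset_add_mset prod_mset.add_mset mult_smult_right)
  finally show ?case using pr IH(2) d by simp
qed

lemma char_poly_root_eigenfunction:
  fixes A :: "'a :: field mat"
  assumes A: "A \<in> carrier_mat n n" and "poly (char_poly A) k = 0"
  obtains f where "\<exists>i<n. f i \<noteq> 0" "\<And>i. i < n \<Longrightarrow> (\<Sum>j<n. A $$ (i, j) * f j) = k * f i"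
proof -
  have "eigenvalue A k" using assms eigenvalue_root_char_poly by blast
  then obtain v where v: "v \<in> carrier_vec n" "v \<noteq> 0\<^sub>v n" "A *\<^sub>v v = k \<cdot>\<^sub>v v"
    using A unfolding eigenvalue_def eigenvector_def by auto
  show ?thesis
  proof (rule that[of "\<lambda>i. v $ i"])
    show "\<exists>i<n. v $ i \<noteq> 0" using v by (metis carrier_vecD eq_vecI index_zero_vec)
    fix i assume i: "i < n"
    have "(\<Sum>j<n. A $$ (i, j) * v $ j) = (A *\<^sub>v v) $ i"
      using A v(1) i by (simp add: scalar_prod_def lessThan_atLeast0)
    then show "(\<Sum>j<n. A $$ (i, j) * v $ j) = k * v $ i" using v i by simp
  qed
qed

text \<open>For a complex eigenfunction \<open>f\<close> the form \<open>?Q\<close> equals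
  \<open>z\<close> times the squared norm of \<open>f\<close>, and symmetry makes it its own
  conjugate.\<close>

lemma symmetric_char_poly_root_real:
  assumes A: "A \<in> carrier_mat n n"
    and sym: "\<And>i j. i < n \<Longrightarrow> j < n \<Longrightarrow> A $$ (i, j) = (A $$ (j, i) :: real)"
    and root: "poly (map_poly of_real (char_poly A)) (z :: complex) = 0"
  shows "z \<in> \<real>"
proof -
  let ?B = "map_mat complex_of_real A"
  have B: "?B \<in> carrier_mat n n" using A by simp
  have "poly (char_poly ?B) z = 0" using root of_real_hom.char_poly_hom[OF A, where ?'a = complex] by simp
  then obtain f where f: "\<exists>i<n. f i \<noteq> 0"
    "\<And>i. i < n \<Longrightarrow> (\<Sum>j<n. ?B $$ (i, j) * f j) = z * f i"
    using char_poly_root_eigenfunction[OF B] by blast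
  let ?Q = "\<Sum>i<n. \<Sum>j<n. cnj (f i) * of_real (A $$ (i, j)) * f j"
  have "?Q = (\<Sum>i<n. cnj (f i) * (\<Sum>j<n. ?B $$ (i, j) * f j))"
    using A by (intro sum.cong refl) (simp add: sum_distrib_left mult.assoc)
  also have "\<dots> = z * of_real (\<Sum>i<n. (cmod (f i))\<^sup>2)"
    using f(2) by (simp add: sum_distrib_left mult_ac complex_norm_square del: of_real_power)
  finally have Q: "?Q = z * of_real (\<Sum>i<n. (cmod (f i))\<^sup>2)" .
  have "cnj ?Q = (\<Sum>i<n. \<Sum>j<n. f i * of_real (A $$ (i, j)) * cnj (f j))" by simp
  also have "\<dots> = (\<Sum>i<n. \<Sum>j<n. f j * of_real (A $$ (j, i)) * cnj (f i))" by (rule sum.swap)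
  also have "\<dots> = ?Q" using sym by (intro sum.cong refl) (simp add: mult_ac)
  finally have "cnj ?Q = ?Q" .
  then have "cnj z * of_real (\<Sum>i<n. (cmod (f i))\<^sup>2) = z * of_real (\<Sum>i<n. (cmod (f i))\<^sup>2)"
    unfolding Q complex_cnj_mult complex_cnj_complex_of_real .
  moreover have "(\<Sum>i<n. (cmod (f i))\<^sup>2) \<noteq> 0"
    using f(1) by (subst sum_nonneg_eq_0_iff) auto
  ultimately have "cnj z = z" by (metis mult_right_cancel of_real_eq_0_iff)
  then show ?thesis by (simp add: Reals_cnj_iff)
qed

lemma symmetric_char_poly_factorization:
  fixes A :: "real mat"
  assumes A: "A \<in> carrier_mat n n"
    and sym: "\<And>i j. i < n \<Longrightarrow> j < n \<Longrightarrow> A $$ (i, j) = A $$ (j, i)"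
  shows "char_poly A = (\<Prod>x\<in>#proots (char_poly A). [:- x, 1:])" "size (proots (char_poly A)) = n"
proof -
  have m: "degree (char_poly A) = n" "lead_coeff (char_poly A) = 1"
    using degree_monic_char_poly[OF A] by auto
  then have "char_poly A \<noteq> 0" by auto
  from real_rooted_factorization[OF this symmetric_char_poly_root_real[OF A sym]]
  show "char_poly A = (\<Prod>x\<in>#proots (char_poly A). [:- x, 1:])" "size (proots (char_poly A)) = n"
    using m by auto
qed

lemma prod_mset_neg_sign:
  assumes "\<And>x. x \<in># M \<Longrightarrow> (x :: real) > 0"
  shows "(- 1) ^ size M * (\<Prod>x\<in>#M. - x) > 0"
  using assms
proof (induction M)
  case (add x M)
  then have "x * ((- 1) ^ size M * (\<Prod>x\<in>#M. - x)) > 0" by simp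
  then show ?case by (simp add: mult_ac)
qed simp

text \<open>All roots are positive, and the value at 0 is the product of the negated roots. In
  \<open>second_root_ge\<close> this determines the sign contributed by each principal
  submatrix.\<close>

lemma positive_definite_char_poly_0:
  fixes A :: "real mat"
  assumes A: "A \<in> carrier_mat n n"
    and sym: "\<And>i j. i < n \<Longrightarrow> j < n \<Longrightarrow> A $$ (i, j) = A $$ (j, i)"
    and pd: "\<And>f. \<exists>i<n. f i \<noteq> 0 \<Longrightarrow> (\<Sum>i<n. \<Sum>j<n. f i * A $$ (i, j) * f j) > 0"
  shows "(- 1) ^ n * poly (char_poly A) 0 > 0"
proof -
  have "x > 0" if "x \<in># proots (char_poly A)" for x
  proof -
    have nz: "char_poly A \<noteq> 0" using degree_monic_char_poly[OF A] by auto
    then have "poly (char_poly A) x = 0" using that by simp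
    from char_poly_root_eigenfunction[OF A this] obtain f where f: "\<exists>i<n. f i \<noteq> 0"
      "\<And>i. i < n \<Longrightarrow> (\<Sum>j<n. A $$ (i, j) * f j) = x * f i" by blast
    have "(\<Sum>i<n. \<Sum>j<n. f i * A $$ (i, j) * f j) = (\<Sum>i<n. f i * (\<Sum>j<n. A $$ (i, j) * f j))"
      by (simp add: sum_distrib_left mult.assoc)
    also have "\<dots> = x * (\<Sum>i<n. f i * f i)" using f(2) by (simp add: sum_distrib_left mult_ac)
    finally have "x * (\<Sum>i<n. f i * f i) > 0" using pd[OF f(1)] by simp
    moreover have "(\<Sum>i<n. f i * f i) \<ge> 0" by (intro sum_nonneg) simp
    ultimately show "x > 0" by (simp add: zero_less_mult_iff)
  qed
  then have "(- 1) ^ size (proots (char_poly A)) * (\<Prod>x\<in>#proots (char_poly A). - x) > 0"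
    by (rule prod_mset_neg_sign)
  moreover have "poly (char_poly A) 0 = (\<Prod>x\<in>#proots (char_poly A). - x)"
    by (subst symmetric_char_poly_factorization(1)[OF A sym])
      (simp_all add: poly_prod_mset multiset.map_comp comp_def image_mset.compositionality)
  ultimately show ?thesis using symmetric_char_poly_factorization(2)[OF A sym] by simp
qed

text \<open>Eigenfunctions of nonzero eigenvalues are orthogonal to the constants, so
  \<open>gap\<close> bounds these eigenvalues. It remains to see that 0 is a simple root. The
  derivative of the characteristic polynomial is the sum of the characteristic polynomials of the
  principal submatrices; these are positive definite, so at 0 all summands have the same sign and
  cannot cancel.\<close>

lemma second_root_ge:
  fixes A :: "real mat"
  assumes A: "A \<in> carrier_mat n n" and n: "2 \<le> n" and \<theta>: "\<theta> > 0"
    and sym: "\<And>i j. i < n \<Longrightarrow> j < n \<Longrightarrow> A $$ (i, j) = A $$ (j, i)"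
    and rows: "\<And>i. i < n \<Longrightarrow> (\<Sum>j<n. A $$ (i, j)) = 0"
    and gap: "\<And>f. (\<Sum>i<n. f i) = 0 \<Longrightarrow> (\<Sum>i<n. \<Sum>j<n. f i * A $$ (i, j) * f j) \<ge> \<theta> * (\<Sum>i<n. (f i)\<^sup>2)"
  shows "sorted_list_of_multiset (proots (char_poly A)) ! 1 \<ge> \<theta>"
proof -
  let ?p = "char_poly A" and ?xs = "sorted_list_of_multiset (proots (char_poly A))"
  have p0: "?p \<noteq> 0" using degree_monic_char_poly[OF A] by auto
  have cols: "(\<Sum>i<n. A $$ (i, j)) = 0" if "j < n" for j
    using rows[OF that] sym that by (metis (no_types, lifting) lessThan_iff sum.cong)
  have big: "x \<ge> \<theta>" if "poly ?p x = 0" "x \<noteq> 0" for x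
  proof -
    from char_poly_root_eigenfunction[OF A that(1)] obtain f where f: "\<exists>i<n. f i \<noteq> 0"
      "\<And>i. i < n \<Longrightarrow> (\<Sum>j<n. A $$ (i, j) * f j) = x * f i" by blast
    have "x * (\<Sum>i<n. f i) = (\<Sum>i<n. \<Sum>j<n. A $$ (i, j) * f j)" using f(2) by (simp add: sum_distrib_left)
    also have "\<dots> = (\<Sum>j<n. (\<Sum>i<n. A $$ (i, j)) * f j)" by (subst sum.swap) (simp add: sum_distrib_right)
    also have "\<dots> = 0" using cols by simp
    finally have "(\<Sum>i<n. f i) = 0" using that by simp
    from gap[OF this] have "\<theta> * (\<Sum>i<n. (f i)\<^sup>2) \<le> (\<Sum>i<n. f i * (\<Sum>j<n. A $$ (i, j) * f j))"
      by (simp add: sum_distrib_left mult.assoc)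
    also have "\<dots> = x * (\<Sum>i<n. (f i)\<^sup>2)" using f(2) by (simp add: sum_distrib_left mult_ac power2_eq_square)
    finally have "\<theta> * (\<Sum>i<n. (f i)\<^sup>2) \<le> x * (\<Sum>i<n. (f i)\<^sup>2)" .
    moreover have "(\<Sum>i<n. (f i)\<^sup>2) > 0" using f(1) by (auto intro!: sum_pos2)
    ultimately show ?thesis by simp
  qed
  \<comment> \<open>A nonzero \<open>g\<close> that vanishes somewhere is not constant, so removing
    its mean leaves a nonzero vector for \<open>gap\<close>. The mean contributes nothing because
    rows and columns sum to 0.\<close>
  have pd: "(\<Sum>a<n. \<Sum>b<n. g a * A $$ (a, b) * g b) > 0"
    if i: "i < n" and gi: "g i = 0" and j: "j < n" "g j \<noteq> 0" for g i j
  proof -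
    define c where "c = (\<Sum>a<n. g a) / n"
    define f where "f a = g a - c" for a
    have s0: "(\<Sum>a<n. f a) = 0" using n by (simp add: f_def sum_subtractf c_def)
    obtain k where "k < n" "f k \<noteq> 0" using gi i j by (cases "f i = 0") (auto simp: f_def)
    then have "(\<Sum>a<n. (f a)\<^sup>2) > 0" by (intro sum_pos2[of _ k]) auto
    then have "0 < \<theta> * (\<Sum>a<n. (f a)\<^sup>2)" using \<theta> by simp
    also have "\<dots> \<le> (\<Sum>a<n. \<Sum>b<n. f a * A $$ (a, b) * f b)" by (rule gap[OF s0])
    also have "\<dots> = (\<Sum>a<n. f a * (\<Sum>b<n. A $$ (a, b) * g b) - c * f a * (\<Sum>b<n. A $$ (a, b)))"
      by (simp add: f_def algebra_simps sum_distrib_left sum.distrib sum_subtractf)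
    also have "\<dots> = (\<Sum>a<n. f a * (\<Sum>b<n. A $$ (a, b) * g b))" using rows by simp
    also have "\<dots> = (\<Sum>a<n. \<Sum>b<n. g a * A $$ (a, b) * g b) - (\<Sum>a<n. \<Sum>b<n. c * (A $$ (a, b) * g b))"
      by (simp add: f_def algebra_simps sum_distrib_left sum.distrib sum_subtractf)
    also have "(\<Sum>a<n. \<Sum>b<n. c * (A $$ (a, b) * g b)) = (\<Sum>b<n. c * (\<Sum>a<n. A $$ (a, b)) * g b)"
      by (subst sum.swap) (simp add: sum_distrib_left sum_distrib_right mult_ac)
    also have "\<dots> = 0" using cols by simp
    finally show ?thesis by simp
  qed
  have minor: "(- 1) ^ (n - 1) * poly (char_poly (mat_delete A i i)) 0 > 0" if i: "i < n" for i
  proof (rule positive_definite_char_poly_0)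
    show "mat_delete A i i \<in> carrier_mat (n - 1) (n - 1)" by (rule mat_delete_carrier[OF A])
    have idx: "mat_delete A i i $$ (a, b) = A $$ (insert_index i a, insert_index i b)"
      if "a < n - 1" "b < n - 1" for a b
      using A i that by (auto simp: mat_delete_def insert_index_def)
    have lt: "insert_index i a < n" if "a < n - 1" for a
      using that by (auto simp: insert_index_def)
    show "mat_delete A i i $$ (a, b) = mat_delete A i i $$ (b, a)" if "a < n - 1" "b < n - 1" for a b
      using that sym lt by (simp add: idx)
    fix f :: "nat \<Rightarrow> real" assume "\<exists>j<n - 1. f j \<noteq> 0"
    then obtain j where j: "j < n - 1" "f j \<noteq> 0" by auto
    define g where "g a = (if a = i then 0 else if a < i then f a else f (a - 1))" for a
    have gi: "g (insert_index i a) = f a" for a by (auto simp: g_def insert_index_def)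
    have bij: "bij_betw (insert_index i) {..<n - 1} ({..<n} - {i})"
      using insert_index_image[of i "n - 1"] i
      by (auto simp: bij_betw_def insert_index_def inj_on_def lessThan_atLeast0 split: if_splits)
    have red: "(\<Sum>a<n. h a) = (\<Sum>a<n - 1. h (insert_index i a))" if "h i = 0" for h :: "nat \<Rightarrow> real"
      unfolding sum.reindex_bij_betw[OF bij, of h] using i that by (subst sum.remove[of _ i]) auto
    have "0 < (\<Sum>a<n. \<Sum>b<n. g a * A $$ (a, b) * g b)"
      by (rule pd[OF i, of g "insert_index i j"]) (use j lt gi in \<open>auto simp: g_def\<close>)
    also have "\<dots> = (\<Sum>a<n - 1. \<Sum>b<n - 1. f a * mat_delete A i i $$ (a, b) * f b)"
      by (subst red, simp add: g_def, subst red, simp add: g_def) (simp add: gi idx)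
    finally show "0 < (\<Sum>a<n - 1. \<Sum>b<n - 1. f a * mat_delete A i i $$ (a, b) * f b)" .
  qed
  have "(- 1) ^ (n - 1) * poly (pderiv ?p) 0 = (\<Sum>i<n. (- 1) ^ (n - 1) * poly (char_poly (mat_delete A i i)) 0)"
    unfolding pderiv_char_poly[OF A] poly_sum sum_distrib_left ..
  also have "\<dots> > 0" using minor n by (intro sum_pos2[of _ 0]) (auto intro: less_imp_le)
  finally have pd0: "poly (pderiv ?p) 0 \<noteq> 0" by auto
  have cnt: "count (proots ?p) 0 \<le> 1"
  proof (rule ccontr)
    assume "\<not> ?thesis"
    then have "[:- 0, 1:] ^ 2 dvd ?p"
      using p0 by (metis count_proots order_divides not_less_eq_eq numeral_2_eq_2 One_nat_def)
    then obtain q where "?p = [:- 0, 1:] ^ 2 * q" by auto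
    then show False using pd0 by (simp add: pderiv_mult power2_eq_square pderiv_pCons)
  qed
  have len: "length ?xs = n" using symmetric_char_poly_factorization(2)[OF A sym]
    by (metis size_mset mset_sorted_list_of_multiset)
  have mem: "?xs ! i = 0 \<or> ?xs ! i \<ge> \<theta>" if "i < n" for i
  proof -
    have "?xs ! i \<in># proots ?p" using that len by (metis nth_mem set_sorted_list_of_multiset)
    then show ?thesis using big p0 by auto
  qed
  show ?thesis
  proof (rule ccontr)
    assume "\<not> ?thesis"
    then have x1: "?xs ! 1 = 0" using mem[of 1] n by auto
    have "?xs ! 0 \<le> ?xs ! 1" using sorted_nth_mono[of ?xs 0 1] len n by simp
    then have x0: "?xs ! 0 = 0" using mem[of 0] n x1 \<theta> by auto
    obtain ys where "?xs = 0 # 0 # ys"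
      using x0 x1 len n by (cases ?xs; cases "tl ?xs") auto
    then have "count (mset ?xs) 0 \<ge> 2" by simp
    then show False using cnt by simp
  qed
qed

lemma lambda2_ge:
  assumes S: "finite S" "2 \<le> card S" and \<theta>: "\<theta> > 0"
    and sym: "\<And>a b. a \<in> S \<Longrightarrow> b \<in> S \<Longrightarrow> A a b = A b a"
    and rows: "\<And>a. a \<in> S \<Longrightarrow> (\<Sum>b\<in>S. A a b) = 0"
    and gap: "\<And>z. (\<Sum>a\<in>S. z a) = 0 \<Longrightarrow> (\<Sum>a\<in>S. \<Sum>b\<in>S. z a * A a b * z b) \<ge> \<theta> * (\<Sum>a\<in>S. (z a)\<^sup>2)"
  shows "lambda2 S A \<ge> \<theta>"
proof -
  let ?l = "sorted_list_of_set S" and ?m = "card S"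
  have bij: "bij_betw (nth ?l) {..<?m} S"
    using S by (intro bij_betw_nth) auto
  have red: "(\<Sum>i<?m. h (?l ! i)) = (\<Sum>a\<in>S. h a)" for h :: "nat \<Rightarrow> real"
    by (rule sum.reindex_bij_betw[OF bij])
  have mem: "?l ! i \<in> S" if "i < ?m" for i using bij that by (auto simp: bij_betw_def)
  show ?thesis unfolding lambda2_def
  proof (rule second_root_ge[OF _ S(2) \<theta>])
    show "matrix_on S A \<in> carrier_mat ?m ?m" by (simp add: matrix_on_def)
    show "matrix_on S A $$ (i, j) = matrix_on S A $$ (j, i)" if "i < ?m" "j < ?m" for i j
      using that sym mem by (simp add: matrix_on_def)
    show "(\<Sum>j<?m. matrix_on S A $$ (i, j)) = 0" if "i < ?m" for i
      using that rows[OF mem[OF that]] by (simp add: matrix_on_def red)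
    fix f :: "nat \<Rightarrow> real" assume f: "(\<Sum>i<?m. f i) = 0"
    define z where "z a = f (the_inv_into {..<?m} (nth ?l) a)" for a
    have z: "z (?l ! i) = f i" if "i < ?m" for i
      using bij that by (simp add: z_def the_inv_into_f_f bij_betw_def)
    have "(\<Sum>a\<in>S. z a) = 0" using f by (simp add: red[symmetric] z)
    from gap[OF this] show "\<theta> * (\<Sum>i<?m. (f i)\<^sup>2) \<le> (\<Sum>i<?m. \<Sum>j<?m. f i * matrix_on S A $$ (i, j) * f j)"
      by (simp add: red[symmetric] z matrix_on_def)
  qed
qed

section \<open>A language of bounded loops\<close>

text \<open>The only loop runs as often as cell 0 of array 0 says, which holds \<open>n\<close>.
  Termination is thus structural, and the nesting depth is what governs the degree of the running
  time.\<close>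

datatype lcom =
    LStore nat aexp aexp
  | LSeq lcom lcom
  | LIf aexp aexp lcom lcom
  | LFor nat lcom

abbreviation var :: "nat \<Rightarrow> aexp" where
  "var a \<equiv> Get a (Const 0)"

fun compile :: "lcom \<Rightarrow> com" where
  "compile (LStore a i e) = Store a i e"
| "compile (LSeq c d) = Seq (compile c) (compile d)"
| "compile (LIf e f c d) = IfLess e f (compile c) (compile d)"
| "compile (LFor i c) = Seq (Store i (Const 0) (Const 0))
     (WhileLess (var i) (var 0) (Seq (compile c) (Store i (Const 0) (Add (var i) (Const 1)))))"

definition upd :: "memory \<Rightarrow> nat \<Rightarrow> int \<Rightarrow> int \<Rightarrow> memory" where
  "upd m a i v = m(a := (m a)(i := v))"

lemma upd_apply: "upd m a i v b j = (if b = a \<and> j = i then v else m b j)"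
  by (simp add: upd_def)

fun for_loop :: "(memory \<Rightarrow> memory) \<Rightarrow> nat \<Rightarrow> nat \<Rightarrow> memory \<Rightarrow> memory" where
  "for_loop f i 0 m = upd m i 0 0"
| "for_loop f i (Suc k) m = upd (f (for_loop f i k m)) i 0 (int (Suc k))"

fun den :: "lcom \<Rightarrow> memory \<Rightarrow> memory" where
  "den (LStore a i e) m = upd m a (aval i m) (aval e m)"
| "den (LSeq c d) m = den d (den c m)"
| "den (LIf e f c d) m = (if aval e m < aval f m then den c m else den d m)"
| "den (LFor i c) m = for_loop (den c) i (nat (m 0 0)) m"

fun writes :: "lcom \<Rightarrow> nat set" where
  "writes (LStore a i e) = {a}"
| "writes (LSeq c d) = writes c \<union> writes d"
| "writes (LIf e f c d) = writes c \<union> writes d"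
| "writes (LFor i c) = insert i (writes c)"

fun read_only :: "aexp \<Rightarrow> bool" where
  "read_only (Get a i) = (a < 6)"
| "read_only _ = False"

text \<open>
  Multiplying only by input values keeps the growth of bit lengths additive, so that a nest of
  loops of polynomial length never creates numbers of more than polynomially many bits.
\<close>

fun tame :: "aexp \<Rightarrow> bool" where
  "tame (Const k) = True"
| "tame (Get a i) = True"
| "tame (Add e f) = (tame e \<and> tame f)"
| "tame (Sub e f) = (tame e \<and> tame f)"
| "tame (Mul e f) = (tame e \<and> read_only f)"
| "tame (Div e f) = tame e"

text \<open>Arrays 0 to 5 hold the input. Protecting them keeps the loop bound and all multipliers
  fixed throughout a run, and a body that leaves its own counter alone cannot prolong its
  loop.\<close>

fun well_formed :: "lcom \<Rightarrow> bool" where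
  "well_formed (LStore a i e) = (6 \<le> a \<and> tame e)"
| "well_formed (LSeq c d) = (well_formed c \<and> well_formed d)"
| "well_formed (LIf e f c d) = (well_formed c \<and> well_formed d)"
| "well_formed (LFor i c) = (6 \<le> i \<and> i \<notin> writes c \<and> well_formed c)"

lemma for_loop_frame:
  assumes "\<And>m. f m a = m a" "a \<noteq> i"
  shows "for_loop f i k m a = m a"
  using assms by (induction k) (auto simp: upd_def)

lemma den_frame: "a \<notin> writes c \<Longrightarrow> den c m a = m a"
proof (induction c arbitrary: m)
  case (LFor i c)
  then show ?case by (simp add: for_loop_frame)
qed (auto simp: upd_def)

lemma writes_ge: "well_formed c \<Longrightarrow> a < 6 \<Longrightarrow> a \<notin> writes c"
  by (induction c) auto

lemma den_input: "well_formed c \<Longrightarrow> a < 6 \<Longrightarrow> den c m a = m a"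
  by (simp add: den_frame writes_ge)

lemma for_loop_input: "well_formed c \<Longrightarrow> a < 6 \<Longrightarrow> 6 \<le> i \<Longrightarrow> for_loop (den c) i k m a = m a"
  by (intro for_loop_frame) (auto simp: den_input)

lemma for_loop_counter: "for_loop f i k m i 0 = int k"
  by (cases k) (auto simp: upd_def)

section \<open>Bit lengths and the cost of expressions\<close>

lemma bits_le_iff: "bits k \<le> Suc B \<longleftrightarrow> \<bar>k\<bar> < 2 ^ B"
proof -
  have "bits k \<le> Suc B \<longleftrightarrow> nat \<bar>k\<bar> < 2 ^ B"
    unfolding bits_def using floorlog_leD[of 2 "nat \<bar>k\<bar>" B] floorlog_leI[of "nat \<bar>k\<bar>" 2 B] by auto
  also have "\<dots> \<longleftrightarrow> \<bar>k\<bar> < 2 ^ B" by (simp add: nat_less_iff)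
  finally show ?thesis .
qed

lemma bits_0_1: "bits 0 = 1" "bits 1 = 2"
  by (simp_all add: bits_def floorlog_def)

lemma bits_pos: "0 < bits k"
  by (simp add: bits_def)

lemma bits_mono: "\<bar>k\<bar> \<le> \<bar>l\<bar> \<Longrightarrow> bits k \<le> bits l"
proof -
  assume a: "\<bar>k\<bar> \<le> \<bar>l\<bar>"
  obtain B where B: "bits l = Suc B" using bits_pos[of l] by (cases "bits l") auto
  then have "\<bar>l\<bar> < 2 ^ B" using bits_le_iff[of l B] by simp
  then show ?thesis using a B bits_le_iff[of k B] by simp
qed

lemma bits_add: "bits a \<le> B \<Longrightarrow> bits b \<le> B \<Longrightarrow> bits (a + b) \<le> Suc B"
  using bits_le_iff[of a "B - 1"] bits_le_iff[of b "B - 1"] bits_le_iff[of "a + b" B] bits_pos[of a]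
  by (cases B) auto

lemma bits_uminus: "bits (- a) = bits a"
  by (simp add: bits_def)

lemma bits_diff: "bits a \<le> B \<Longrightarrow> bits b \<le> B \<Longrightarrow> bits (a - b) \<le> Suc B"
  using bits_add[of a B "- b"] by (simp add: bits_uminus)

lemma bits_mult: "bits (a * b) \<le> bits a + bits b"
proof -
  obtain p q where pq: "bits a = Suc p" "bits b = Suc q"
    using bits_pos[of a] bits_pos[of b] by (cases "bits a"; cases "bits b") auto
  then have "\<bar>a\<bar> < 2 ^ p" "\<bar>b\<bar> < 2 ^ q" using bits_le_iff[of a p] bits_le_iff[of b q] by auto
  then have "\<bar>a\<bar> * \<bar>b\<bar> < 2 ^ p * 2 ^ q" by (intro mult_strict_mono') auto
  then have "bits (a * b) \<le> Suc (p + q)" unfolding bits_le_iff by (simp add: abs_mult power_add)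
  then show ?thesis using pq by simp
qed

text \<open>Floor division rounds a negative quotient away from 0, but for a positive divisor never
  beyond the dividend. The case \<open>b = 0\<close> rests on \<open>a div 0 = 0\<close>.\<close>

lemma abs_div_le: "\<bar>a div b :: int\<bar> \<le> \<bar>a\<bar>"
proof -
  have pos: "\<bar>a div b\<bar> \<le> \<bar>a\<bar>" if "b > 0" for a b :: int
  proof (cases "a \<ge> 0")
    case True
    then have "0 \<le> a div b" "a div b \<le> a"
      using that pos_imp_zdiv_nonneg_iff[of b a] zdiv_mono2[of a 1 b] by auto
    then show ?thesis using True by simp
  next
    case False
    then have "a div b < 0" using that by (simp add: pos_imp_zdiv_neg_iff)
    moreover have "a div 1 \<le> a div b" using False that by (intro zdiv_mono2_neg) auto
    ultimately show ?thesis by simp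
  qed
  show ?thesis
  proof (cases "b = 0")
    case False
    then show ?thesis using pos[of b a] pos[of "- b" "- a"] by (cases "b > 0") auto
  qed simp
qed

lemma bits_div: "bits (a div b) \<le> bits a"
  by (rule bits_mono[OF abs_div_le])

fun esize :: "aexp \<Rightarrow> nat" where
  "esize (Const k) = bits k"
| "esize (Get a i) = Suc (esize i)"
| "esize (Add e f) = Suc (esize e + esize f)"
| "esize (Sub e f) = Suc (esize e + esize f)"
| "esize (Mul e f) = Suc (esize e + esize f)"
| "esize (Div e f) = Suc (esize e + esize f)"

definition bounded_mem :: "memory \<Rightarrow> nat \<Rightarrow> bool" where
  "bounded_mem m B \<longleftrightarrow> (\<forall>a i. bits (m a i) \<le> B)"

lemma bounded_mem_pos: "bounded_mem m B \<Longrightarrow> 1 \<le> B"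
  using bits_pos unfolding bounded_mem_def by (metis One_nat_def Suc_leI le_trans)

lemma bounded_mem_mono: "bounded_mem m B \<Longrightarrow> B \<le> B' \<Longrightarrow> bounded_mem m B'"
  unfolding bounded_mem_def using le_trans by blast

lemma bounded_mem_upd: "bounded_mem m B \<Longrightarrow> bits v \<le> B \<Longrightarrow> bounded_mem (upd m a i v) B"
  unfolding bounded_mem_def by (simp add: upd_apply)

lemma bits_aval: assumes m: "bounded_mem m B" shows "bits (aval e m) \<le> esize e * B"
proof (induction e)
  case (Const k)
  then show ?case using bounded_mem_pos[OF m] by simp
next
  case (Get a i)
  have "bits (m a (aval i m)) \<le> B" using m by (simp add: bounded_mem_def)
  then show ?case by simp
next
  case (Add e f)
  have "bits (aval e m + aval f m) \<le> Suc (esize e * B + esize f * B)" using Add by (intro bits_add) auto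
  then show ?case using bounded_mem_pos[OF m] by (simp add: algebra_simps)
next
  case (Sub e f)
  have "bits (aval e m - aval f m) \<le> Suc (esize e * B + esize f * B)" using Sub by (intro bits_diff) auto
  then show ?case using bounded_mem_pos[OF m] by (simp add: algebra_simps)
next
  case (Mul e f)
  then show ?case using bits_mult[of "aval e m" "aval f m"] by (simp add: algebra_simps)
next
  case (Div e f)
  then show ?case using bits_div[of "aval e m" "aval f m"] by (simp add: algebra_simps)
qed

lemma acost_le: assumes m: "bounded_mem m B" shows "acost e m \<le> (esize e)\<^sup>2 * B"
proof -
  have bin: "a + b + c \<le> (Suc (p + q))\<^sup>2 * B"
    if "a \<le> p\<^sup>2 * B" "b \<le> q\<^sup>2 * B" "c \<le> Suc (p + q) * B" for a b c p q :: nat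
  proof -
    have "a + b + c \<le> (p\<^sup>2 + q\<^sup>2 + Suc (p + q)) * B" using that by (simp add: algebra_simps)
    also have "\<dots> \<le> (Suc (p + q))\<^sup>2 * B" by (intro mult_right_mono) (simp_all add: power2_eq_square algebra_simps)
    finally show ?thesis .
  qed
  show ?thesis
  proof (induction e)
    case (Const k)
    have "1 * bits k \<le> (bits k * B) * bits k" using bounded_mem_pos[OF m] bits_pos[of k] by (intro mult_right_mono) auto
    then show ?case by (simp add: power2_eq_square mult_ac)
  next
    case (Get a i)
    have "bits (m a (aval i m)) \<le> B" using m by (simp add: bounded_mem_def)
    then show ?case using Get bin[of "acost i m" "esize i" 0 0 "bits (m a (aval i m))"] by simp
  next
    case (Add e f)
    then show ?case using bin bits_aval[OF m, of "Add e f"] by simp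
  next
    case (Sub e f)
    then show ?case using bin bits_aval[OF m, of "Sub e f"] by simp
  next
    case (Mul e f)
    then show ?case using bin bits_aval[OF m, of "Mul e f"] by simp
  next
    case (Div e f)
    then show ?case using bin bits_aval[OF m, of "Div e f"] by simp
  qed
qed

definition bounded_input :: "memory \<Rightarrow> nat \<Rightarrow> bool" where
  "bounded_input m b \<longleftrightarrow> (\<forall>a<6. \<forall>i. bits (m a i) \<le> b)"

text \<open>Here \<open>B\<close> enters with coefficient 1, whereas \<open>bits_aval\<close>
  multiplies it by \<open>esize e\<close>. Rounds of a loop therefore add to the bit length instead
  of multiplying it.\<close>

lemma bits_aval_tame:
  assumes m: "bounded_mem m B" and b: "bounded_input m b" and "tame e"
  shows "bits (aval e m) \<le> B + esize e * Suc b"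
  using \<open>tame e\<close>
proof (induction e)
  case (Get a i)
  have "bits (m a (aval i m)) \<le> B" using m by (simp add: bounded_mem_def)
  then show ?case by simp
next
  case (Add e f)
  then have "bits (aval e m + aval f m) \<le> Suc (B + (esize e + esize f) * Suc b)"
    by (intro bits_add) (auto simp: algebra_simps)
  then show ?case by (simp add: algebra_simps)
next
  case (Sub e f)
  then have "bits (aval e m - aval f m) \<le> Suc (B + (esize e + esize f) * Suc b)"
    by (intro bits_diff) (auto simp: algebra_simps)
  then show ?case by (simp add: algebra_simps)
next
  case (Mul e f)
  then obtain a i where f: "f = Get a i" "a < 6" by (cases f) auto
  then have "bits (aval f m) \<le> b" using b by (simp add: bounded_input_def)
  then show ?case using Mul bits_mult[of "aval e m" "aval f m"] by (simp add: algebra_simps)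
next
  case (Div e f)
  then show ?case using bits_div[of "aval e m" "aval f m"] by (simp add: algebra_simps)
qed simp

text \<open>The number of bits, in units of \<open>Suc b\<close> and as a polynomial in
  \<open>n\<close>, by which a run may lengthen the longest memory cell when input cells have at
  most \<open>b\<close> bits.\<close>

fun growth :: "lcom \<Rightarrow> nat poly" where
  "growth (LStore a i e) = [:esize e:]"
| "growth (LSeq c d) = growth c + growth d"
| "growth (LIf e f c d) = growth c + growth d"
| "growth (LFor i c) = [:0, 1:] * growth c"

text \<open>A time bound per bit of the longest cell. For a loop, 23 covers the initial store (3)
  and the last test (20), and 40 covers one test and one increment in each round.\<close>

fun work :: "lcom \<Rightarrow> nat poly" where
  "work (LStore a i e) = [:1 + (esize i)\<^sup>2 + (esize e)\<^sup>2:]"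
| "work (LSeq c d) = work c + work d"
| "work (LIf e f c d) = [:1 + (esize e)\<^sup>2 + (esize f)\<^sup>2:] + work c + work d"
| "work (LFor i c) = [:23:] + [:0, 1:] * ([:40:] + work c)"

text \<open>Time and memory are bounded in the same induction, since the cost of a command depends
  on the bit lengths left behind by the commands before it.\<close>

lemma exec_compile:
  assumes "well_formed c" "bounded_mem m B" "bounded_input m b" "m 0 0 = int n"
  shows "\<exists>t. exec (compile c) m t (den c m) \<and> t \<le> poly (work c) n * (B + poly (growth c) n * Suc b)
    \<and> bounded_mem (den c m) (B + poly (growth c) n * Suc b)"
  using assms
proof (induction c arbitrary: m B)
  case (LStore a i e)
  have "1 + acost i m + acost e m \<le> (1 + (esize i)\<^sup>2 + (esize e)\<^sup>2) * B"
    using acost_le[OF LStore(2), of i] acost_le[OF LStore(2), of e] bounded_mem_pos[OF LStore(2)]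
    by (simp add: algebra_simps)
  also have "\<dots> \<le> (1 + (esize i)\<^sup>2 + (esize e)\<^sup>2) * (B + esize e * Suc b)"
    by (intro mult_left_mono) auto
  finally have t: "1 + acost i m + acost e m \<le> (1 + (esize i)\<^sup>2 + (esize e)\<^sup>2) * (B + esize e * Suc b)" .
  have "bounded_mem (upd m a (aval i m) (aval e m)) (B + esize e * Suc b)"
    using LStore(1) bits_aval_tame[OF LStore(2,3), of e]
    by (intro bounded_mem_upd bounded_mem_mono[OF LStore(2)]) auto
  moreover have "exec (compile (LStore a i e)) m (1 + acost i m + acost e m) (den (LStore a i e) m)"
    using exec.Store[of a i e m] by (simp add: upd_def)
  ultimately show ?case using t by (auto intro!: exI[of _ "1 + acost i m + acost e m"])
next
  case (LSeq c d)
  define B1 where "B1 = B + poly (growth c) n * Suc b"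
  define B2 where "B2 = B1 + poly (growth d) n * Suc b"
  have wf: "well_formed c" "well_formed d" using LSeq.prems by auto
  obtain s where s: "exec (compile c) m s (den c m)" "s \<le> poly (work c) n * B1" "bounded_mem (den c m) B1"
    using LSeq.IH(1)[OF wf(1) LSeq.prems(2-4)] unfolding B1_def by auto
  have "bounded_input (den c m) b" "den c m 0 0 = int n"
    using LSeq.prems den_input[OF wf(1)] by (auto simp: bounded_input_def)
  from LSeq.IH(2)[OF wf(2) s(3) this]
  obtain t where t: "exec (compile d) (den c m) t (den d (den c m))" "t \<le> poly (work d) n * B2"
    "bounded_mem (den d (den c m)) B2" unfolding B2_def by auto
  have "poly (work c) n * B1 \<le> poly (work c) n * B2" by (simp add: B2_def)
  then have "s + t \<le> poly (work (LSeq c d)) n * B2"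
    unfolding work.simps poly_add add_mult_distrib using s(2) t(2) by linarith
  moreover have "B2 = B + poly (growth (LSeq c d)) n * Suc b"
    by (simp add: B1_def B2_def algebra_simps)
  ultimately show ?case using exec.Seq[OF s(1) t(1)] t(3) by auto
next
  case (LIf e f c d)
  define B' where "B' = B + poly (growth (LIf e f c d)) n * Suc b"
  have wf: "well_formed c" "well_formed d" using LIf.prems by auto
  have BB: "B + poly (growth c) n * Suc b \<le> B'" "B + poly (growth d) n * Suc b \<le> B'" "B \<le> B'"
    by (auto simp: B'_def algebra_simps)
  let ?d = "if aval e m < aval f m then c else d"
  have "\<exists>t. exec (compile ?d) m t (den ?d m) \<and> t \<le> poly (work ?d) n * B' \<and> bounded_mem (den ?d m) B'"
  proof -
    have "\<exists>t. exec (compile ?d) m t (den ?d m) \<and> t \<le> poly (work ?d) n * (B + poly (growth ?d) n * Suc b)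
      \<and> bounded_mem (den ?d m) (B + poly (growth ?d) n * Suc b)"
      using LIf.IH(1)[OF wf(1) LIf.prems(2-4)] LIf.IH(2)[OF wf(2) LIf.prems(2-4)] by (cases "aval e m < aval f m") auto
    moreover have "B + poly (growth ?d) n * Suc b \<le> B'" using BB by auto
    ultimately show ?thesis by (meson bounded_mem_mono le_trans mult_le_mono2)
  qed
  then obtain t where t: "exec (compile ?d) m t (den ?d m)" "t \<le> poly (work ?d) n * B'"
    "bounded_mem (den ?d m) B'" by blast
  have ex: "exec (compile (LIf e f c d)) m (1 + acost e m + acost f m + t) (den (LIf e f c d) m)"
    using t(1) exec.IfTrue[of e m f "compile c" t _ "compile d"] exec.IfFalse[of e m f "compile d" t _ "compile c"]
    by (cases "aval e m < aval f m") auto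
  have "1 + acost e m + acost f m \<le> (1 + (esize e)\<^sup>2 + (esize f)\<^sup>2) * B"
    using acost_le[OF LIf.prems(2), of e] acost_le[OF LIf.prems(2), of f] bounded_mem_pos[OF LIf.prems(2)]
    by (simp add: algebra_simps)
  also have "\<dots> \<le> (1 + (esize e)\<^sup>2 + (esize f)\<^sup>2) * B'" using BB by (intro mult_left_mono) auto
  finally have "1 + acost e m + acost f m + t \<le> (1 + (esize e)\<^sup>2 + (esize f)\<^sup>2) * B' + poly (work ?d) n * B'"
    using t(2) by simp
  also have "\<dots> \<le> poly (work (LIf e f c d)) n * B'" by (auto simp: algebra_simps)
  finally show ?case using ex t(3) unfolding B'_def by auto
next
  case (LFor i c)
  let ?g = "poly (growth c) n * Suc b" and ?w = "poly (work c) n"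
  let ?body = "Seq (compile c) (Store i (Const 0) (Add (var i) (Const 1)))"
  let ?wh = "WhileLess (var i) (var 0) ?body"
  let ?M = "\<lambda>k. for_loop (den c) i k m"
  define B' where "B' = B + n * ?g"
  have wf: "well_formed c" "6 \<le> i" "i \<notin> writes c" using LFor.prems by auto
  have inp: "?M k a = m a" if "a < 6" for k a
    using for_loop_input[OF wf(1) that wf(2)] .
  have binp: "bounded_input (?M k) b" "?M k 0 0 = int n" for k
    using LFor.prems inp by (auto simp: bounded_input_def)
  have cnt: "?M k i 0 = int k" for k by (rule for_loop_counter)
  have nb: "bits (int k) \<le> B" if "k \<le> n" for k
  proof -
    have "bits (int k) \<le> bits (int n)" using that by (intro bits_mono) auto
    also have "\<dots> \<le> B" using LFor.prems(2,4) unfolding bounded_mem_def by metis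
    finally show ?thesis .
  qed
  have bd: "bounded_mem (?M k) (B + k * ?g)" if "k \<le> n" for k
    using that
  proof (induction k)
    case 0
    then show ?case using LFor.prems(2) nb[of 0] by (auto intro: bounded_mem_upd)
  next
    case (Suc k)
    then have IHk: "bounded_mem (?M k) (B + k * ?g)" by simp
    have "bounded_mem (den c (?M k)) (B + k * ?g + ?g)"
      using LFor.IH[OF wf(1) IHk binp] by blast
    moreover have "bits (int (Suc k)) \<le> B + k * ?g + ?g" using nb[OF Suc.prems] by (simp add: trans_le_add1)
    ultimately show ?case by (simp add: bounded_mem_upd add_ac)
  qed
  have BM: "bounded_mem (?M k) B'" if "k \<le> n" for k
    by (rule bounded_mem_mono[OF bd[OF that]]) (use that in \<open>simp add: B'_def mult_right_mono\<close>)
  have test: "1 + acost (var i) (?M k) + acost (var 0) (?M k) \<le> 20 * B'" if "k \<le> n" for k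
    using acost_le[OF BM[OF that], of "var i"] acost_le[OF BM[OF that], of "var 0"] bounded_mem_pos[OF BM[OF that]]
    by (simp add: bits_0_1 power2_eq_square)
  \<comment> \<open>\<open>WhileTrue\<close> peels off the first round, so the induction is over the
    number \<open>k\<close> of rounds still to come.\<close>
  have loop: "\<exists>t. exec ?wh (?M (n - k)) t (?M n) \<and> t \<le> 20 * B' + k * (40 + ?w) * B'" if "k \<le> n" for k
    using that
  proof (induction k)
    case 0
    have "\<not> aval (var i) (?M n) < aval (var 0) (?M n)" using cnt[of n] binp(2)[of n] by simp
    from exec.WhileFalse[OF this, of ?body] show ?case using test[of n] by auto
  next
    case (Suc k)
    define j where "j = n - Suc k"
    have j: "n - k = Suc j" "j < n" using Suc.prems by (auto simp: j_def)
    obtain s where s: "exec (compile c) (?M j) s (den c (?M j))"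
        "s \<le> ?w * (B + j * ?g + ?g)" "bounded_mem (den c (?M j)) (B + j * ?g + ?g)"
      using LFor.IH[OF wf(1) bd binp, of j] j by auto
    have jj: "B + j * ?g + ?g \<le> B'"
      using mult_right_mono[of "Suc j" n ?g] j by (simp add: B'_def)
    have D: "bounded_mem (den c (?M j)) B'" using s(3) jj by (rule bounded_mem_mono)
    have ci: "den c (?M j) i = ?M j i" using wf(3) by (rule den_frame)
    have st: "exec (Store i (Const 0) (Add (var i) (Const 1))) (den c (?M j))
        (1 + acost (Const 0) (den c (?M j)) + acost (Add (var i) (Const 1)) (den c (?M j))) (?M (Suc j))"
      using exec.Store[of i "Const 0" "Add (var i) (Const 1)" "den c (?M j)"] ci cnt[of j]
      by (simp add: upd_def add_ac)
    have stc: "1 + acost (Const 0) (den c (?M j)) + acost (Add (var i) (Const 1)) (den c (?M j)) \<le> 20 * B'"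
    proof -
      have "bits (den c (?M j) i 0) \<le> B'" using D by (simp add: bounded_mem_def)
      moreover from this have "bits (den c (?M j) i 0 + 1) \<le> B' * 3"
        using bounded_mem_pos[OF D] bits_add[of "den c (?M j) i 0" "B' + 1" 1] by (simp add: bits_0_1)
      ultimately show ?thesis using bounded_mem_pos[OF D] by (simp add: bits_0_1)
    qed
    have lt: "aval (var i) (?M j) < aval (var 0) (?M j)" using cnt[of j] binp(2)[of j] j by simp
    obtain t where t: "exec ?wh (?M (Suc j)) t (?M n)" "t \<le> 20 * B' + k * (40 + ?w) * B'"
      using Suc.IH Suc.prems j by auto
    have "s \<le> ?w * B'" using s(2) jj by (meson le_trans mult_le_mono2)
    then have "1 + acost (var i) (?M j) + acost (var 0) (?M j) +
        (s + (1 + acost (Const 0) (den c (?M j)) + acost (Add (var i) (Const 1)) (den c (?M j)))) + t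
        \<le> 20 * B' + Suc k * (40 + ?w) * B'"
      using test[of j] stc t(2) j by (simp add: algebra_simps)
    with exec.WhileTrue[OF lt exec.Seq[OF s(1) st] t(1)] show ?case unfolding j_def[symmetric] by blast
  qed
  obtain t where t: "exec ?wh (?M 0) t (?M n)" "t \<le> 20 * B' + n * (40 + ?w) * B'"
    using loop[of n] by auto
  have "exec (Store i (Const 0) (Const 0)) m 3 (?M 0)"
    using exec.Store[of i "Const 0" "Const 0" m] by (simp add: upd_def bits_0_1 eval_nat_numeral)
  from exec.Seq[OF this t(1)] have "exec (compile (LFor i c)) m (3 + t) (den (LFor i c) m)"
    using LFor.prems(4) by simp
  moreover have "3 + t \<le> poly (work (LFor i c)) n * B'"
    using t(2) bounded_mem_pos[OF BM[of 0]] by (simp add: algebra_simps)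
  moreover have "bounded_mem (den (LFor i c) m) B'" using BM[of n] LFor.prems(4) by simp
  moreover have "B' = B + poly (growth (LFor i c)) n * Suc b" by (simp add: B'_def algebra_simps)
  ultimately show ?case by blast
qed

lemma poly_nat_mono: "k \<le> l \<Longrightarrow> poly p k \<le> poly p (l :: nat)"
  by (induction p) (auto intro!: mult_mono)

text \<open>Cells outside the listed ranges contain 0, and each listed cell is charged at least one
  bit in the input size. The \<open>n * n\<close> cells of the adjacency matrix give the bound on
  \<open>n\<close>.\<close>

lemma input_memory_bounded:
  "bounded_mem (input_memory n E \<delta> lam x y) (input_size n E \<delta> lam x y)"
  "n \<le> input_size n E \<delta> lam x y"
proof -
  let ?m = "input_memory n E \<delta> lam x y" and ?s = "input_size n E \<delta> lam x y"
  have s5: "5 \<le> ?s"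
  proof -
    have "(\<Sum>i<5::nat. 1) \<le> (\<Sum>i<5. bits (?m 0 (int i)))"
      by (intro sum_mono) (simp add: Suc_leI[OF bits_pos])
    then show ?thesis by (simp add: input_size_def)
  qed
  have arr: "bits (?m a (int k)) \<le> ?s" if "a \<in> {1..5}" "k < n * n" for a k
  proof -
    have "bits (?m a (int k)) \<le> (\<Sum>i<n * n. bits (?m a (int i)))"
      using that by (intro member_le_sum) auto
    also have "\<dots> \<le> (\<Sum>a\<in>{1..5}. \<Sum>i<n * n. bits (?m a (int i)))"
      using that by (intro member_le_sum[of a "{1..5}" "\<lambda>a. \<Sum>i<n * n. bits (?m a (int i))"]) auto
    finally show ?thesis by (simp add: input_size_def)
  qed
  have scal: "bits (?m 0 (int k)) \<le> ?s" if "k < 5" for k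
  proof -
    have "bits (?m 0 (int k)) \<le> (\<Sum>i<5. bits (?m 0 (int i)))"
      using that by (intro member_le_sum) auto
    then show ?thesis by (simp add: input_size_def)
  qed
  have z: "bits 0 \<le> ?s" using s5 by (simp add: bits_0_1)
  show "bounded_mem ?m ?s" unfolding bounded_mem_def
  proof (intro allI)
    fix a i
    have out: "pair_array n F f 0 i = 0" if "\<not> (0 \<le> i \<and> i < int (n * n))" for F f
      using that by (auto simp: pair_array_def)
    have "?m a i = 0" if "a = 0" "\<not> (0 \<le> i \<and> i < 5)"
      using that by (auto simp: input_memory_def)
    moreover have "?m a i = 0" if "\<not> (0 \<le> i \<and> i < int (n * n))" "a \<noteq> 0"
      using out[OF that(1)] that(2) by (simp add: input_memory_def)
    moreover have "?m a i = 0" if "a > 5" using that by (simp add: input_memory_def)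
    ultimately consider "a = 0" "0 \<le> i" "i < 5" | "a \<in> {1..5}" "0 \<le> i" "i < int (n * n)" | "?m a i = 0"
      by (cases "a = 0"; cases "a > 5") fastforce+
    then show "bits (?m a i) \<le> ?s"
    proof cases
      case 1
      then show ?thesis using scal[of "nat i"] by simp
    next
      case 2
      then show ?thesis using arr[of a "nat i"] by (simp add: nat_less_iff)
    qed (use z in simp)
  qed
  have "n \<le> (\<Sum>i<n * n. 1 :: nat)" by simp
  also have "\<dots> \<le> (\<Sum>i<n * n. bits (?m 1 (int i)))" by (intro sum_mono) (simp add: Suc_leI[OF bits_pos])
  also have "\<dots> \<le> (\<Sum>a\<in>{1..5}. \<Sum>i<n * n. bits (?m a (int i)))"
    by (intro member_le_sum[of 1 "{1..5}" "\<lambda>a. \<Sum>i<n * n. bits (?m a (int i))"]) auto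
  finally show "n \<le> ?s" by (simp add: input_size_def)
qed

lemma polynomial_time:
  assumes "well_formed c"
  shows "\<exists>p :: nat poly. \<forall>n E \<delta> lam x y. \<exists>t.
    exec (compile c) (input_memory n E \<delta> lam x y) t (den c (input_memory n E \<delta> lam x y)) \<and>
    t \<le> poly p (input_size n E \<delta> lam x y)"
proof (intro exI[of _ "work c * ([:0, 1:] + growth c * [:1, 1:])"] allI)
  fix n E \<delta> lam x y
  let ?m = "input_memory n E \<delta> lam x y" and ?s = "input_size n E \<delta> lam x y"
  have b: "bounded_mem ?m ?s" "n \<le> ?s" by (rule input_memory_bounded)+
  have "bounded_input ?m ?s" using b(1) by (simp add: bounded_mem_def bounded_input_def)
  moreover have "?m 0 0 = int n" by (simp add: input_memory_def)
  ultimately obtain t where t: "exec (compile c) ?m t (den c ?m)"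
    "t \<le> poly (work c) n * (?s + poly (growth c) n * Suc ?s)"
    using exec_compile[OF assms b(1)] by blast
  \<comment> \<open>Polynomials with natural coefficients are monotone, so the input size may
    replace \<open>n\<close>.\<close>
  have mono: "poly (work c) n \<le> poly (work c) ?s" "poly (growth c) n \<le> poly (growth c) ?s"
    by (intro poly_nat_mono b(2))+
  have "t \<le> poly (work c) ?s * (?s + poly (growth c) ?s * Suc ?s)"
    by (rule order_trans[OF t(2)]) (intro mult_le_mono add_le_mono order_refl mono)
  also have "\<dots> = poly (work c * ([:0, 1:] + growth c * [:1, 1:])) ?s" by simp
  finally show "\<exists>t. exec (compile c) ?m t (den c ?m) \<and>
      t \<le> poly (work c * ([:0, 1:] + growth c * [:1, 1:])) ?s"
    using t(1) by blast
qed

section \<open>Cuts and the semidefinite program\<close>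

definition cut :: "nat set set \<Rightarrow> nat set \<Rightarrow> nat set set" where
  "cut F A = {e \<in> F. card (e \<inter> A) = 1}"

definition between :: "nat set set \<Rightarrow> nat set \<Rightarrow> nat set \<Rightarrow> nat set set" where
  "between F A B = {e \<in> F. e \<inter> A \<noteq> {} \<and> e \<inter> B \<noteq> {}}"

definition edge_diff :: "(nat \<Rightarrow> real) \<Rightarrow> nat set \<Rightarrow> real" where
  "edge_diff z e = \<bar>z (Max e) - z (Min e)\<bar>"

lemma pairsE:
  assumes "e \<in> pairs V"
  obtains u v where "u \<noteq> v" "e = {u, v}" "u \<in> V" "v \<in> V"
  using assms by (auto simp: pairs_def card_2_iff)

lemma finite_pairs: "finite V \<Longrightarrow> finite (pairs V)"
  by (rule finite_subset[of _ "Pow V"]) (auto simp: pairs_def)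

lemma edge_diff_doubleton: "edge_diff z {u, v} = \<bar>z u - z v\<bar>"
  by (auto simp: edge_diff_def max_def min_def)

lemma card_doubleton_Int:
  "u \<noteq> v \<Longrightarrow> card ({u, v} \<inter> A) = 1 \<longleftrightarrow> (u \<in> A) \<noteq> (v \<in> A)"
  by (auto simp: Int_insert_left)

lemma edge_diff_indicator:
  "e \<in> pairs V \<Longrightarrow> edge_diff (\<lambda>u. if u \<in> A then 1 else 0) e = (if card (e \<inter> A) = 1 then 1 else 0)"
  by (elim pairsE) (simp only: edge_diff_doubleton card_doubleton_Int, auto)

lemma edge_mat_form:
  assumes "finite V" and e: "e \<in> pairs V"
  shows "(\<Sum>a\<in>V. \<Sum>b\<in>V. z a * edge_mat e a b * z b) = (edge_diff z e)\<^sup>2"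
proof -
  obtain u v where uv: "u \<noteq> v" "e = {u, v}" "u \<in> V" "v \<in> V" using e by (rule pairsE)
  have "(\<Sum>a\<in>V. pair_vec u v a * z a) = (\<Sum>a\<in>V. (if a = v then z a else 0) - (if a = u then z a else 0))"
    using uv(1) by (intro sum.cong) (auto simp: pair_vec_def)
  also have "\<dots> = z v - z u" using uv assms by (simp add: sum_subtractf)
  finally have s: "(\<Sum>a\<in>V. pair_vec u v a * z a) = z v - z u" .
  have "(\<Sum>a\<in>V. \<Sum>b\<in>V. z a * edge_mat e a b * z b) =
      (\<Sum>a\<in>V. \<Sum>b\<in>V. (pair_vec u v a * z a) * (pair_vec u v b * z b))"
    unfolding uv(2) edge_mat_doubleton[OF uv(1)] pair_mat_def by (simp add: mult_ac)
  also have "\<dots> = (\<Sum>a\<in>V. pair_vec u v a * z a) * (\<Sum>b\<in>V. pair_vec u v b * z b)"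
    by (rule sum_product[symmetric])
  also have "\<dots> = (edge_diff z e)\<^sup>2"
    unfolding s uv(2) edge_diff_doubleton by (simp add: power2_eq_square[symmetric] power2_commute)
  finally show ?thesis .
qed

lemma weighted_laplacian_form:
  assumes "finite V" and F: "F \<subseteq> pairs V"
  shows "(\<Sum>a\<in>V. \<Sum>b\<in>V. z a * weighted_laplacian F c a b * z b) = (\<Sum>e\<in>F. c e * (edge_diff z e)\<^sup>2)"
proof -
  have "(\<Sum>a\<in>V. \<Sum>b\<in>V. z a * weighted_laplacian F c a b * z b) =
      (\<Sum>a\<in>V. \<Sum>b\<in>V. \<Sum>e\<in>F. c e * (z a * edge_mat e a b * z b))"
    unfolding weighted_laplacian_def sum_distrib_left sum_distrib_right
    by (intro sum.cong refl) (simp add: mult_ac)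
  also have "\<dots> = (\<Sum>e\<in>F. \<Sum>a\<in>V. \<Sum>b\<in>V. c e * (z a * edge_mat e a b * z b))"
    by (subst sum.swap[of _ F], subst sum.swap[of _ F]) (rule refl)
  also have "\<dots> = (\<Sum>e\<in>F. c e * (edge_diff z e)\<^sup>2)"
    using edge_mat_form[OF assms(1)] F by (intro sum.cong refl) (auto simp: sum_distrib_left[symmetric])
  finally show ?thesis .
qed

lemma sum_cut:
  assumes "finite V" "F \<subseteq> pairs V"
  shows "(\<Sum>e\<in>F. c e * (edge_diff (\<lambda>u. if u \<in> A then 1 else 0) e)\<^sup>2) = sum c (cut F A)"
proof -
  have fin: "finite F" using assms finite_pairs finite_subset by blast
  have "(\<Sum>e\<in>F. c e * (edge_diff (\<lambda>u. if u \<in> A then 1 else 0) e)\<^sup>2) =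
      (\<Sum>e\<in>F. if card (e \<inter> A) = 1 then c e else 0)"
    using assms(2) edge_diff_indicator[of _ V A] by (intro sum.cong refl) auto
  then show ?thesis unfolding cut_def using fin by (simp add: sum.inter_filter)
qed

text \<open>An edge between \<open>A\<close> and \<open>B\<close> lies in both boundaries on the
  left but not in the boundary of the union; every other edge of either boundary survives in the
  union.\<close>

lemma sum_cut_Un:
  fixes c :: "nat set \<Rightarrow> real"
  assumes "finite F" "F \<subseteq> pairs V" "A \<inter> B = {}"
  shows "sum c (cut F A) + sum c (cut F B) = sum c (cut F (A \<union> B)) + 2 * sum c (between F A B)"
proof -
  have filt: "sum c {e \<in> F. P e} = (\<Sum>e\<in>F. if P e then c e else 0)" for P
    by (rule sum.inter_filter[OF assms(1)])
  have "(\<Sum>e\<in>F. (if card (e \<inter> A) = 1 then c e else 0) + (if card (e \<inter> B) = 1 then c e else 0)) =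
      (\<Sum>e\<in>F. (if card (e \<inter> (A \<union> B)) = 1 then c e else 0) +
        2 * (if e \<inter> A \<noteq> {} \<and> e \<inter> B \<noteq> {} then c e else 0))"
  proof (rule sum.cong[OF refl])
    fix e assume "e \<in> F"
    then obtain u v where uv: "u \<noteq> v" "e = {u, v}" using assms(2) by (blast elim: pairsE)
    have "e \<inter> A \<noteq> {} \<longleftrightarrow> u \<in> A \<or> v \<in> A" "e \<inter> B \<noteq> {} \<longleftrightarrow> u \<in> B \<or> v \<in> B" using uv by auto
    moreover have "card (e \<inter> C) = 1 \<longleftrightarrow> (u \<in> C) \<noteq> (v \<in> C)" for C
      using card_doubleton_Int uv by simp
    moreover have "\<not> (u \<in> A \<and> u \<in> B)" "\<not> (v \<in> A \<and> v \<in> B)" using assms(3) by auto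
    ultimately show "(if card (e \<inter> A) = 1 then c e else 0) + (if card (e \<inter> B) = 1 then c e else 0) =
      (if card (e \<inter> (A \<union> B)) = 1 then c e else 0) + 2 * (if e \<inter> A \<noteq> {} \<and> e \<inter> B \<noteq> {} then c e else 0)"
      by (cases "u \<in> A"; cases "u \<in> B"; cases "v \<in> A"; cases "v \<in> B") simp_all
  qed
  then show ?thesis unfolding cut_def between_def filt sum.distrib sum_distrib_left[symmetric] .
qed

text \<open>
  The potential of a set is its conductance plus a multiple of the logarithm of its volume.
\<close>

lemma potential_split:
  fixes a a' p p' P c \<phi> :: real
  assumes "0 < a" "a \<le> a'" "p + p' = P + 2 * c" "c \<le> \<phi> * a" "0 < \<phi>"
  defines "\<Psi> \<equiv> P / (a + a') + 4 * \<phi> * ln (a + a')"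
  shows "p / a + 4 * \<phi> * ln a \<le> \<Psi> \<or> p' / a' + 4 * \<phi> * ln a' \<le> \<Psi>"
proof (rule ccontr)
  assume "\<not> ?thesis"
  then have "\<Psi> < p / a + 4 * \<phi> * ln a" "\<Psi> < p' / a' + 4 * \<phi> * ln a'" by auto
  \<comment> \<open>The two inequalities are averaged with the volumes as weights. The cut raises
    the boundaries by \<open>2 * c\<close>, at most \<open>2 * \<phi> * a\<close>, while the
    logarithmic terms drop by at least \<open>a / 2\<close> before scaling, because the lighter part
    has at most half of the volume. The coefficient \<open>4 * \<phi>\<close> balances the
    two.\<close>
  then have "\<Psi> * a < p + 4 * \<phi> * ln a * a" "\<Psi> * a' < p' + 4 * \<phi> * ln a' * a'"
    using assms(1,2) by (auto simp: field_simps)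
  then have 1: "\<Psi> * (a + a') < P + 2 * c + 4 * \<phi> * (ln a * a + ln a' * a')"
    using assms(3) by (simp add: algebra_simps)
  have 2: "\<Psi> * (a + a') = P + 4 * \<phi> * (ln (a + a') * (a + a'))"
    using assms(1,2) by (simp add: \<Psi>_def field_simps)
  have "ln 2 \<le> ln ((a + a') / a)" using assms(1,2) by (subst ln_le_cancel_iff) (auto simp: field_simps)
  moreover have "1 / 2 \<le> ln (2 :: real)" using ln_le_minus_one[of "1 / 2 :: real"] by (simp add: ln_div)
  ultimately have "1 / 2 \<le> ln (a + a') - ln a" using assms(1,2) by (simp add: ln_div)
  then have "a / 2 \<le> (ln (a + a') - ln a) * a" using assms(1) by simp
  moreover have "0 \<le> (ln (a + a') - ln a') * a'" using assms(1,2) by simp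
  ultimately have "a / 2 \<le> ln (a + a') * (a + a') - (ln a * a + ln a' * a')" by (simp add: algebra_simps)
  then have "4 * \<phi> * (a / 2) \<le> 4 * \<phi> * (ln (a + a') * (a + a') - (ln a * a + ln a' * a'))"
    using assms(5) by (intro mult_left_mono) auto
  then have "2 * \<phi> * a \<le> 4 * \<phi> * (ln (a + a') * (a + a')) - 4 * \<phi> * (ln a * a + ln a' * a')"
    by (simp add: algebra_simps)
  then show False using 1 2 assms(4) by simp
qed

text \<open>Complements \<open>potential_split\<close>, which may favour a small part with a large
  boundary. A lighter part whose conductance is at least \<open>\<rho>\<close> takes away its share
  of the boundary, so the rest gains at most \<open>2 * \<phi> * a\<close>. Dividing by
  \<open>a'\<close>, which is at least half of the volume, gives
  \<open>4 * \<phi> * (a / (a + a'))\<close>, and the drop of the logarithm outweighs this.\<close>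

lemma potential_remove:
  fixes a a' p p' P c \<phi> \<rho> :: real
  assumes "0 < a" "a \<le> a'" "p + p' = P + 2 * c" "c \<le> \<phi> * a" "0 < \<phi>"
    and "\<rho> * a \<le> p" "P \<le> \<rho> * (a + a')"
  shows "p' / a' + 4 * \<phi> * ln a' \<le> P / (a + a') + 4 * \<phi> * ln (a + a')"
proof -
  let ?w = "a + a'"
  have a': "a' > 0" using assms by simp
  have "(P / ?w) * a \<le> \<rho> * a" using assms by (intro mult_right_mono) (auto simp: divide_simps)
  moreover have "P = (P / ?w) * a + (P / ?w) * a'"
    using assms unfolding distrib_left[symmetric] by simp
  moreover have "2 * \<phi> * a \<le> 4 * \<phi> * (a / ?w) * a'"
  proof -
    have "2 * \<phi> * a * ?w \<le> 2 * \<phi> * a * (2 * a')" using assms by (intro mult_left_mono) auto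
    then show ?thesis using assms by (simp add: field_simps)
  qed
  ultimately have "p' \<le> (P / ?w) * a' + 4 * \<phi> * (a / ?w) * a'" using assms(3,4,6) by argo
  then have 1: "p' / a' \<le> P / ?w + 4 * \<phi> * (a / ?w)" using a' by (simp add: field_simps)
  have "ln (a' / ?w) \<le> a' / ?w - 1" using assms by (intro ln_le_minus_one) auto
  also have "a' / ?w - 1 = - (a / ?w)" using assms by (simp add: field_simps)
  finally have "a / ?w \<le> ln ?w - ln a'" using assms by (simp add: ln_div)
  then have "4 * \<phi> * (a / ?w) \<le> 4 * \<phi> * (ln ?w - ln a')" using assms(5) by (intro mult_left_mono) auto
  then show ?thesis using 1 by (simp add: algebra_simps)
qed

section \<open>Dyadic levels of the weight\<close>

lemma le_power_pred: "d \<le> 2 ^ (d - 1)"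
  by (induction d) (auto simp: Suc_le_eq neq0_conv intro: order.strict_trans2 dest: gr0_implies_Suc)

text \<open>If the levels differ by \<open>d\<close>, the larger number is at least
  \<open>2 ^ (d - 1)\<close> times the smaller one, where rounding costs one factor 2, and
  \<open>d \<le> 2 ^ (d - 1)\<close>.\<close>

lemma level_gap:
  fixes a b c :: real
  assumes "0 < a" "0 < b" "0 \<le> c" "c \<le> a" "c \<le> b"
  shows "c * \<bar>\<lfloor>log 2 a\<rfloor> - \<lfloor>log 2 b\<rfloor>\<bar> \<le> a + b"
proof -
  have main: "c * \<bar>\<lfloor>log 2 a\<rfloor> - \<lfloor>log 2 b\<rfloor>\<bar> \<le> b"
    if ab: "0 < a" "0 < b" "0 \<le> c" "c \<le> a" "c \<le> b" "\<lfloor>log 2 a\<rfloor> \<le> \<lfloor>log 2 b\<rfloor>" for a b :: real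
  proof -
    define d where "d = nat (\<lfloor>log 2 b\<rfloor> - \<lfloor>log 2 a\<rfloor>)"
    have d: "\<lfloor>log 2 b\<rfloor> = \<lfloor>log 2 a\<rfloor> + int d" using ab by (simp add: d_def)
    have le: "c * real d \<le> b"
    proof (cases "d = 0")
      case False
      have "real_of_int \<lfloor>log 2 b\<rfloor> \<le> log 2 b" "log 2 a < real_of_int \<lfloor>log 2 a\<rfloor> + 1" by linarith+
      moreover have "real_of_int \<lfloor>log 2 b\<rfloor> = real_of_int \<lfloor>log 2 a\<rfloor> + real d" using d by simp
      moreover have "real (d - 1) = real d - 1" using False by simp
      ultimately have "log 2 a + real (d - 1) \<le> log 2 b" by linarith
      moreover have "log 2 (a * 2 ^ (d - 1)) = log 2 a + real (d - 1)"
        using ab by (simp add: log_mult log_nat_power)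
      ultimately have "log 2 (a * 2 ^ (d - 1)) \<le> log 2 b" by simp
      then have "a * 2 ^ (d - 1) \<le> b" using ab by simp
      moreover have "c * real d \<le> a * 2 ^ (d - 1)"
        using ab le_power_pred[of d] by (intro mult_mono) (auto simp: of_nat_le_iff[symmetric] simp del: of_nat_le_iff)
      ultimately show ?thesis by simp
    qed (use ab in simp)
    have "real_of_int \<bar>\<lfloor>log 2 a\<rfloor> - \<lfloor>log 2 b\<rfloor>\<bar> = real d" using d by simp
    then show ?thesis using le by simp
  qed
  show ?thesis
  proof (cases "\<lfloor>log 2 a\<rfloor> \<le> \<lfloor>log 2 b\<rfloor>")
    case True
    then show ?thesis using main[of a b] assms by simp
  next
    case False
    then show ?thesis using main[of b a] assms by (simp add: abs_minus_commute)
  qed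
qed

text \<open>A window is named by its lowest level \<open>a\<close>. Those containing exactly one of
  the levels \<open>k\<close> and \<open>l\<close> form the symmetric difference of two translates
  of an interval, with at most \<open>\<bar>k - l\<bar>\<close> elements at either end.\<close>

lemma card_windows_separating:
  fixes k l :: int
  shows "finite {a. (k - int N < a \<and> a \<le> k) \<noteq> (l - int N < a \<and> a \<le> l)}"
    "real (card {a. (k - int N < a \<and> a \<le> k) \<noteq> (l - int N < a \<and> a \<le> l)}) \<le> 2 * \<bar>k - l\<bar>"
proof -
  let ?W = "{a. (k - int N < a \<and> a \<le> k) \<noteq> (l - int N < a \<and> a \<le> l)}"
  let ?U = "{min k l<..max k l} \<union> {min k l - int N<..max k l - int N}"
  have sub: "?W \<subseteq> ?U" by auto
  show "finite ?W" using sub by (rule finite_subset) simp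
  have "card ?W \<le> card ?U" using sub by (intro card_mono) auto
  also have "\<dots> \<le> card {min k l<..max k l} + card {min k l - int N<..max k l - int N}" by (rule card_Un_le)
  also have "\<dots> = 2 * nat \<bar>k - l\<bar>" by (auto simp: max_def min_def)
  finally have "int (card ?W) \<le> int (2 * nat \<bar>k - l\<bar>)" by (simp only: of_nat_le_iff)
  also have "\<dots> = 2 * \<bar>k - l\<bar>" by simp
  finally have "int (card ?W) \<le> 2 * \<bar>k - l\<bar>" .
  then show "real (card ?W) \<le> 2 * \<bar>k - l\<bar>" by (metis of_int_le_iff of_int_of_nat_eq)
qed

section \<open>Feasible solutions tested on indicator vectors\<close>

locale sdp_solution =
  fixes n :: nat and E :: "nat set set" and \<Delta> :: nat and \<delta> lam :: real and x y :: "nat set \<Rightarrow> real"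
  assumes regular: "regular_graph n E \<Delta>" and \<delta>: "\<delta> > 0" and lam: "lam > 0"
    and feasible: "sdp_feasible n E \<delta> lam x y"
begin

abbreviation "V \<equiv> {..<n}"

definition weight :: "nat \<Rightarrow> real" where
  "weight u = (\<Sum>v\<in>V - {u}. y {u, v})"

abbreviation "vol \<equiv> sum weight"
abbreviation "bd A \<equiv> sum x (cut E A)"

lemma E_pairs: "E \<subseteq> pairs V" using regular by (simp add: regular_graph_def)

lemma finite_E: "finite E" using E_pairs finite_pairs[of V] finite_subset by blast

lemma degree: "u < n \<Longrightarrow> card {e \<in> E. u \<in> e} = \<Delta>" using regular by (simp add: regular_graph_def)

lemma x_nonneg: "e \<in> E \<Longrightarrow> 0 \<le> x e" using feasible by (auto simp: sdp_feasible_def)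

lemma y_nonneg: "u < n \<Longrightarrow> v < n \<Longrightarrow> u \<noteq> v \<Longrightarrow> 0 \<le> y {u, v}"
  using feasible by (auto simp: sdp_feasible_def pairs_def)

lemma x_le_weight: assumes "e \<in> E" "u \<in> e" shows "x e \<le> weight u"
proof -
  have u: "u < n" using assms E_pairs by (auto simp: pairs_def)
  have "x e \<le> Max (x ` {e \<in> E. u \<in> e})" using assms finite_E by (intro Max_ge) auto
  also have "\<dots> \<le> weight u" using feasible u by (auto simp: sdp_feasible_def weight_def)
  finally show ?thesis .
qed

lemma weight_nonneg: "u < n \<Longrightarrow> 0 \<le> weight u"
  unfolding weight_def by (intro sum_nonneg) (auto intro: y_nonneg)

lemma vol_pos: "vol V > 0" and n_pos: "n > 0"
proof -
  obtain e where e: "e \<in> E" "x e \<noteq> 0" using feasible by (auto simp: sdp_feasible_def)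
  obtain u v where uv: "u \<noteq> v" "e = {u, v}" "u \<in> V" "v \<in> V" using e E_pairs by (meson pairsE subsetD)
  then have "0 < weight u" using x_nonneg[of e] x_le_weight[of e u] e by auto
  then show "vol V > 0" using uv weight_nonneg by (intro sum_pos2[of _ u]) auto
  show "n > 0" using uv by auto
qed

text \<open>Since \<open>y\<close> lives on pairs of distinct vertices, a vertex of \<open>A\<close>
  has only \<open>card A - 1\<close> partners inside \<open>A\<close>, and each receives at most a
  fraction \<open>1 / (\<delta> * n)\<close> of its weight. The \<open>- 1\<close> later yields two
  vertices in every balanced set, and for singletons it yields
  \<open>lam \<le> \<Delta>\<close>.\<close>

lemma bd_ge:
  assumes A: "A \<subseteq> V" "A \<noteq> {}"
  shows "lam * ((1 - (real (card A) - 1) / (\<delta> * n)) * vol A) \<le> bd A"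
proof -
  have fin: "finite A" using A finite_subset by blast
  let ?z = "\<lambda>u. if u \<in> A then 1 else 0 :: real"
  have "0 \<le> (\<Sum>a\<in>V. \<Sum>b\<in>V. ?z a * (weighted_laplacian E x a b - lam * weighted_laplacian (pairs V) y a b) * ?z b)"
    using feasible by (simp only: sdp_feasible_def loewner_ge_def)
  also have "\<dots> = (\<Sum>a\<in>V. \<Sum>b\<in>V. ?z a * weighted_laplacian E x a b * ?z b) -
      lam * (\<Sum>a\<in>V. \<Sum>b\<in>V. ?z a * weighted_laplacian (pairs V) y a b * ?z b)"
    unfolding sum_distrib_left sum_subtractf[symmetric] by (intro sum.cong refl) (simp add: algebra_simps)
  also have "\<dots> = bd A - lam * sum y (cut (pairs V) A)"
    by (subst (1 2) weighted_laplacian_form) (auto simp: E_pairs sum_cut[of V])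
  finally have 1: "lam * sum y (cut (pairs V) A) \<le> bd A" by simp
  have bij: "bij_betw (\<lambda>(u, v). {u, v}) (A \<times> (V - A)) (cut (pairs V) A)"
  proof (rule bij_betwI')
    show "(case p of (u, v) \<Rightarrow> {u, v}) = (case q of (u, v) \<Rightarrow> {u, v}) \<longleftrightarrow> p = q"
      if "p \<in> A \<times> (V - A)" "q \<in> A \<times> (V - A)" for p q
      using that by (auto simp: doubleton_eq_iff)
    show "(case p of (u, v) \<Rightarrow> {u, v}) \<in> cut (pairs V) A" if p: "p \<in> A \<times> (V - A)" for p
    proof -
      obtain u v where uv: "p = (u, v)" "u \<in> A" "v \<in> V" "v \<notin> A" using p by auto
      then have "u \<noteq> v" by auto
      then show ?thesis using uv A card_doubleton_Int[of u v A] by (auto simp: cut_def pairs_def)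
    qed
    show "\<exists>p\<in>A \<times> (V - A). e = (case p of (u, v) \<Rightarrow> {u, v})" if e: "e \<in> cut (pairs V) A" for e
    proof -
      obtain u v where uv: "u \<noteq> v" "e = {u, v}" "u \<in> V" "v \<in> V" using e by (auto simp: cut_def elim: pairsE)
      then have "(u \<in> A) \<noteq> (v \<in> A)" using e card_doubleton_Int[of u v A] by (simp add: cut_def)
      then show ?thesis using uv by (cases "u \<in> A") (auto simp: insert_commute)
    qed
  qed
  have "sum y (cut (pairs V) A) = (\<Sum>p\<in>A \<times> (V - A). y (case p of (u, v) \<Rightarrow> {u, v}))"
    by (rule sum.reindex_bij_betw[OF bij, symmetric])
  also have "\<dots> = (\<Sum>u\<in>A. \<Sum>v\<in>V - A. y {u, v})"
    by (subst sum.cartesian_product) (simp add: case_prod_unfold)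
  finally have 2: "sum y (cut (pairs V) A) = (\<Sum>u\<in>A. \<Sum>v\<in>V - A. y {u, v})" .
  have "(1 - (real (card A) - 1) / (\<delta> * n)) * weight u \<le> (\<Sum>v\<in>V - A. y {u, v})" if u: "u \<in> A" for u
  proof -
    have "y {u, v} \<le> weight u / (\<delta> * n)" if "v \<in> A - {u}" for v
    proof -
      have "\<delta> * real n * y {u, v} \<le> weight u"
        using feasible that u A unfolding sdp_feasible_def weight_def by blast
      then show ?thesis using \<delta> n_pos by (simp add: field_simps)
    qed
    then have "(\<Sum>v\<in>A - {u}. y {u, v}) \<le> (\<Sum>v\<in>A - {u}. weight u / (\<delta> * n))" by (intro sum_mono) auto
    also have "\<dots> = (real (card A) - 1) / (\<delta> * n) * weight u"
    proof -
      have "1 \<le> card A" using u fin by (auto simp: Suc_le_eq card_gt_0_iff)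
      then show ?thesis using u by (simp add: card_Diff_singleton of_nat_diff)
    qed
    finally have le: "(\<Sum>v\<in>A - {u}. y {u, v}) \<le> (real (card A) - 1) / (\<delta> * n) * weight u" .
    have "V - {u} = (V - A) \<union> (A - {u})" using u A by auto
    then have "weight u = (\<Sum>v\<in>V - A. y {u, v}) + (\<Sum>v\<in>A - {u}. y {u, v})"
      unfolding weight_def using fin by (simp add: sum.union_disjoint Int_Diff disjoint_iff)
    then show ?thesis using le by (simp add: algebra_simps)
  qed
  then have "(1 - (real (card A) - 1) / (\<delta> * n)) * vol A \<le> sum y (cut (pairs V) A)"
    unfolding 2 sum_distrib_left by (intro sum_mono) auto
  then show ?thesis using 1 lam by (meson less_imp_le mult_left_mono order_trans)
qed

lemma sum_endpoints: "(\<Sum>e\<in>E. \<Sum>u\<in>e. weight u) = \<Delta> * vol V"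
proof -
  have "(\<Sum>e\<in>E. \<Sum>u\<in>e. weight u) = (\<Sum>e\<in>E. \<Sum>u | u \<in> V \<and> u \<in> e. weight u)"
  proof (rule sum.cong[OF refl])
    fix e assume "e \<in> E"
    then have "e = {u. u \<in> V \<and> u \<in> e}" using E_pairs by (auto simp: pairs_def)
    then show "vol e = (\<Sum>u | u \<in> V \<and> u \<in> e. weight u)" by (rule arg_cong)
  qed
  also have "\<dots> = (\<Sum>u\<in>V. \<Sum>e | e \<in> E \<and> u \<in> e. weight u)"
    using finite_E by (intro sum.swap_restrict) auto
  also have "\<dots> = (\<Sum>u\<in>V. \<Delta> * weight u)" using degree by (intro sum.cong) auto
  finally show ?thesis by (simp add: sum_distrib_left)
qed

text \<open>
  The windows \<open>2 ^ a \<le> w < 2 ^ (a + N)\<close> of the weight \<open>w\<close> cover every vertex \<open>N\<close> times, while an edge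
  between the levels \<open>k\<close> and \<open>l\<close> leaves at most \<open>2 \<bar>k - l\<bar>\<close> of them.
\<close>

lemma window:
  assumes N: "16 * real \<Delta> / lam \<le> real N"
  obtains t p q where "t > 0" "p < n" "q < n"
    "\<And>u. u < n \<Longrightarrow> weight p \<le> weight u \<Longrightarrow> weight u \<le> weight q \<Longrightarrow> t \<le> weight u \<and> weight u \<le> 2 ^ N * t"
    "weight p \<le> weight q"
    "bd {u. u < n \<and> weight p \<le> weight u \<and> weight u \<le> weight q} \<le> lam / 8 * vol {u. u < n \<and> weight p \<le> weight u \<and> weight u \<le> weight q}"
proof -
  define l where "l u = \<lfloor>log 2 (weight u)\<rfloor>" for u
  define P where "P = {u \<in> V. weight u > 0}"
  define W where "W a = {u \<in> P. l u - int N < a \<and> a \<le> l u}" for a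
  define R where "R = (\<Union>u\<in>P. {l u - int N<..l u})"
  have finR: "finite R" by (simp add: R_def P_def)
  have volP: "vol P = vol V" unfolding P_def
    using weight_nonneg by (intro sum.mono_neutral_left) (auto simp: less_le)
  have "(\<Sum>a\<in>R. vol (W a)) = (\<Sum>a\<in>R. \<Sum>u | u \<in> P \<and> (l u - int N < a \<and> a \<le> l u). weight u)"
    by (simp add: W_def)
  also have "\<dots> = (\<Sum>u\<in>P. \<Sum>a | a \<in> R \<and> (l u - int N < a \<and> a \<le> l u). weight u)"
    by (intro sum.swap_restrict finR) (simp add: P_def)
  also have "\<dots> = (\<Sum>u\<in>P. real N * weight u)"
  proof (intro sum.cong refl)
    fix u assume "u \<in> P"
    then have "{a. a \<in> R \<and> (l u - int N < a \<and> a \<le> l u)} = {l u - int N<..l u}" by (auto simp: R_def)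
    then show "(\<Sum>a | a \<in> R \<and> (l u - int N < a \<and> a \<le> l u). weight u) = real N * weight u" by simp
  qed
  finally have volW: "(\<Sum>a\<in>R. vol (W a)) = real N * vol V" by (simp add: sum_distrib_left[symmetric] volP)
  have "(\<Sum>a\<in>R. bd (W a)) = (\<Sum>a\<in>R. \<Sum>e | e \<in> E \<and> card (e \<inter> W a) = 1. x e)" by (simp add: cut_def)
  also have "\<dots> = (\<Sum>e\<in>E. \<Sum>a | a \<in> R \<and> card (e \<inter> W a) = 1. x e)"
    by (intro sum.swap_restrict finR finite_E)
  also have "\<dots> \<le> (\<Sum>e\<in>E. 2 * (\<Sum>u\<in>e. weight u))"
  proof (intro sum_mono)
    fix e assume e: "e \<in> E"
    then obtain u v where uv: "u \<noteq> v" "e = {u, v}" "u \<in> V" "v \<in> V" using E_pairs by (meson pairsE subsetD)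
    let ?C = "{a. a \<in> R \<and> card (e \<inter> W a) = 1}"
    have xle: "x e \<le> weight u" "x e \<le> weight v" using x_le_weight[OF e] uv by auto
    have wn: "0 \<le> weight u" "0 \<le> weight v" using weight_nonneg uv by auto
    have "real (card ?C) * x e \<le> 2 * (weight u + weight v)"
    proof (cases "weight u > 0 \<and> weight v > 0")
      case True
      then have "u \<in> P" "v \<in> P" using uv by (auto simp: P_def)
      then have "?C \<subseteq> {a. (l u - int N < a \<and> a \<le> l u) \<noteq> (l v - int N < a \<and> a \<le> l v)}"
        unfolding uv(2) using card_doubleton_Int[OF uv(1)] by (auto simp: W_def)
      then have "card ?C \<le> card {a. (l u - int N < a \<and> a \<le> l u) \<noteq> (l v - int N < a \<and> a \<le> l v)}"
        by (intro card_mono card_windows_separating(1))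
      then have "real (card ?C) \<le> 2 * real_of_int \<bar>l u - l v\<bar>"
        using card_windows_separating(2)[of "l u" N "l v"] by linarith
      then have "real (card ?C) * x e \<le> 2 * real_of_int \<bar>l u - l v\<bar> * x e"
        by (intro mult_right_mono x_nonneg e)
      also have "\<dots> \<le> 2 * (weight u + weight v)"
        using level_gap[of "weight u" "weight v" "x e"] True xle x_nonneg[OF e] by (simp add: l_def mult_ac)
      finally show ?thesis .
    next
      \<comment> \<open>Where a weight is 0, its level is a mere default value, but then
        \<open>x e = 0\<close>.\<close>
      case False
      then have "x e \<le> 0" using xle by auto
      then have "x e = 0" using x_nonneg[OF e] by simp
      then show ?thesis using wn by simp
    qed
    then show "(\<Sum>a | a \<in> R \<and> card (e \<inter> W a) = 1. x e) \<le> 2 * (\<Sum>u\<in>e. weight u)"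
      using uv by simp
  qed
  also have "\<dots> = 2 * (\<Delta> * vol V)" by (simp add: sum_distrib_left[symmetric] sum_endpoints)
  finally have bdW: "(\<Sum>a\<in>R. bd (W a)) \<le> 2 * (\<Delta> * vol V)" .
  \<comment> \<open>If every window failed, summation would give
    \<open>lam / 8 * N < 2 * \<Delta>\<close>, contrary to the choice of \<open>N\<close>. This is
    the origin of the factor 16.\<close>
  have "\<exists>a\<in>R. bd (W a) \<le> lam / 8 * vol (W a)"
  proof (rule ccontr)
    assume "\<not> ?thesis"
    then have less: "lam / 8 * vol (W a) < bd (W a)" if "a \<in> R" for a using that by auto
    have "\<exists>u\<in>P. True" using volP vol_pos by (metis all_not_in_conv less_irrefl sum.empty)
    moreover have "N > 0"
    proof -
      have "\<Delta> > 0"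
      proof (rule ccontr)
        assume "\<not> \<Delta> > 0"
        then have "{e \<in> E. u \<in> e} = {}" if "u < n" for u using degree[OF that] finite_E by simp
        moreover obtain e where "e \<in> E" using feasible by (auto simp: sdp_feasible_def)
        moreover from this obtain u where "u \<in> e" "u < n" using E_pairs by (blast elim: pairsE)
        ultimately show False by blast
      qed
      then show ?thesis using N lam by (metis divide_pos_pos gr0I mult_pos_pos not_le of_nat_0 of_nat_0_less_iff zero_less_numeral)
    qed
    ultimately have "R \<noteq> {}" by (auto simp: R_def)
    then have "(\<Sum>a\<in>R. lam / 8 * vol (W a)) < (\<Sum>a\<in>R. bd (W a))" using less finR by (intro sum_strict_mono) auto
    then have "lam / 8 * (\<Sum>a\<in>R. vol (W a)) < (\<Sum>a\<in>R. bd (W a))" by (simp only: sum_distrib_left)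
    then have "lam / 8 * (real N * vol V) < 2 * (\<Delta> * vol V)" using bdW volW by simp
    then have "lam / 8 * real N < 2 * \<Delta>" using vol_pos by (simp add: mult.assoc[symmetric] mult_less_cancel_right)
    then show False using N lam by (simp add: field_simps)
  qed
  then obtain a where a: "a \<in> R" "bd (W a) \<le> lam / 8 * vol (W a)" by auto
  have finW: "finite (W a)" "W a \<noteq> {}" using a(1) by (auto simp: W_def P_def R_def)
  obtain p where p: "p \<in> W a" "\<And>u. u \<in> W a \<Longrightarrow> weight p \<le> weight u"
    using finW by (metis arg_min_if_finite(1) arg_min_least)
  obtain q where q: "q \<in> W a" "\<And>u. u \<in> W a \<Longrightarrow> weight u \<le> weight q"
  proof -
    have "Max (weight ` W a) \<in> weight ` W a" using finW by simp
    then obtain q where "q \<in> W a" "weight q = Max (weight ` W a)" by auto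
    then show ?thesis using that[of q] finW by simp
  qed
  define t where "t = 2 powr (real_of_int a)"
  have mem: "u \<in> W a \<longleftrightarrow> u < n \<and> t \<le> weight u \<and> weight u < 2 ^ N * t" for u
  proof -
    have "2 ^ N * t = 2 powr (real_of_int (a + int N))" by (simp add: t_def powr_add powr_realpow mult.commute)
    then have "weight u > 0 \<Longrightarrow> (l u - int N < a \<and> a \<le> l u) \<longleftrightarrow> t \<le> weight u \<and> weight u < 2 ^ N * t"
      unfolding l_def by (simp add: le_floor_iff floor_less_iff le_log_iff log_less_iff t_def diff_less_eq conj_commute)
    moreover have "0 < t" by (simp add: t_def)
    ultimately show ?thesis by (auto simp: W_def P_def)
  qed
  have pm: "p < n" "t \<le> weight p" and qm: "q < n" "weight q < 2 ^ N * t" using p(1) q(1) mem by blast+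
  \<comment> \<open>Described by its lightest and heaviest members, the window becomes one of at
    most \<open>n\<^sup>2\<close> candidates, which can be tried without knowing \<open>a\<close> or
    \<open>N\<close>.\<close>
  have W: "W a = {u. u < n \<and> weight p \<le> weight u \<and> weight u \<le> weight q}"
  proof (intro equalityI subsetI)
    fix u assume "u \<in> W a"
    then show "u \<in> {u. u < n \<and> weight p \<le> weight u \<and> weight u \<le> weight q}"
      using p(2) q(2) mem[of u] by blast
  next
    fix u assume "u \<in> {u. u < n \<and> weight p \<le> weight u \<and> weight u \<le> weight q}"
    then have "u < n" "t \<le> weight u" "weight u < 2 ^ N * t" using pm qm by auto
    then show "u \<in> W a" using mem by blast
  qed
  show ?thesis
  proof (rule that[of t p q])
    show "t > 0" by (simp add: t_def)
    show "p < n" "q < n" by (fact pm(1) qm(1))+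
    show "weight p \<le> weight q" using p(2) q(1) by blast
    show "t \<le> weight u \<and> weight u \<le> 2 ^ N * t" if "weight p \<le> weight u" "weight u \<le> weight q" for u
      using that pm(2) qm(2) by linarith
    show "bd {u. u < n \<and> weight p \<le> weight u \<and> weight u \<le> weight q} \<le>
        lam / 8 * vol {u. u < n \<and> weight p \<le> weight u \<and> weight u \<le> weight q}"
      using a(2) unfolding W .
  qed
qed

end

section \<open>Cheeger's inequality for sweep cuts\<close>

text \<open>The weight of a threshold in a discrete layer-cake integral over the values of a vector.
  The largest value separates no two values, so its weight is 0.\<close>

definition successor_gap :: "real set \<Rightarrow> real \<Rightarrow> real" where
  "successor_gap X t = (if \<exists>s\<in>X. t < s then Min {s \<in> X. t < s} - t else 0)"

lemma successor_gap_nonneg: "finite X \<Longrightarrow> 0 \<le> successor_gap X t"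
proof (cases "\<exists>s\<in>X. t < s")
  case True
  moreover assume "finite X"
  ultimately have "Min {s \<in> X. t < s} \<in> {s \<in> X. t < s}" by (intro Min_in) auto
  then show ?thesis by (simp add: successor_gap_def)
qed (simp add: successor_gap_def)

lemma sum_successor_gap:
  assumes "finite X" "a \<in> X" "b \<in> X" "a \<le> b"
  shows "(\<Sum>t | t \<in> X \<and> a \<le> t \<and> t < b. successor_gap X t) = b - a"
  using assms(2,4)
proof (induction "card {t. t \<in> X \<and> a \<le> t \<and> t < b}" arbitrary: a rule: less_induct)
  case less
  show ?case
  proof (cases "a = b")
    case True
    then have "{t. t \<in> X \<and> a \<le> t \<and> t < b} = {}" by auto
    then show ?thesis using True by (metis diff_self sum.empty)
  next
    case False
    then have ab: "a < b" using less.prems by simp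
    define s where "s = Min {s \<in> X. a < s}"
    have "b \<in> {s \<in> X. a < s}" using ab assms by simp
    moreover from this have "s \<in> {s \<in> X. a < s}"
      unfolding s_def using assms(1) by (intro Min_in) auto
    ultimately have s: "s \<in> X" "a < s" "s \<le> b" unfolding s_def using assms(1) by auto
    have least: "s \<le> t" if "t \<in> X" "a < t" for t unfolding s_def using assms(1) that by (intro Min_le) auto
    have eq: "{t. t \<in> X \<and> a \<le> t \<and> t < b} = insert a {t. t \<in> X \<and> s \<le> t \<and> t < b}"
      using s ab least less.prems by force
    have fin: "finite {t. t \<in> X \<and> s \<le> t \<and> t < b}" using assms(1) by simp
    have na: "a \<notin> {t. t \<in> X \<and> s \<le> t \<and> t < b}" using s by simp
    have "card {t. t \<in> X \<and> s \<le> t \<and> t < b} < card {t. t \<in> X \<and> a \<le> t \<and> t < b}"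
      unfolding eq using fin na by simp
    from less.hyps[OF this s(1,3)]
    have "(\<Sum>t | t \<in> X \<and> s \<le> t \<and> t < b. successor_gap X t) = b - s" .
    moreover have "successor_gap X a = s - a" unfolding successor_gap_def s_def using s(1,2) by auto
    ultimately show ?thesis unfolding eq using fin na by simp
  qed
qed

text \<open>The gaps at the thresholds that separate \<open>a\<close> from \<open>b\<close>
  telescope.\<close>

lemma abs_diff_eq_sum_gap:
  assumes "finite X" "a \<in> X" "b \<in> X"
  shows "\<bar>a - b\<bar> = (\<Sum>t\<in>X. if (a \<le> t) \<noteq> (b \<le> t) then successor_gap X t else 0)"
proof -
  have "{t. t \<in> X \<and> (a \<le> t) \<noteq> (b \<le> t)} = {t. t \<in> X \<and> min a b \<le> t \<and> t < max a b}" by auto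
  then have "(\<Sum>t\<in>X. if (a \<le> t) \<noteq> (b \<le> t) then successor_gap X t else 0) =
      (\<Sum>t | t \<in> X \<and> min a b \<le> t \<and> t < max a b. successor_gap X t)"
    using assms(1) by (simp add: sum.inter_filter[symmetric])
  also have "\<dots> = max a b - min a b" using assms by (intro sum_successor_gap) (auto simp: min_def max_def)
  finally show ?thesis by (simp add: max_def min_def)
qed

abbreviation sweep :: "nat set \<Rightarrow> (nat \<Rightarrow> 'a :: linorder) \<Rightarrow> nat \<Rightarrow> nat set" where
  "sweep S z j \<equiv> {u \<in> S. z u \<le> z j}"

text \<open>Chosen so that in every sweep cut the side without \<open>m\<close> is the smaller one.
  Hence the vertices that a threshold separates from \<open>m\<close> are exactly the smaller side
  counted in the expansion condition.\<close>

definition median :: "nat set \<Rightarrow> (nat \<Rightarrow> real) \<Rightarrow> nat \<Rightarrow> bool" where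
  "median S z m \<longleftrightarrow> m \<in> S \<and> (\<forall>j\<in>S. if z m \<le> z j then card (S - sweep S z j) \<le> card (sweep S z j)
     else card (sweep S z j) \<le> card (S - sweep S z j))"

text \<open>A vertex of least value works among those whose sweep contains at least half of
  \<open>S\<close>.\<close>

lemma median_exists:
  assumes "finite S" "S \<noteq> {}"
  obtains m where "median S z m"
proof -
  let ?P = "{j \<in> S. card (S - sweep S z j) \<le> card (sweep S z j)}"
  have "Max (z ` S) \<in> z ` S" using assms by simp
  then obtain j where j: "j \<in> S" "z j = Max (z ` S)" by auto
  then have "sweep S z j = S" using assms by auto
  then have "j \<in> ?P" using j by simp
  then have "finite ?P" "?P \<noteq> {}" using assms by auto
  then obtain m where m: "m \<in> ?P" "\<And>u. u \<in> ?P \<Longrightarrow> z m \<le> z u"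
    by (metis (no_types, lifting) arg_min_if_finite(1) arg_min_least)
  have "card (S - sweep S z j) \<le> card (sweep S z j)" if "j \<in> S" "z m \<le> z j" for j
  proof -
    have "card (sweep S z m) \<le> card (sweep S z j)" "card (S - sweep S z j) \<le> card (S - sweep S z m)"
      using that assms by (auto intro!: card_mono)
    then show ?thesis using m(1) by simp
  qed
  moreover have "card (sweep S z j) \<le> card (S - sweep S z j)" if "j \<in> S" "\<not> z m \<le> z j" for j
    using that m(2)[of j] by force
  ultimately have "median S z m" using m(1) by (auto simp: median_def)
  then show ?thesis by (rule that)
qed

text \<open>Both sums are layer-cake sums over the same thresholds: at a threshold the edges
  contribute the size of a sweep cut and the vertices, by the choice of the median, its smaller
  side. The hypothesis \<open>sweeps\<close> compares them threshold by threshold.\<close>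

lemma coarea:
  assumes S: "finite S" and F: "F \<subseteq> pairs S" and m: "median S f m" and h: "0 \<le> h"
    and sweeps: "\<And>j. j \<in> S \<Longrightarrow> h * real (min (card (sweep S f j)) (card (S - sweep S f j))) \<le> real (card (cut F (sweep S f j)))"
  shows "h * (\<Sum>u\<in>S. \<bar>f u - f m\<bar>) \<le> (\<Sum>e\<in>F. edge_diff f e)"
proof -
  let ?X = "f ` S"
  let ?A = "\<lambda>t. {u \<in> S. f u \<le> t}"
  have finX: "finite ?X" and finF: "finite F" using S F finite_pairs finite_subset by auto
  have mS: "m \<in> S" using m by (simp add: median_def)
  have vertices: "(\<Sum>u\<in>S. \<bar>f u - f m\<bar>) = (\<Sum>t\<in>?X. real (card {u \<in> S. (f u \<le> t) \<noteq> (f m \<le> t)}) * successor_gap ?X t)"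
  proof -
    have "(\<Sum>u\<in>S. \<bar>f u - f m\<bar>) = (\<Sum>u\<in>S. \<Sum>t\<in>?X. if (f u \<le> t) \<noteq> (f m \<le> t) then successor_gap ?X t else 0)"
      using finX mS by (intro sum.cong refl abs_diff_eq_sum_gap) auto
    also have "\<dots> = (\<Sum>t\<in>?X. \<Sum>u\<in>S. if (f u \<le> t) \<noteq> (f m \<le> t) then successor_gap ?X t else 0)" by (rule sum.swap)
    also have "\<dots> = (\<Sum>t\<in>?X. \<Sum>u | u \<in> S \<and> (f u \<le> t) \<noteq> (f m \<le> t). successor_gap ?X t)"
      by (rule sum.cong[OF refl], rule sum.inter_filter[symmetric, OF S])
    finally show ?thesis by simp
  qed
  have edges: "(\<Sum>e\<in>F. edge_diff f e) = (\<Sum>t\<in>?X. real (card (cut F (?A t))) * successor_gap ?X t)"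
  proof -
    have "(\<Sum>e\<in>F. edge_diff f e) = (\<Sum>e\<in>F. \<Sum>t\<in>?X. if card (e \<inter> ?A t) = 1 then successor_gap ?X t else 0)"
    proof (intro sum.cong refl)
      fix e assume "e \<in> F"
      then obtain u v where uv: "u \<noteq> v" "e = {u, v}" "u \<in> S" "v \<in> S" using F by (blast elim: pairsE)
      have "card (e \<inter> ?A t) = 1 \<longleftrightarrow> (f u \<le> t) \<noteq> (f v \<le> t)" for t
        unfolding uv(2) card_doubleton_Int[OF uv(1)] using uv by simp
      then show "edge_diff f e = (\<Sum>t\<in>?X. if card (e \<inter> ?A t) = 1 then successor_gap ?X t else 0)"
        using abs_diff_eq_sum_gap[OF finX, of "f u" "f v"] uv by (simp add: edge_diff_doubleton)
    qed
    also have "\<dots> = (\<Sum>t\<in>?X. \<Sum>e\<in>F. if card (e \<inter> ?A t) = 1 then successor_gap ?X t else 0)" by (rule sum.swap)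
    also have "\<dots> = (\<Sum>t\<in>?X. \<Sum>e | e \<in> F \<and> card (e \<inter> ?A t) = 1. successor_gap ?X t)"
      by (rule sum.cong[OF refl], rule sum.inter_filter[symmetric, OF finF])
    finally show ?thesis by (simp add: cut_def)
  qed
  have "h * real (card {u \<in> S. (f u \<le> t) \<noteq> (f m \<le> t)}) \<le> real (card (cut F (?A t)))" if t: "t \<in> ?X" for t
  proof -
    obtain j where j: "j \<in> S" "t = f j" using t by auto
    have "{u \<in> S. (f u \<le> f j) \<noteq> (f m \<le> f j)} = (if f m \<le> f j then S - sweep S f j else sweep S f j)" by auto
    moreover have "if f m \<le> f j then card (S - sweep S f j) \<le> card (sweep S f j)
        else card (sweep S f j) \<le> card (S - sweep S f j)"
      using m j(1) unfolding median_def by blast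
    ultimately have "card {u \<in> S. (f u \<le> f j) \<noteq> (f m \<le> f j)} = min (card (sweep S f j)) (card (S - sweep S f j))"
      by (cases "f m \<le> f j") (simp_all only: if_True if_False min_absorb1 min_absorb2 min.commute)
    then show ?thesis using sweeps[OF j(1)] unfolding j(2) by simp
  qed
  then show ?thesis
    unfolding vertices edges sum_distrib_left mult.assoc[symmetric]
    by (intro sum_mono mult_right_mono successor_gap_nonneg finX) auto
qed

definition sdiff :: "(nat \<Rightarrow> real) \<Rightarrow> nat set \<Rightarrow> real" where
  "sdiff z e = z (Max e) - z (Min e)"

lemma edge_diff_sdiff: "edge_diff z e = \<bar>sdiff z e\<bar>"
  by (simp add: edge_diff_def sdiff_def)

lemma sum_incident_le:
  assumes S: "finite S" and F: "F \<subseteq> pairs S" and deg: "\<And>u. u \<in> S \<Longrightarrow> card {e \<in> F. u \<in> e} \<le> D"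
    and g: "\<And>u. u \<in> S \<Longrightarrow> 0 \<le> g u"
  shows "(\<Sum>e\<in>F. \<Sum>u\<in>e. g u) \<le> real D * (\<Sum>u\<in>S. g u)"
proof -
  have finF: "finite F" using S F finite_pairs finite_subset by blast
  have "(\<Sum>e\<in>F. \<Sum>u\<in>e. g u) = (\<Sum>e\<in>F. \<Sum>u | u \<in> S \<and> u \<in> e. g u)"
  proof (rule sum.cong[OF refl])
    fix e assume "e \<in> F"
    then have "e = {u. u \<in> S \<and> u \<in> e}" using F by (auto simp: pairs_def)
    then show "sum g e = (\<Sum>u | u \<in> S \<and> u \<in> e. g u)" by (rule arg_cong)
  qed
  also have "\<dots> = (\<Sum>u\<in>S. \<Sum>e | e \<in> F \<and> u \<in> e. g u)" using finF S by (intro sum.swap_restrict)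
  also have "\<dots> \<le> (\<Sum>u\<in>S. real D * g u)"
    using deg g by (intro sum_mono) (auto intro!: mult_right_mono)
  finally show ?thesis by (simp add: sum_distrib_left)
qed

lemma sum_doubleton: "e \<in> pairs S \<Longrightarrow> sum g e = g (Max e) + (g (Min e) :: real)"
  by (elim pairsE) (auto simp: max_def min_def)

lemma abs_square_le: "\<bar>a * \<bar>a\<bar> - b * \<bar>b\<bar>\<bar> \<le> \<bar>a - b\<bar> * (\<bar>a\<bar> + \<bar>b\<bar> :: real)"
proof -
  have "a * \<bar>a\<bar> - b * \<bar>b\<bar> = (a - b) * \<bar>a\<bar> + b * (\<bar>a\<bar> - \<bar>b\<bar>)" by (simp add: algebra_simps)
  also have "\<bar>\<dots>\<bar> \<le> \<bar>a - b\<bar> * \<bar>a\<bar> + \<bar>b\<bar> * \<bar>\<bar>a\<bar> - \<bar>b\<bar>\<bar>"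
    by (rule order_trans[OF abs_triangle_ineq]) (simp add: abs_mult)
  also have "\<dots> \<le> \<bar>a - b\<bar> * \<bar>a\<bar> + \<bar>b\<bar> * \<bar>a - b\<bar>"
    by (intro add_left_mono mult_left_mono abs_triangle_ineq3) auto
  finally show ?thesis by (simp add: algebra_simps)
qed

text \<open>It ensures that the signed square in \<open>cheeger_sweep\<close> has the same sweep
  cuts and medians as the original vector.\<close>

lemma signed_square_le_iff: "a * \<bar>a\<bar> \<le> b * \<bar>b\<bar> \<longleftrightarrow> a \<le> (b :: real)"
proof -
  have mono: "x * \<bar>x\<bar> < y * \<bar>y\<bar>" if "x < y" for x y :: real
  proof -
    consider "0 \<le> x" | "x < 0" "0 \<le> y" | "y < 0" using \<open>x < y\<close> by linarith
    then show ?thesis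
    proof cases
      case 1
      then show ?thesis using \<open>x < y\<close> by (simp add: mult_strict_mono')
    next
      case 2
      then have "x * \<bar>x\<bar> < 0" "0 \<le> y * \<bar>y\<bar>" by (simp_all add: mult_neg_pos mult_neg_neg)
      then show ?thesis by linarith
    next
      case 3
      then have "(- y) * (- y) < (- x) * (- x)" using \<open>x < y\<close> by (intro mult_strict_mono') auto
      then show ?thesis using 3 \<open>x < y\<close> by simp
    qed
  qed
  show ?thesis using mono[of a b] mono[of b a] by (cases a b rule: linorder_cases) auto
qed

text \<open>
  The coarea formula is applied to the signed square of the vector recentred at its median.
\<close>

lemma cheeger_sweep:
  assumes S: "finite S" "S \<noteq> {}" and F: "F \<subseteq> pairs S" and deg: "\<And>u. u \<in> S \<Longrightarrow> card {e \<in> F. u \<in> e} \<le> D"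
    and h: "0 < h" and z: "(\<Sum>u\<in>S. z u) = 0"
    and sweeps: "\<And>j. j \<in> S \<Longrightarrow> h * real (min (card (sweep S z j)) (card (S - sweep S z j))) \<le> real (card (cut F (sweep S z j)))"
  shows "h\<^sup>2 * (\<Sum>u\<in>S. (z u)\<^sup>2) \<le> 2 * real D * (\<Sum>e\<in>F. (sdiff z e)\<^sup>2)"
proof -
  obtain m where m: "median S z m" using median_exists[OF S] by blast
  define g where "g u = z u - z m" for u
  define f where "f u = g u * \<bar>g u\<bar>" for u
  define G where "G = (\<Sum>u\<in>S. (g u)\<^sup>2)"
  define En where "En = (\<Sum>e\<in>F. (sdiff z e)\<^sup>2)"
  have le: "f u \<le> f v \<longleftrightarrow> z u \<le> z v" for u v by (simp add: f_def signed_square_le_iff g_def)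
  have mf: "median S f m" using m by (simp add: median_def le)
  have "h * (\<Sum>u\<in>S. \<bar>f u - f m\<bar>) \<le> (\<Sum>e\<in>F. edge_diff f e)"
    by (rule coarea[OF S(1) F mf]) (use h sweeps in \<open>auto simp: le\<close>)
  moreover have "\<bar>f u - f m\<bar> = (g u)\<^sup>2" for u by (simp add: f_def g_def abs_mult power2_eq_square)
  ultimately have "h * G \<le> (\<Sum>e\<in>F. edge_diff f e)" by (simp add: G_def)
  also have "\<dots> \<le> (\<Sum>e\<in>F. (D / h) * (sdiff z e)\<^sup>2 + h / (2 * D) * (\<Sum>u\<in>e. (g u)\<^sup>2))"
  proof (rule sum_mono)
    fix e assume e: "e \<in> F"
    then obtain u v where uv: "u \<noteq> v" "e = {u, v}" "u \<in> S" "v \<in> S" using F by (blast elim: pairsE)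
    have D: "real D > 0"
    proof -
      have "e \<in> {e \<in> F. u \<in> e}" "finite {e \<in> F. u \<in> e}"
        using e uv finite_subset[OF F finite_pairs[OF S(1)]] by auto
      then have "card {e \<in> F. u \<in> e} > 0" by (auto simp: card_gt_0_iff)
      then show ?thesis using deg[OF uv(3)] by simp
    qed
    have "edge_diff f e \<le> \<bar>g u - g v\<bar> * (\<bar>g u\<bar> + \<bar>g v\<bar>)"
      unfolding uv(2) edge_diff_doubleton f_def by (rule abs_square_le)
    also have "\<bar>g u - g v\<bar> = \<bar>sdiff z e\<bar>"
      unfolding edge_diff_sdiff[symmetric] uv(2) edge_diff_doubleton by (simp add: g_def)
    \<comment> \<open>The weights in the inequality of the means are such that the vertex terms,
      with at most \<open>D\<close> edges per vertex, sum to at most \<open>h / 2 * G\<close>, half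
      of the left-hand side.\<close>
    also have "\<bar>sdiff z e\<bar> * (\<bar>g u\<bar> + \<bar>g v\<bar>) \<le> (D / h) * (sdiff z e)\<^sup>2 + h / (4 * D) * (\<bar>g u\<bar> + \<bar>g v\<bar>)\<^sup>2"
    proof -
      have amgm: "a * b \<le> (D / h) * a\<^sup>2 + h / (4 * D) * b\<^sup>2" for a b :: real
      proof -
        have "0 \<le> (2 * D * a - h * b)\<^sup>2 / (4 * D * h)" using D h by simp
        also have "\<dots> = (D / h) * a\<^sup>2 + h / (4 * D) * b\<^sup>2 - a * b"
          using D h by (simp add: field_simps power2_eq_square)
        finally show ?thesis by simp
      qed
      show ?thesis using amgm[of "\<bar>sdiff z e\<bar>" "\<bar>g u\<bar> + \<bar>g v\<bar>"] by simp
    qed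
    also have "\<dots> \<le> (D / h) * (sdiff z e)\<^sup>2 + h / (4 * D) * (2 * ((g u)\<^sup>2 + (g v)\<^sup>2))"
    proof -
      have "(\<bar>g u\<bar> + \<bar>g v\<bar>)\<^sup>2 \<le> 2 * ((g u)\<^sup>2 + (g v)\<^sup>2)"
        using sum_squares_bound[of "\<bar>g u\<bar>" "\<bar>g v\<bar>"] by (simp add: power2_sum)
      then show ?thesis using D h by (intro add_left_mono mult_left_mono) auto
    qed
    finally show "edge_diff f e \<le> (D / h) * (sdiff z e)\<^sup>2 + h / (2 * D) * (\<Sum>u\<in>e. (g u)\<^sup>2)"
      using uv by (simp add: algebra_simps)
  qed
  also have "\<dots> = (D / h) * En + h / (2 * D) * (\<Sum>e\<in>F. \<Sum>u\<in>e. (g u)\<^sup>2)"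
    by (simp add: sum.distrib sum_distrib_left En_def)
  also have "\<dots> \<le> (D / h) * En + h / (2 * D) * (D * G)"
    unfolding G_def using sum_incident_le[OF S(1) F deg, of "\<lambda>u. (g u)\<^sup>2"] h
    by (intro add_left_mono mult_left_mono) auto
  also have "\<dots> \<le> (D / h) * En + h / 2 * G"
  proof -
    have "0 \<le> G" by (simp add: G_def sum_nonneg)
    then show ?thesis using h by (cases "D = 0") auto
  qed
  finally have "h * G \<le> 2 * ((D / h) * En)" by simp
  then have "h * (h * G) \<le> h * (2 * ((D / h) * En))" using h by (intro mult_left_mono) auto
  also have "\<dots> = 2 * D * En" using h by simp
  finally have "h\<^sup>2 * G \<le> 2 * D * En" by (simp add: power2_eq_square mult.assoc)
  \<comment> \<open>Among the translates of a vector, the one with mean 0 has the least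
    norm.\<close>
  moreover have "(\<Sum>u\<in>S. (z u)\<^sup>2) \<le> G"
  proof -
    have "G = (\<Sum>u\<in>S. (z u)\<^sup>2) - 2 * z m * (\<Sum>u\<in>S. z u) + card S * (z m)\<^sup>2"
    proof -
      have "G = (\<Sum>u\<in>S. (z u)\<^sup>2 - 2 * z m * z u + (z m)\<^sup>2)"
        by (simp add: G_def g_def power2_diff algebra_simps)
      then show ?thesis by (simp add: sum.distrib sum_subtractf sum_distrib_left)
    qed
    then show ?thesis using z by simp
  qed
  then have "h\<^sup>2 * (\<Sum>u\<in>S. (z u)\<^sup>2) \<le> h\<^sup>2 * G" by (rule mult_left_mono) simp
  ultimately show ?thesis unfolding En_def by linarith
qed

section \<open>Power iteration\<close>

text \<open>
  This is \<open>d - L\<close> for the Laplacian \<open>L\<close> of the graph \<open>(S, F)\<close>. It is positive semidefinite when \<open>d\<close> is at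
  least twice the maximum degree, and its powers then amplify the small eigenvalues of \<open>L\<close>.
\<close>

definition shift_op :: "nat set \<Rightarrow> nat set set \<Rightarrow> 'a :: comm_ring_1 \<Rightarrow> (nat \<Rightarrow> 'a) \<Rightarrow> nat \<Rightarrow> 'a" where
  "shift_op S F d v u = d * v u - (\<Sum>w | w \<in> S \<and> {u, w} \<in> F. v u - v w)"

lemma sum_ordered_pairs:
  fixes g :: "nat \<Rightarrow> nat \<Rightarrow> real"
  assumes S: "finite S" and F: "F \<subseteq> pairs S"
  shows "(\<Sum>u\<in>S. \<Sum>w | w \<in> S \<and> {u, w} \<in> F. g u w) = (\<Sum>e\<in>F. g (Min e) (Max e) + g (Max e) (Min e))"
proof -
  have finF: "finite F" using finite_subset[OF F finite_pairs[OF S]] .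
  have one: "(\<Sum>u\<in>S. \<Sum>w\<in>S. if {u, w} = e then g u w else 0) = g (Min e) (Max e) + g (Max e) (Min e)" if "e \<in> F" for e
  proof -
    obtain p q where pq: "p < q" "e = {p, q}" "p \<in> S" "q \<in> S"
    proof -
      obtain u v where "u \<noteq> v" "e = {u, v}" "u \<in> S" "v \<in> S" using \<open>e \<in> F\<close> F by (blast elim: pairsE)
      then show ?thesis using that[of u v] that[of v u] by (cases "u < v") (auto simp: insert_commute)
    qed
    have "(\<Sum>u\<in>S. \<Sum>w\<in>S. if {u, w} = e then g u w else 0) =
        (\<Sum>u\<in>S. \<Sum>w\<in>S. (if u = p then if w = q then g p q else 0 else 0) + (if u = q then if w = p then g q p else 0 else 0))"
      using pq(1) unfolding pq(2) by (intro sum.cong refl) (auto simp: doubleton_eq_iff)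
    also have "\<dots> = (\<Sum>u\<in>S. if u = p then \<Sum>w\<in>S. if w = q then g p q else 0 else 0) + (\<Sum>u\<in>S. if u = q then \<Sum>w\<in>S. if w = p then g q p else 0 else 0)"
      unfolding sum.distrib by (intro arg_cong2[of _ _ _ _ "(+)"] sum.cong refl) auto
    also have "\<dots> = g p q + g q p" using pq S by simp
    finally show ?thesis using pq(1) unfolding pq(2) by simp
  qed
  have "(\<Sum>u\<in>S. \<Sum>w | w \<in> S \<and> {u, w} \<in> F. g u w) = (\<Sum>u\<in>S. \<Sum>w\<in>S. if {u, w} \<in> F then g u w else 0)"
    by (rule sum.cong[OF refl], rule sum.inter_filter[OF S])
  also have "\<dots> = (\<Sum>u\<in>S. \<Sum>w\<in>S. \<Sum>e\<in>F. if {u, w} = e then g u w else 0)"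
    using finF by (simp add: sum.delta')
  also have "\<dots> = (\<Sum>e\<in>F. \<Sum>u\<in>S. \<Sum>w\<in>S. if {u, w} = e then g u w else 0)"
    by (subst sum.swap[of _ F], subst sum.swap[of _ F]) (rule refl)
  also have "\<dots> = (\<Sum>e\<in>F. g (Min e) (Max e) + g (Max e) (Min e))" by (rule sum.cong[OF refl one])
  finally show ?thesis .
qed

lemma form_of_shift_op:
  fixes z v :: "nat \<Rightarrow> real"
  assumes S: "finite S" and F: "F \<subseteq> pairs S"
  shows "(\<Sum>u\<in>S. z u * shift_op S F d v u) = d * (\<Sum>u\<in>S. z u * v u) - (\<Sum>e\<in>F. sdiff z e * sdiff v e)"
proof -
  have "(\<Sum>u\<in>S. z u * shift_op S F d v u) =
      d * (\<Sum>u\<in>S. z u * v u) - (\<Sum>u\<in>S. \<Sum>w | w \<in> S \<and> {u, w} \<in> F. z u * (v u - v w))"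
    by (simp add: shift_op_def right_diff_distrib sum_subtractf sum_distrib_left mult_ac)
  also have "(\<Sum>u\<in>S. \<Sum>w | w \<in> S \<and> {u, w} \<in> F. z u * (v u - v w)) = (\<Sum>e\<in>F. sdiff z e * sdiff v e)"
    unfolding sum_ordered_pairs[OF S F] by (intro sum.cong refl) (simp add: sdiff_def algebra_simps)
  finally show ?thesis .
qed

text \<open>The core of the Cauchy-Schwarz inequality for semidefinite forms. It serves both
  \<open>inner\<close> and the form given by \<open>M\<close>, and it allows
  \<open>c = 0\<close>.\<close>

lemma discriminant_nonpos:
  fixes a b c :: real
  assumes "\<And>s. 0 \<le> a + 2 * s * b + s\<^sup>2 * c"
  shows "b\<^sup>2 \<le> a * c"
proof (cases "c = 0")
  case True
  have "b = 0"
  proof (rule ccontr)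
    assume "b \<noteq> 0"
    then show False using assms[of "- (a + 1) / (2 * b)"] True by (simp add: field_simps)
  qed
  then show ?thesis using True by simp
next
  case False
  have "c > 0"
  proof (rule ccontr)
    assume "\<not> c > 0"
    then have c: "c < 0" using False by simp
    \<comment> \<open>Large enough for the negative quadratic term to outweigh the other
      two.\<close>
    define s where "s = (\<bar>a\<bar> + 2 * \<bar>b\<bar> + 1) / \<bar>c\<bar> + 1"
    have s: "s \<ge> 1" "\<bar>a\<bar> + 2 * \<bar>b\<bar> + 1 \<le> s * \<bar>c\<bar>" using c by (auto simp: s_def field_simps)
    have "\<bar>a\<bar> + 2 * s * \<bar>b\<bar> < s * (\<bar>a\<bar> + 2 * \<bar>b\<bar> + 1)"
      using s(1) mult_right_mono[of 1 s "\<bar>a\<bar>"] by (simp add: algebra_simps)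
    also have "\<dots> \<le> s * (s * \<bar>c\<bar>)" using s by (intro mult_left_mono) auto
    finally have "\<bar>a\<bar> + 2 * s * \<bar>b\<bar> + s\<^sup>2 * c < 0" using c by (simp add: power2_eq_square mult.assoc)
    moreover have "2 * s * b \<le> 2 * s * \<bar>b\<bar>" using s(1) by simp
    ultimately show False using assms[of s] by linarith
  qed
  then have "0 \<le> (a + 2 * (- b / c) * b + (- b / c)\<^sup>2 * c) * c" using assms[of "- b / c"] by simp
  also have "\<dots> = a * c - b\<^sup>2" using \<open>c > 0\<close> by (simp add: field_simps power2_eq_square)
  finally show ?thesis by simp
qed

text \<open>Log-convexity makes the ratios of consecutive terms increase, so the last ratio bounds
  all earlier ones, and their product telescopes. Working with products instead of quotients admits
  vanishing terms.\<close>

lemma log_convex_ratio_down: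
  fixes f :: "nat \<Rightarrow> real"
  assumes nn: "\<And>j. 0 \<le> f j" and lc: "\<And>j. (f (Suc j))\<^sup>2 \<le> f j * f (Suc (Suc j))"
    and q: "0 \<le> q" and top: "f (Suc k) \<le> q * f k"
  shows "f k \<le> q ^ k * f 0"
proof -
  have step: "f (Suc j) \<le> q * f j" if "j \<le> k" for j
    using that
  proof (induction rule: inc_induct)
    case (step j)
    show ?case
    proof (cases "f (Suc j) = 0")
      case False
      then have pos: "f (Suc j) > 0" using nn[of "Suc j"] by simp
      have "f (Suc j) * f (Suc j) \<le> f j * f (Suc (Suc j))" using lc[of j] by (simp add: power2_eq_square)
      also have "\<dots> \<le> f j * (q * f (Suc j))" using step.IH nn by (intro mult_left_mono) auto
      finally have "f (Suc j) * f (Suc j) \<le> (q * f j) * f (Suc j)" by (simp add: mult_ac)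
      then show ?thesis using pos by simp
    qed (use nn q in simp)
  qed (rule top)
  have "f j \<le> q ^ j * f 0" if "j \<le> k" for j
    using that
  proof (induction j)
    case (Suc j)
    have "f (Suc j) \<le> q * f j" using step[of j] Suc.prems by simp
    also have "\<dots> \<le> q * (q ^ j * f 0)" using Suc q by (intro mult_left_mono) auto
    finally show ?case by (simp add: mult_ac)
  qed simp
  then show ?thesis by simp
qed

text \<open>The first ratio is the smallest, so growth can only accelerate; positivity of
  \<open>f 0\<close> excludes a later return from 0.\<close>

lemma log_convex_ratio_up:
  fixes f :: "nat \<Rightarrow> real"
  assumes nn: "\<And>j. 0 \<le> f j" and lc: "\<And>j. (f (Suc j))\<^sup>2 \<le> f j * f (Suc (Suc j))"
    and f0: "0 < f 0"
  shows "(f 1 / f 0) ^ k * f 0 \<le> f k"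
proof -
  let ?r = "f 1 / f 0"
  have r: "0 \<le> ?r" using nn f0 by simp
  have step: "?r * f j \<le> f (Suc j)" for j
  proof (induction j)
    case 0
    then show ?case using f0 by simp
  next
    case (Suc j)
    show ?case
    proof (cases "f (Suc j) = 0")
      case False
      then have pos: "f (Suc j) > 0" using nn[of "Suc j"] by simp
      have "f j \<noteq> 0" using lc[of j] pos by (metis mult_zero_left not_le zero_less_power)
      then have fj: "f j > 0" using nn[of j] by simp
      have "?r * f j * f (Suc j) \<le> f (Suc j) * f (Suc j)" using Suc pos by (intro mult_right_mono) auto
      also have "\<dots> \<le> f j * f (Suc (Suc j))" using lc[of j] by (simp add: power2_eq_square)
      finally have "f j * (?r * f (Suc j)) \<le> f j * f (Suc (Suc j))" by (simp only: mult_ac)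
      then show ?thesis using fj by (rule mult_left_le_imp_le)
    qed (use nn in simp)
  qed
  show ?thesis
  proof (induction k)
    case (Suc k)
    have "?r ^ Suc k * f 0 = ?r * (?r ^ k * f 0)" by simp
    also have "\<dots> \<le> ?r * f k" using Suc r by (intro mult_left_mono)
    also have "\<dots> \<le> f (Suc k)" by (rule step)
    finally show ?case .
  qed simp
qed

section \<open>Moments of the shifted Laplacian\<close>

locale shifted_graph =
  fixes S :: "nat set" and F :: "nat set set" and D :: nat and d :: real
  assumes S: "finite S" "S \<noteq> {}" and F: "F \<subseteq> pairs S"
    and deg: "\<And>u. u \<in> S \<Longrightarrow> card {e \<in> F. u \<in> e} \<le> D"
    and d: "2 * real D \<le> d" "0 < d"
begin

abbreviation "M \<equiv> shift_op S F d"
abbreviation inner :: "(nat \<Rightarrow> real) \<Rightarrow> (nat \<Rightarrow> real) \<Rightarrow> real" where "inner z v \<equiv> \<Sum>u\<in>S. z u * v u"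
abbreviation "energy z \<equiv> \<Sum>e\<in>F. (sdiff z e)\<^sup>2"

lemma inner_M: "inner z (M v) = d * inner z v - (\<Sum>e\<in>F. sdiff z e * sdiff v e)"
  by (rule form_of_shift_op[OF S(1) F])

lemma M_symmetric: "inner z (M v) = inner (M z) v"
  using inner_M[of z v] inner_M[of v z] by (simp add: mult.commute)

lemma inner_M_self: "inner v (M v) = d * inner v v - energy v"
  using inner_M[of v v] by (simp add: power2_eq_square)

lemma inner_nonneg: "0 \<le> inner v v"
  by (simp add: sum_nonneg)

lemma inner_M_nonneg: "0 \<le> inner v (M v)"
proof -
  have "energy v \<le> (\<Sum>e\<in>F. \<Sum>u\<in>e. 2 * (v u)\<^sup>2)"
  proof (rule sum_mono)
    fix e assume "e \<in> F"
    then have e: "e \<in> pairs S" using F by auto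
    show "(sdiff v e)\<^sup>2 \<le> (\<Sum>u\<in>e. 2 * (v u)\<^sup>2)"
      unfolding sum_doubleton[OF e] sdiff_def using sum_squares_bound[of "v (Max e)" "- v (Min e)"]
      by (simp add: power2_diff)
  qed
  also have "\<dots> \<le> D * (\<Sum>u\<in>S. 2 * (v u)\<^sup>2)" by (rule sum_incident_le[OF S(1) F deg]) auto
  also have "\<dots> = 2 * real D * inner v v" by (simp add: power2_eq_square sum_distrib_left mult_ac)
  also have "\<dots> \<le> d * inner v v" using d inner_nonneg by (intro mult_right_mono)
  finally show ?thesis unfolding inner_M_self by simp
qed

lemma M_linear: "M (\<lambda>u. a * v u + b * w u) = (\<lambda>u. a * M v u + b * M w u)"
proof
  fix u
  have "(\<Sum>x | x \<in> S \<and> {u, x} \<in> F. a * v u + b * w u - (a * v x + b * w x)) =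
      a * (\<Sum>x | x \<in> S \<and> {u, x} \<in> F. v u - v x) + b * (\<Sum>x | x \<in> S \<and> {u, x} \<in> F. w u - w x)"
    unfolding sum_distrib_left sum.distrib[symmetric] by (intro sum.cong refl) (simp add: algebra_simps)
  then show "M (\<lambda>u. a * v u + b * w u) u = a * M v u + b * M w u"
    by (simp add: shift_op_def algebra_simps)
qed

lemma M_sum: "finite I \<Longrightarrow> M (\<lambda>u. \<Sum>i\<in>I. c i * v i u) = (\<lambda>u. \<Sum>i\<in>I. c i * M (v i) u)"
proof (induction I rule: finite_induct)
  case empty
  then show ?case by (simp add: shift_op_def)
next
  case (insert i I)
  then show ?case using M_linear[of "c i" "v i" 1 "\<lambda>u. \<Sum>i\<in>I. c i * v i u"] by simp
qed

lemma M_pow_sum: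
  assumes "finite I"
  shows "(M ^^ k) (\<lambda>u. \<Sum>i\<in>I. c i * v i u) = (\<lambda>u. \<Sum>i\<in>I. c i * (M ^^ k) (v i) u)"
  by (induction k) (simp_all add: M_sum[OF assms])

text \<open>Constants are eigenvectors. Subtracting the mean before the iteration therefore only
  translates the iterate, which keeps its sweep cuts; integer unit vectors can stand for their
  projections in the program.\<close>

lemma M_pow_sub_const: "(M ^^ k) (\<lambda>u. v u - c) = (\<lambda>u. (M ^^ k) v u - d ^ k * c)"
proof (induction k)
  case (Suc k)
  have "M (\<lambda>u. (M ^^ k) v u - d ^ k * c) = (\<lambda>u. M ((M ^^ k) v) u - d ^ Suc k * c)"
    by (auto simp: shift_op_def algebra_simps)
  then show ?case using Suc by simp
qed simp

lemma sum_M: "(\<Sum>u\<in>S. M v u) = d * (\<Sum>u\<in>S. v u)"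
  using inner_M[of "\<lambda>_. 1" v] by (simp add: sdiff_def)

lemma sum_M_pow: "(\<Sum>u\<in>S. (M ^^ k) v u) = d ^ k * (\<Sum>u\<in>S. v u)"
  by (induction k) (simp_all add: sum_M)

definition moment :: "(nat \<Rightarrow> real) \<Rightarrow> nat \<Rightarrow> real" where
  "moment v j = inner v ((M ^^ j) v)"

lemma inner_M_pow: "inner ((M ^^ i) v) ((M ^^ j) v) = moment v (i + j)"
proof (induction i arbitrary: j)
  case (Suc i)
  have "inner ((M ^^ Suc i) v) ((M ^^ j) v) = inner ((M ^^ i) v) ((M ^^ Suc j) v)"
    using M_symmetric by simp
  then show ?case using Suc[of "Suc j"] by simp
qed (simp add: moment_def)

lemma inner_expand: "inner (\<lambda>u. a u + s * b u) (\<lambda>u. a u + s * b u) = inner a a + 2 * s * inner a b + s\<^sup>2 * inner b b"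
proof -
  have "inner (\<lambda>u. a u + s * b u) (\<lambda>u. a u + s * b u) = (\<Sum>u\<in>S. a u * a u + 2 * s * (a u * b u) + s\<^sup>2 * (b u * b u))"
    by (intro sum.cong refl) (simp add: algebra_simps power2_eq_square)
  then show ?thesis by (simp add: sum.distrib sum_distrib_left)
qed

lemma inner_Cauchy_Schwarz: "(inner a b)\<^sup>2 \<le> inner a a * inner b b"
proof (rule discriminant_nonpos)
  fix s show "0 \<le> inner a a + 2 * s * inner a b + s\<^sup>2 * inner b b"
    using inner_nonneg[of "\<lambda>u. a u + s * b u"] unfolding inner_expand .
qed

lemma inner_M_Cauchy_Schwarz: "(inner a (M b))\<^sup>2 \<le> inner a (M a) * inner b (M b)"
proof (rule discriminant_nonpos)
  fix s
  have "inner (\<lambda>u. a u + s * b u) (M (\<lambda>u. a u + s * b u)) =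
      (\<Sum>u\<in>S. a u * M a u + s * (a u * M b u) + s * (M a u * b u) + s\<^sup>2 * (b u * M b u))"
    using M_linear[of 1 a s b] by (intro sum.cong refl) (simp add: algebra_simps power2_eq_square)
  also have "\<dots> = inner a (M a) + s * inner a (M b) + s * inner (M a) b + s\<^sup>2 * inner b (M b)"
    by (simp add: sum.distrib sum_distrib_left)
  finally show "0 \<le> inner a (M a) + 2 * s * inner a (M b) + s\<^sup>2 * inner b (M b)"
    using inner_M_nonneg[of "\<lambda>u. a u + s * b u"] by (simp add: M_symmetric[symmetric])
qed

lemma moment_nonneg: "0 \<le> moment v j"
proof (cases "even j")
  case True
  then obtain i where "j = i + i" by (metis mult_2 dvdE)
  then show ?thesis using inner_M_pow[of i v i] inner_nonneg by metis
next
  case False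
  then obtain i where "j = i + Suc i" by (metis add_Suc_right mult_2 oddE Suc_eq_plus1)
  then show ?thesis using inner_M_pow[of i v "Suc i"] inner_M_nonneg[of "(M ^^ i) v"] by simp
qed

text \<open>Self-adjointness distributes the powers evenly over both arguments. For even
  \<open>j\<close> this leaves the Cauchy-Schwarz inequality for \<open>inner\<close>; for odd
  \<open>j\<close> one factor \<open>M\<close> remains in the middle, and positivity of
  \<open>M\<close> is required.\<close>

lemma moment_log_convex: "(moment v (Suc j))\<^sup>2 \<le> moment v j * moment v (Suc (Suc j))"
proof (cases "even j")
  case True
  then obtain i where j: "j = i + i" by (metis mult_2 dvdE)
  show ?thesis
    using inner_Cauchy_Schwarz[of "(M ^^ i) v" "(M ^^ Suc i) v"] unfolding inner_M_pow j by simp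
next
  case False
  then obtain i where j: "j = i + Suc i" by (metis add_Suc_right mult_2 oddE Suc_eq_plus1)
  have "inner ((M ^^ i) v) (M ((M ^^ Suc i) v)) = moment v (Suc j)"
    "inner ((M ^^ i) v) (M ((M ^^ i) v)) = moment v j"
    "inner ((M ^^ Suc i) v) (M ((M ^^ Suc i) v)) = moment v (Suc (Suc j))"
    using inner_M_pow[of i v "Suc (Suc i)"] inner_M_pow[of i v "Suc i"] inner_M_pow[of "Suc i" v "Suc (Suc i)"]
    unfolding j by simp_all
  then show ?thesis using inner_M_Cauchy_Schwarz[of "(M ^^ i) v" "(M ^^ Suc i) v"] by metis
qed

text \<open>The projections of the unit vectors to the complement of the constants; they span that
  complement without being independent.\<close>

definition basis :: "nat \<Rightarrow> nat \<Rightarrow> real" where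
  "basis i u = (if u = i then 1 else 0) - 1 / real (card S)"

text \<open>With \<open>r\<close> the Rayleigh quotient of \<open>z\<close>, log-convexity upwards
  gives \<open>r ^ (2 * k)\<close> times the squared norm of \<open>z\<close> as a lower bound for
  that of its \<open>k\<close>-th iterate. Expanding \<open>z\<close> in the \<open>basis i\<close>
  and applying Cauchy-Schwarz bounds the latter by the sum of their moments, and each of these is at
  most \<open>q ^ (2 * k)\<close> by log-convexity downwards from the ratio at \<open>2 * k\<close>.
  No eigenvectors are involved.\<close>

lemma power_iteration:
  fixes q :: real
  assumes q: "0 \<le> q"
    and ratio: "\<And>i. i \<in> S \<Longrightarrow>
      inner ((M ^^ k) (basis i)) ((M ^^ Suc k) (basis i)) \<le> q * inner ((M ^^ k) (basis i)) ((M ^^ k) (basis i))"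
    and z: "(\<Sum>u\<in>S. z u) = 0" and pos: "0 < inner z z"
  shows "(inner z (M z) / inner z z) ^ (2 * k) \<le> card S * q ^ (2 * k)"
proof -
  have fin: "card S > 0" using S by (simp add: card_gt_0_iff)
  have small: "moment (basis i) (2 * k) \<le> q ^ (2 * k)" if i: "i \<in> S" for i
  proof -
    have "moment (basis i) (Suc (2 * k)) \<le> q * moment (basis i) (2 * k)"
      using ratio[OF i] inner_M_pow[of k "basis i" k] inner_M_pow[of k "basis i" "Suc k"] by (simp add: mult_2)
    then have le: "moment (basis i) (2 * k) \<le> q ^ (2 * k) * moment (basis i) 0"
      by (intro log_convex_ratio_down moment_nonneg moment_log_convex q)
    have "moment (basis i) 0 \<le> 1"
    proof -
      have "moment (basis i) 0 = (\<Sum>u\<in>S. (if u = i then 1 - 2 / card S else 0) + (1 / card S)\<^sup>2)"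
        unfolding moment_def funpow_0 basis_def by (intro sum.cong refl) (simp add: algebra_simps power2_eq_square)
      also have "\<dots> = (1 - 2 / card S) + card S * (1 / card S)\<^sup>2" using i S by (simp add: sum.distrib)
      also have "\<dots> = 1 - 1 / card S" using fin by (simp add: power2_eq_square field_simps)
      finally show ?thesis by simp
    qed
    then have "q ^ (2 * k) * moment (basis i) 0 \<le> q ^ (2 * k) * 1" using q by (intro mult_left_mono) auto
    then show ?thesis using le by simp
  qed
  \<comment> \<open>It agrees with \<open>z\<close> on \<open>S\<close>, but it is a combination of
    the \<open>basis i\<close> as a function on all numbers, which is the form that
    \<open>M_pow_sum\<close> takes.\<close>
  define w where "w u = (\<Sum>i\<in>S. z i * basis i u)" for u
  have wz: "w u = z u" if "u \<in> S" for u
  proof -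
    have "w u = (\<Sum>i\<in>S. (if i = u then z i else 0) - z i / card S)"
      unfolding w_def basis_def by (rule sum.cong[OF refl]) (simp add: algebra_simps)
    also have "\<dots> = z u" using that z S by (simp add: sum_subtractf sum_divide_distrib[symmetric])
    finally show ?thesis .
  qed
  have ww: "inner z z = inner w w" using wz by simp
  have Mz: "inner z (M z) = inner w (M w)"
  proof -
    have "M z u = M w u" if "u \<in> S" for u
      using wz that unfolding shift_op_def by (auto intro!: arg_cong2[of _ _ _ _ "(-)"] sum.cong)
    then show ?thesis using wz by simp
  qed
  have "(inner w (M w) / inner w w) ^ (2 * k) * inner w w \<le> moment w (2 * k)"
    using log_convex_ratio_up[of "moment w" "2 * k"] moment_nonneg moment_log_convex pos ww
    by (simp add: moment_def)
  also have "moment w (2 * k) = inner ((M ^^ k) w) ((M ^^ k) w)"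
    using inner_M_pow[of k w k] by (simp add: mult_2)
  also have "\<dots> \<le> (\<Sum>u\<in>S. inner z z * (\<Sum>i\<in>S. ((M ^^ k) (basis i) u)\<^sup>2))"
  proof (rule sum_mono)
    fix u
    have "(M ^^ k) w u = inner z (\<lambda>i. (M ^^ k) (basis i) u)"
      unfolding w_def by (subst M_pow_sum[OF S(1)]) simp
    then have "(M ^^ k) w u * (M ^^ k) w u = (inner z (\<lambda>i. (M ^^ k) (basis i) u))\<^sup>2" by (simp add: power2_eq_square)
    also have "\<dots> \<le> inner z z * inner (\<lambda>i. (M ^^ k) (basis i) u) (\<lambda>i. (M ^^ k) (basis i) u)" by (rule inner_Cauchy_Schwarz)
    finally show "(M ^^ k) w u * (M ^^ k) w u \<le> inner z z * (\<Sum>i\<in>S. ((M ^^ k) (basis i) u)\<^sup>2)"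
      by (simp add: power2_eq_square)
  qed
  also have "\<dots> = inner z z * (\<Sum>i\<in>S. moment (basis i) (2 * k))"
  proof -
    have "(\<Sum>i\<in>S. moment (basis i) (2 * k)) = (\<Sum>i\<in>S. \<Sum>u\<in>S. ((M ^^ k) (basis i) u)\<^sup>2)"
      using inner_M_pow[of k _ k] by (intro sum.cong refl) (simp add: mult_2 power2_eq_square)
    also have "\<dots> = (\<Sum>u\<in>S. \<Sum>i\<in>S. ((M ^^ k) (basis i) u)\<^sup>2)" by (rule sum.swap)
    finally show ?thesis by (simp only: sum_distrib_left)
  qed
  also have "\<dots> \<le> inner z z * (\<Sum>i\<in>S. q ^ (2 * k))"
    using small inner_nonneg by (intro mult_left_mono sum_mono) auto
  finally have "(inner w (M w) / inner w w) ^ (2 * k) * inner z z \<le> (card S * q ^ (2 * k)) * inner z z"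
    using ww by (simp add: mult_ac)
  then show ?thesis using pos unfolding ww[symmetric] Mz[symmetric] by simp
qed

text \<open>Cheeger's inequality bounds the Rayleigh quotient of each iterate, and
  \<open>power_iteration\<close> extends the bound to all \<open>z\<close> at the price of the
  \<open>2 * k\<close>-th root of \<open>card S\<close>. With \<open>k \<ge> n ^ 6\<close> this
  price is at most half of the gap, hence \<open>4 * D\<close> in place of
  \<open>2 * D\<close>.\<close>

lemma sweep_expansion_imp_gap:
  assumes D: "0 < D" "D \<le> n" and n: "2 \<le> n" "card S \<le> n" and dn: "d = 2 * real n + 1"
    and k: "n ^ 6 \<le> k" and h: "0 < h" "h \<le> real D"
    and sweeps: "\<And>i j v. i \<in> S \<Longrightarrow> j \<in> S \<Longrightarrow> v = (M ^^ k) (\<lambda>u. if u = i then 1 else 0) \<Longrightarrow>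
      h * real (min (card (sweep S v j)) (card (S - sweep S v j))) \<le> real (card (cut F (sweep S v j)))"
    and z: "(\<Sum>u\<in>S. z u) = 0"
  shows "h\<^sup>2 / (4 * D) * inner z z \<le> energy z"
proof (cases "inner z z = 0")
  case True
  then show ?thesis by (simp add: sum_nonneg)
next
  case False
  then have pos: "0 < inner z z" using inner_nonneg[of z] by simp
  \<comment> \<open>Cut sizes are integers and the smaller side has at most \<open>n / 2\<close>
    vertices, so a proper cut that is not empty has density at least \<open>2 / n\<close>. The gap
    is thus inverse polynomial however small \<open>h\<close> is, and polynomially many iterations
    suffice.\<close>
  define h' where "h' = max h (2 / n)"
  have n0: "real n > 0" "real n \<ge> 2" using n by auto
  have h': "0 < h'" "h \<le> h'" "2 / n \<le> h'" using h by (auto simp: h'_def)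
  have "2 / real n \<le> 1" using n0 by (simp add: field_simps)
  moreover have "1 \<le> real D" using D by simp
  ultimately have "2 / real n \<le> real D" by linarith
  then have h'D: "h' \<le> D" using h by (simp add: h'_def)
  have sweeps': "h' * real (min (card (sweep S v j)) (card (S - sweep S v j))) \<le> real (card (cut F (sweep S v j)))"
    if "i \<in> S" "j \<in> S" "v = (M ^^ k) (\<lambda>u. if u = i then 1 else 0)" for i j v
  proof (cases "min (card (sweep S v j)) (card (S - sweep S v j)) = 0")
    case False
    let ?c = "min (card (sweep S v j)) (card (S - sweep S v j))"
    have "0 < h * real ?c" using False h by simp
    then have "0 < card (cut F (sweep S v j))" using sweeps[OF that] by linarith
    then have 1: "1 \<le> real (card (cut F (sweep S v j)))" by linarith
    have "card (sweep S v j) + card (S - sweep S v j) = card S"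
      using S card_mono[of S "sweep S v j"] by (simp add: card_Diff_subset)
    then have "2 * ?c \<le> n" using n by linarith
    then have "2 * real ?c \<le> n" by linarith
    then have "2 / n * real ?c \<le> 1" using n0 by (simp add: field_simps)
    then have "2 / n * real ?c \<le> real (card (cut F (sweep S v j)))" using 1 by linarith
    then show ?thesis using sweeps[OF that] by (simp add: h'_def max_def)
  qed simp
  define q where "q = d - h'\<^sup>2 / (2 * D)"
  have hD: "h'\<^sup>2 / (2 * D) \<le> D"
  proof -
    have "h'\<^sup>2 \<le> (real D)\<^sup>2" using h' h'D by (intro power_mono) auto
    then have "h'\<^sup>2 \<le> 2 * (real D * real D)" by (simp add: power2_eq_square) (use zero_le_square[of "real D"] in linarith)
    then show ?thesis using D by (simp add: field_simps)
  qed
  have kpos: "0 < k"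
  proof -
    have "0 < n ^ 6" using n by simp
    then show ?thesis using k by linarith
  qed
  have q: "0 < q" using hD D dn by (simp add: q_def)
  have "(inner z (M z) / inner z z) ^ (2 * k) \<le> card S * q ^ (2 * k)"
  proof (rule power_iteration[OF less_imp_le[OF q] _ z pos])
    fix i assume i: "i \<in> S"
    define e where "e u = (if u = i then 1 else 0 :: real)" for u
    define v where "v = (M ^^ k) (\<lambda>u. e u - 1 / card S)"
    define v0 where "v0 = (M ^^ k) e"
    have v: "v u = v0 u - d ^ k * (1 / card S)" for u by (simp add: v_def v0_def M_pow_sub_const)
    have le: "v u \<le> v w \<longleftrightarrow> v0 u \<le> v0 w" for u w by (simp add: v)
    have "(\<Sum>u\<in>S. e u - 1 / card S) = 0" using S i by (simp add: e_def sum_subtractf)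
    then have s0: "(\<Sum>u\<in>S. v u) = 0" by (simp add: v_def sum_M_pow)
    have "v0 = (M ^^ k) (\<lambda>u. if u = i then 1 else 0)" by (simp add: v0_def e_def[abs_def])
    then have sw: "h' * real (min (card (sweep S v j)) (card (S - sweep S v j))) \<le> real (card (cut F (sweep S v j)))"
      if "j \<in> S" for j unfolding le using sweeps'[OF i that] by blast
    have "h'\<^sup>2 * (\<Sum>u\<in>S. (v u)\<^sup>2) \<le> 2 * real D * energy v"
      by (rule cheeger_sweep[OF S F deg h'(1) s0 sw])
    moreover have "inner v v = (\<Sum>u\<in>S. (v u)\<^sup>2)" by (simp add: power2_eq_square)
    ultimately have "h'\<^sup>2 / (2 * D) * inner v v \<le> energy v" using D by (simp add: pos_divide_le_eq mult.commute)
    then have "inner v (M v) \<le> q * inner v v" unfolding inner_M_self q_def by (simp add: algebra_simps)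
    moreover have "v = (M ^^ k) (basis i)" by (simp add: v_def e_def basis_def[abs_def])
    ultimately show "inner ((M ^^ k) (basis i)) ((M ^^ Suc k) (basis i)) \<le> q * inner ((M ^^ k) (basis i)) ((M ^^ k) (basis i))"
      by simp
  qed
  also have "\<dots> \<le> (1 + n / (2 * k)) ^ (2 * k) * q ^ (2 * k)"
  proof -
    \<comment> \<open>Bernoulli's inequality hides the factor \<open>card S\<close> in a
      \<open>2 * k\<close>-th power, so that the root can be taken on both sides.\<close>
    have "real (card S) \<le> 1 + real (2 * k) * (n / (2 * k))" using n kpos by simp
    also have "\<dots> \<le> (1 + n / (2 * k)) ^ (2 * k)"
      by (rule Bernoulli_inequality) (rule order_trans[of _ 0], simp_all)
    finally show ?thesis using q by (intro mult_right_mono) auto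
  qed
  also have "\<dots> = ((1 + n / (2 * k)) * q) ^ (2 * k)" by (simp add: power_mult_distrib)
  finally have pw: "(inner z (M z) / inner z z) ^ (2 * k) \<le> ((1 + n / (2 * k)) * q) ^ (2 * k)" .
  have kk: "real n ^ 6 \<le> real k" using k by (metis of_nat_le_iff of_nat_power)
  have "inner z (M z) / inner z z \<le> (1 + n / (2 * k)) * q"
    by (rule power_le_imp_le_base[of _ "2 * k - 1"]) (use pw kpos q in simp_all)
  then have "inner z (M z) \<le> (q + n / (2 * k) * q) * inner z z" using pos by (simp add: pos_divide_le_eq algebra_simps)
  also have "\<dots> \<le> (q + h'\<^sup>2 / (4 * D)) * inner z z"
  proof (intro mult_right_mono add_left_mono inner_nonneg)
    have "q \<le> d" using D by (simp add: q_def)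
    \<comment> \<open>Origin of the exponent 6: \<open>q\<close> is at most \<open>3 * n\<close>,
      and the error \<open>3 * n\<^sup>2 / (2 * k)\<close> must not exceed
      \<open>h'\<^sup>2 / (4 * D)\<close>, which is at least \<open>1 / n ^ 3\<close> because
      \<open>h' \<ge> 2 / n\<close> and \<open>D \<le> n\<close>.\<close>
    then have "n / (2 * k) * q \<le> n / (2 * k) * (3 * n)" using dn n0 by (intro mult_left_mono) auto
    also have "\<dots> \<le> n / (2 * n ^ 6) * (3 * n)"
      using kk n0 kpos by (intro mult_right_mono divide_left_mono mult_pos_pos) auto
    also have "\<dots> = 3 / (2 * n ^ 4)" using n0 by (simp add: eval_nat_numeral field_simps)
    also have "\<dots> \<le> 1 / n ^ 3" using n0 by (simp add: eval_nat_numeral field_simps)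
    also have "\<dots> = (2 / n)\<^sup>2 / (4 * n)" using n0 by (simp add: eval_nat_numeral field_simps)
    also have "\<dots> \<le> h'\<^sup>2 / (4 * D)" using h' n0 D by (intro frac_le power_mono) auto
    finally show "n / (2 * k) * q \<le> h'\<^sup>2 / (4 * D)" .
  qed
  also have "q + h'\<^sup>2 / (4 * D) = d - h'\<^sup>2 / (4 * D)" using D by (simp add: q_def field_simps)
  finally have "inner z (M z) \<le> (d - h'\<^sup>2 / (4 * D)) * inner z z" .
  then have "h'\<^sup>2 / (4 * D) * inner z z \<le> energy z" unfolding inner_M_self by (simp add: algebra_simps)
  moreover have "h\<^sup>2 / (4 * D) * inner z z \<le> h'\<^sup>2 / (4 * D) * inner z z"
    using h h' pos by (intro mult_right_mono divide_right_mono power_mono) auto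
  ultimately show ?thesis by linarith
qed

end

section \<open>Large expanding sets\<close>

lemma induced_edges_pairs: "E \<subseteq> pairs V \<Longrightarrow> induced_edges E S \<subseteq> pairs S"
  by (auto simp: induced_edges_def pairs_def)

lemma cut_induced_edges:
  assumes "E \<subseteq> pairs V" "A \<subseteq> S"
  shows "cut (induced_edges E S) A = between E A (S - A)"
proof -
  have "e \<subseteq> S \<and> card (e \<inter> A) = 1 \<longleftrightarrow> e \<inter> A \<noteq> {} \<and> e \<inter> (S - A) \<noteq> {}" if "e \<in> E" for e
  proof -
    obtain u v where uv: "u \<noteq> v" "e = {u, v}" using \<open>e \<in> E\<close> assms(1) by (blast elim: pairsE)
    have "card (e \<inter> A) = 1 \<longleftrightarrow> (u \<in> A) \<noteq> (v \<in> A)" using card_doubleton_Int uv by simp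
    moreover have "e \<subseteq> S \<longleftrightarrow> u \<in> S \<and> v \<in> S" "e \<inter> A \<noteq> {} \<longleftrightarrow> u \<in> A \<or> v \<in> A"
      "e \<inter> (S - A) \<noteq> {} \<longleftrightarrow> (u \<in> S \<and> u \<notin> A) \<or> (v \<in> S \<and> v \<notin> A)" using uv by auto
    ultimately show ?thesis using assms(2) by blast
  qed
  then show ?thesis by (auto simp: cut_def induced_edges_def between_def)
qed

section \<open>Sparse cuts of a narrow window\<close>

definition expanding :: "nat set set \<Rightarrow> real \<Rightarrow> nat set \<Rightarrow> nat set \<Rightarrow> bool" where
  "expanding E h S A \<longleftrightarrow> h * real (min (card A) (card (S - A))) \<le> real (card (cut (induced_edges E S) A))"

definition side :: "(nat set \<Rightarrow> nat set) \<Rightarrow> nat \<Rightarrow> nat set \<Rightarrow> nat set" where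
  "side C z S = (if z \<in> C S then C S else S - C S)"

text \<open>An edge inside the window carries at most \<open>K * t\<close> and a vertex weighs at
  least \<open>t\<close>, so a cut with at most \<open>h\<close> edges per vertex of a side carries
  at most \<open>h * K\<close> times the volume of that side; \<open>h * K\<close> is the
  \<open>\<phi>\<close> of the potential. The second condition on \<open>h\<close> bounds by
  \<open>lam / 2\<close> what the logarithmic term can contribute,
  \<open>16 * K / (3 * \<delta>)\<close> being the largest ratio of volumes that occurs.\<close>

locale narrow_window = sdp_solution +
  fixes B :: "nat set" and K t h :: real
  assumes B: "B \<subseteq> {..<n}" "B \<noteq> {}" and t: "0 < t" and K: "1 \<le> K"
    and weights: "\<And>u. u \<in> B \<Longrightarrow> t \<le> weight u" "\<And>u. u \<in> B \<Longrightarrow> weight u \<le> K * t"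
    and bd_B: "bd B \<le> lam / 8 * vol B"
    and h: "0 < h" "4 * (h * K) * ln (16 * K / (3 * \<delta>)) \<le> lam / 2"
begin

text \<open>The size bound concerns \<open>card S - 1\<close>, which forces two vertices. The
  right-hand side of the last conjunct bounds the potential of \<open>B\<close> and stays fixed
  along the branch.\<close>

definition balanced :: "nat set \<Rightarrow> bool" where
  "balanced S \<longleftrightarrow> S \<subseteq> B \<and> S \<noteq> {} \<and> 3 * \<delta> * n / 8 \<le> real (card S) - 1 \<and>
     bd S / vol S + 4 * (h * K) * ln (vol S) \<le> lam / 8 + 4 * (h * K) * ln (vol B)"

lemma finite_sub: "S \<subseteq> B \<Longrightarrow> finite S"
  by (rule finite_subset[OF _ finite_subset[OF B(1) finite_lessThan]])

lemma vol_ge: assumes "S \<subseteq> B" shows "t * card S \<le> vol S"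
proof -
  have "(\<Sum>u\<in>S. t) \<le> vol S" by (rule sum_mono) (use assms in \<open>blast intro: weights(1)\<close>)
  then show ?thesis by (simp add: mult.commute)
qed

lemma vol_le: assumes "S \<subseteq> B" shows "vol S \<le> K * t * card S"
proof -
  have "vol S \<le> (\<Sum>u\<in>S. K * t)" by (rule sum_mono) (use assms in \<open>blast intro: weights(2)\<close>)
  then show ?thesis by (simp add: mult.commute)
qed

lemma vol_sub_pos: assumes "S \<subseteq> B" "S \<noteq> {}" shows "0 < vol S"
proof -
  have "0 < card S" using assms(2) finite_sub[OF assms(1)] by (simp add: card_gt_0_iff)
  then have "0 < t * card S" using t by simp
  then show ?thesis using vol_ge[OF assms(1)] by linarith
qed

text \<open>Against \<open>bd_ge\<close>, a conductance of at most 5/8 of \<open>lam\<close> leaves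
  \<open>1 - (card S - 1) / (\<delta> * n) \<le> 5 / 8\<close>, whence 3/8.\<close>

lemma large_if_small_boundary:
  assumes "S \<subseteq> B" "S \<noteq> {}" "bd S \<le> 5 / 8 * lam * vol S"
  shows "3 * \<delta> * n / 8 \<le> real (card S) - 1"
proof -
  have v: "0 < vol S" using assms vol_sub_pos by blast
  have "lam * ((1 - (real (card S) - 1) / (\<delta> * n)) * vol S) \<le> 5 / 8 * lam * vol S"
    using bd_ge[of S] assms B by (meson order_trans subset_trans)
  then have "(lam * vol S) * (1 - (real (card S) - 1) / (\<delta> * n)) \<le> (lam * vol S) * (5 / 8)"
    by (simp add: mult_ac)
  then have "1 - (real (card S) - 1) / (\<delta> * n) \<le> 5 / 8" using v lam by (simp del: mult.commute)
  then have "3 / 8 \<le> (real (card S) - 1) / (\<delta> * n)" by simp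
  then show ?thesis using \<delta> n_pos by (simp add: field_simps)
qed

text \<open>The volume bound is half of what \<open>balanced_vol\<close> gives, so that it applies
  to the heavier part of a balanced set before this part is known to be balanced. As
  \<open>vol B\<close> is at most \<open>K * t * n\<close>, the logarithms differ by at most
  \<open>ln (16 * K / (3 * \<delta>))\<close>.\<close>

lemma small_boundary:
  assumes S: "S \<subseteq> B" "S \<noteq> {}" and v: "3 / 16 * \<delta> * n * t \<le> vol S"
    and pot: "bd S / vol S + 4 * (h * K) * ln (vol S) \<le> lam / 8 + 4 * (h * K) * ln (vol B)"
  shows "bd S \<le> 5 / 8 * lam * vol S"
proof -
  have pos: "0 < vol S" "0 < vol B" using S B vol_sub_pos by auto
  have c: "0 < 3 / 16 * \<delta> * n * t" using \<delta> n_pos t by simp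
  have "card B \<le> n" using card_mono[of "{..<n}" B] B by simp
  then have "K * t * card B \<le> K * t * n" using K t by (intro mult_left_mono) auto
  then have vB: "vol B \<le> K * t * n" using vol_le[of B] by simp
  have "vol B / vol S \<le> (K * t * n) / (3 / 16 * \<delta> * n * t)"
    using vB v c pos K t by (intro frac_le) auto
  also have "\<dots> = 16 * K / (3 * \<delta>)" using \<delta> n_pos t by (simp add: field_simps)
  finally have "ln (vol B / vol S) \<le> ln (16 * K / (3 * \<delta>))"
    using pos K \<delta> by (subst ln_le_cancel_iff) auto
  then have "ln (vol B) - ln (vol S) \<le> ln (16 * K / (3 * \<delta>))" using pos by (simp add: ln_div)
  then have "4 * (h * K) * (ln (vol B) - ln (vol S)) \<le> 4 * (h * K) * ln (16 * K / (3 * \<delta>))"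
    using h K by (intro mult_left_mono) auto
  then have "4 * (h * K) * ln (vol B) - 4 * (h * K) * ln (vol S) \<le> lam / 2"
    using h(2) by (simp add: right_diff_distrib)
  then have "bd S / vol S \<le> 5 / 8 * lam" using pot by linarith
  then show ?thesis using pos by (simp add: pos_divide_le_eq)
qed

lemma balanced_B: "balanced B"
proof -
  have v: "0 < vol B" using B vol_sub_pos by blast
  then have "0 \<le> lam * vol B" using lam by simp
  then have "bd B \<le> 5 / 8 * lam * vol B" using bd_B by simp
  then have "3 * \<delta> * n / 8 \<le> real (card B) - 1" using large_if_small_boundary B by blast
  moreover have "bd B / vol B \<le> lam / 8" using bd_B v by (simp add: pos_divide_le_eq)
  ultimately show ?thesis using B by (simp add: balanced_def)
qed

lemma balanced_vol: assumes "balanced S" shows "3 / 8 * \<delta> * n * t \<le> vol S"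
proof -
  have "t * (3 * \<delta> * n / 8) \<le> t * card S" using assms t by (intro mult_left_mono) (auto simp: balanced_def)
  then show ?thesis using vol_ge[of S] assms by (simp add: balanced_def mult_ac)
qed

text \<open>If the potential of the heavier part \<open>A'\<close> does not increase,
  \<open>A'\<close> has volume enough to be balanced. Otherwise that of \<open>A\<close> does not
  increase, but \<open>A\<close> may be too small. If so, its conductance exceeds 5/8 of
  \<open>lam\<close> and hence that of \<open>S\<close>, and then \<open>potential_remove\<close>
  makes \<open>A'\<close> balanced after all.\<close>

lemma balanced_step_ordered:
  assumes S: "balanced S" and A: "A \<union> A' = S" "A \<inter> A' = {}" "A \<noteq> {}" "A' \<noteq> {}"
    and vol: "vol A \<le> vol A'"
    and sparse: "real (card (between E A A')) \<le> h * real (min (card A) (card A'))"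
  shows "balanced A \<or> balanced A'"
proof -
  let ?\<phi> = "h * K"
  have AB: "A \<subseteq> B" "A' \<subseteq> B" "S \<subseteq> B" using S A by (auto simp: balanced_def)
  have fin: "finite A" "finite A'" using AB finite_sub by auto
  have pos: "0 < vol A" "0 < vol A'" using AB A vol_sub_pos by auto
  have volS: "vol S = vol A + vol A'" using A fin by (simp add: sum.union_disjoint[symmetric])
  define c where "c = sum x (between E A A')"
  have split: "bd A + bd A' = bd S + 2 * c"
    using sum_cut_Un[OF finite_E E_pairs A(2)] A(1) by (simp add: c_def)
  have "c \<le> (\<Sum>e\<in>between E A A'. K * t)"
    unfolding c_def
  proof (rule sum_mono)
    fix e assume e: "e \<in> between E A A'"
    then obtain u where "u \<in> e" "u \<in> A" "e \<in> E" by (auto simp: between_def)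
    then show "x e \<le> K * t" using x_le_weight[of e u] weights(2)[of u] AB by auto
  qed
  also have "\<dots> = K * t * real (card (between E A A'))" by (simp add: mult.commute)
  also have "\<dots> \<le> K * t * (h * real (card A))"
  proof -
    have "h * real (min (card A) (card A')) \<le> h * real (card A)" using h by (intro mult_left_mono) auto
    then show ?thesis using sparse K t by (intro mult_left_mono) auto
  qed
  also have "\<dots> = ?\<phi> * (t * card A)" by (simp add: mult_ac)
  also have "\<dots> \<le> ?\<phi> * vol A" using vol_ge[OF AB(1)] h K by (intro mult_left_mono) auto
  finally have c: "c \<le> ?\<phi> * vol A" .
  have \<phi>: "0 < ?\<phi>" using h K by simp
  define \<Psi> where "\<Psi> T = bd T / vol T + 4 * ?\<phi> * ln (vol T)" for T
  have \<Psi>S: "\<Psi> S \<le> lam / 8 + 4 * ?\<phi> * ln (vol B)" using S by (simp add: balanced_def \<Psi>_def)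
  have vS: "3 / 8 * \<delta> * n * t \<le> vol S" using S by (rule balanced_vol)
  have A': "balanced A'" if "\<Psi> A' \<le> \<Psi> S"
  proof -
    have pot: "bd A' / vol A' + 4 * ?\<phi> * ln (vol A') \<le> lam / 8 + 4 * ?\<phi> * ln (vol B)"
      using that \<Psi>S by (simp add: \<Psi>_def)
    have "3 / 16 * \<delta> * n * t \<le> vol A'" using vS vol volS by simp
    then have "bd A' \<le> 5 / 8 * lam * vol A'" using small_boundary AB A pot by blast
    then show ?thesis using large_if_small_boundary AB A pot by (simp add: balanced_def)
  qed
  consider "\<Psi> A' \<le> \<Psi> S" | "\<Psi> A \<le> \<Psi> S"
    using potential_split[OF pos(1) vol split c \<phi>] by (auto simp: \<Psi>_def volS)
  then show ?thesis
  proof cases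
    case 2
    show ?thesis
    proof (cases "bd A \<le> 5 / 8 * lam * vol A")
      case True
      then have "balanced A" using 2 \<Psi>S AB A large_if_small_boundary by (simp add: balanced_def \<Psi>_def)
      then show ?thesis by simp
    next
      case False
      have "0 < 3 / 8 * \<delta> * n * t" using \<delta> n_pos t by simp
      then have "3 / 16 * \<delta> * n * t \<le> vol S" using vS by linarith
      then have "bd S \<le> 5 / 8 * lam * vol S" using small_boundary S by (simp add: balanced_def)
      then have "\<Psi> A' \<le> \<Psi> S"
        unfolding \<Psi>_def volS using potential_remove[OF pos(1) vol split c \<phi>, of "5 / 8 * lam"] False by simp
      then show ?thesis using A' by simp
    qed
  qed (use A' in simp)
qed

lemma balanced_step:
  assumes S: "balanced S" and A: "A \<subseteq> S" and sparse: "\<not> expanding E h S A"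
  shows "balanced A \<or> balanced (S - A)" "A \<noteq> {}" "A \<noteq> S"
proof -
  have lt: "real (card (cut (induced_edges E S) A)) < h * real (min (card A) (card (S - A)))"
    using sparse by (simp add: expanding_def)
  then have "0 < h * real (min (card A) (card (S - A)))" by linarith
  then show ne: "A \<noteq> {}" "A \<noteq> S" using h by auto
  have b: "real (card (between E A (S - A))) \<le> h * real (min (card A) (card (S - A)))"
    using lt unfolding cut_induced_edges[OF E_pairs A] by simp
  have comm: "between E (S - A) A = between E A (S - A)" by (auto simp: between_def)
  show "balanced A \<or> balanced (S - A)"
  proof (cases "vol A \<le> vol (S - A)")
    case True
    then show ?thesis using balanced_step_ordered[OF S, of A "S - A"] A ne b by auto
  next
    case False
    then have "balanced (S - A) \<or> balanced A"
      using balanced_step_ordered[OF S, of "S - A" A] A ne b comm by (auto simp: min.commute)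
    then show ?thesis by blast
  qed
qed

text \<open>
  Following the part that contains a fixed vertex \<open>z\<close> replaces the tree of all cuts by paths: the
  balanced sets form a branch of that tree, and it is the path of any \<open>z\<close> in its last set.
\<close>

lemma balanced_walk:
  assumes cuts: "\<And>S. balanced S \<Longrightarrow> \<not> Q S \<Longrightarrow> C S \<subseteq> S \<and> \<not> expanding E h S (C S)"
  obtains z j where "z < n" "j < n" "balanced ((side C z ^^ j) B)" "Q ((side C z ^^ j) B)"
proof -
  have "\<exists>z\<in>S. \<exists>j<card S. balanced ((side C z ^^ j) S) \<and> Q ((side C z ^^ j) S)" if "balanced S" for S
    using that
  proof (induction "card S" arbitrary: S rule: less_induct)
    case less
    have S: "S \<noteq> {}" "finite S" using less.prems finite_sub by (auto simp: balanced_def)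
    show ?case
    proof (cases "Q S")
      case True
      obtain z where "z \<in> S" using S by auto
      moreover have "0 < card S" using S by (simp add: card_gt_0_iff)
      ultimately show ?thesis using True less.prems by (intro bexI[of _ z] exI[of _ 0]) auto
    next
      case False
      have C: "C S \<subseteq> S" "\<not> expanding E h S (C S)" using cuts[OF less.prems False] by auto
      obtain S' where S': "balanced S'" "S' = C S \<or> S' = S - C S" "S' \<subset> S"
        using balanced_step[OF less.prems C] C(1) by blast
      have card: "card S' < card S" using S' S by (simp add: psubset_card_mono)
      obtain z j where zj: "z \<in> S'" "j < card S'" "balanced ((side C z ^^ j) S')" "Q ((side C z ^^ j) S')"
        using less.hyps[OF card S'(1)] by blast
      have "side C z S = S'" using S' zj(1) by (auto simp: side_def)
      then have "(side C z ^^ Suc j) S = (side C z ^^ j) S'" by (simp only: funpow_Suc_right o_apply)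
      moreover have "z \<in> S" "Suc j < card S" using S' zj card by auto
      ultimately show ?thesis using zj by (intro bexI[of _ z] exI[of _ "Suc j"]) auto
    qed
  qed
  from this[OF balanced_B] obtain z j where "z \<in> B" "j < card B"
    "balanced ((side C z ^^ j) B)" "Q ((side C z ^^ j) B)" by blast
  moreover have "card B \<le> n" using card_mono[of "{..<n}" B] B by simp
  ultimately show ?thesis using B that[of z j] by auto
qed

lemma balanced_card: assumes "balanced S" shows "2 \<le> card S" "3 * \<delta> * n / 8 \<le> card S" "S \<subseteq> {..<n}"
proof -
  have "3 * \<delta> * n / 8 \<le> real (card S) - 1" using assms by (simp add: balanced_def)
  moreover have "0 < 3 * \<delta> * n / 8" using \<delta> n_pos by simp
  ultimately have "1 < real (card S)" "3 * \<delta> * n / 8 \<le> card S" by linarith+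
  then show "2 \<le> card S" "3 * \<delta> * n / 8 \<le> card S" by auto
  show "S \<subseteq> {..<n}" using assms B by (auto simp: balanced_def)
qed

end

section \<open>The expansion threshold and the final bound\<close>

definition window_exponent :: "nat \<Rightarrow> real \<Rightarrow> nat" where
  "window_exponent \<Delta> lam = nat \<lceil>16 * real \<Delta> / lam\<rceil>"

text \<open>The solution \<open>h\<close> of the condition of \<open>narrow_window\<close> with
  \<open>K = 2 ^ N\<close>, where the logarithm is replaced by its upper bound: \<open>ln (16 * 2 ^
  N / (3 * \<delta>)) \<le> 5 + N + \<bar>ln \<delta>\<bar> \<le> (6 + N) * max 1 \<bar>ln
  \<delta>\<bar>\<close>.\<close>

definition threshold :: "nat \<Rightarrow> real \<Rightarrow> real \<Rightarrow> real" where
  "threshold \<Delta> lam \<delta> =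
     lam / (8 * 2 ^ window_exponent \<Delta> lam * (6 + window_exponent \<Delta> lam) * max 1 \<bar>ln \<delta>\<bar>)"

text \<open>With \<open>r = \<Delta> / lam\<close>, the square of the threshold loses
  \<open>4 ^ N * (6 + N)\<^sup>2\<close>, at most \<open>36 * 16 ^ N\<close>. From
  \<open>N \<le> 16 * r + 1\<close> and \<open>ln 16 \<le> 4\<close> follows
  \<open>16 ^ N \<le> 16 * exp (64 * r)\<close>, and the quadratic loss of Cheeger's inequality, a
  factor \<open>r\<close>, costs one more \<open>exp r\<close>. This explains 65 and
  \<open>147456 = 4 * 64 * 36 * 16\<close>.\<close>

lemma threshold_bound:
  assumes lam: "0 < lam"
  shows "1 / 147456 * (lam / (max 1 ((ln \<delta>)\<^sup>2) * exp (65 * (real \<Delta> / lam)))) * (4 * real \<Delta>) \<le> (threshold \<Delta> lam \<delta>)\<^sup>2"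
proof -
  define r where "r = real \<Delta> / lam"
  define N where "N = window_exponent \<Delta> lam"
  define L where "L = max 1 \<bar>ln \<delta>\<bar>"
  have r: "0 \<le> r" using lam by (simp add: r_def)
  have L: "1 \<le> L" "max 1 ((ln \<delta>)\<^sup>2) = L\<^sup>2"
  proof -
    show "1 \<le> L" by (simp add: L_def)
    show "max 1 ((ln \<delta>)\<^sup>2) = L\<^sup>2"
    proof (cases "\<bar>ln \<delta>\<bar> \<le> 1")
      case True
      then have "(ln \<delta>)\<^sup>2 \<le> 1" by (simp add: abs_square_le_1)
      then show ?thesis using True by (simp add: L_def max_absorb1)
    next
      case False
      then have "1 \<le> \<bar>ln \<delta>\<bar>\<^sup>2" by (intro one_le_power) simp
      then show ?thesis using False by (simp add: L_def max_absorb2)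
    qed
  qed
  have N: "real N \<le> 16 * r + 1"
    unfolding N_def window_exponent_def r_def using lam r unfolding r_def by linarith
  have "(16 :: real) ^ N = 16 powr real N" by (simp add: powr_realpow)
  also have "\<dots> \<le> 16 powr (16 * r + 1)" using N by (intro powr_mono) auto
  also have "\<dots> = 16 * 16 powr (16 * r)" by (simp add: powr_add)
  also have "\<dots> = 16 * exp (16 * r * ln 16)" by (simp add: powr_def)
  also have "\<dots> \<le> 16 * exp (64 * r)"
  proof -
    have "ln (16 :: real) = 4 * ln 2" using ln_realpow[of 2 4] by simp
    then have "ln (16 :: real) \<le> 4" using ln_le_minus_one[of "2 :: real"] by simp
    then have "16 * r * ln 16 \<le> 16 * r * 4" using r by (intro mult_left_mono) auto
    then show ?thesis by simp
  qed
  finally have p16: "(16 :: real) ^ N \<le> 16 * exp (64 * r)" .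
  have "6 + real N \<le> 6 * 2 ^ N"
  proof -
    have "1 + N \<le> 2 ^ N" by (induction N) auto
    then have "real (1 + N) \<le> 2 ^ N" by (metis of_nat_le_iff of_nat_numeral of_nat_power)
    then show ?thesis by simp
  qed
  then have "(6 + real N)\<^sup>2 \<le> (6 * 2 ^ N)\<^sup>2" by (intro power_mono) auto
  then have N2: "(6 + real N)\<^sup>2 \<le> 36 * 4 ^ N" by (simp add: power_mult_distrib power_mult[symmetric] mult.commute[of N] power_mult)
  have rexp: "r \<le> exp r" using exp_ge_add_one_self[of r] by linarith
  have "256 * r * (4 ^ N * (6 + real N)\<^sup>2) \<le> 256 * exp r * (4 ^ N * (36 * 4 ^ N))"
    using N2 r rexp by (intro mult_mono) auto
  also have "\<dots> = 256 * 36 * exp r * 16 ^ N" by (simp add: power_mult_distrib[symmetric])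
  also have "\<dots> \<le> 256 * 36 * exp r * (16 * exp (64 * r))" using p16 by (intro mult_left_mono) auto
  also have "\<dots> = 147456 * exp (65 * r)" by (simp add: exp_add[symmetric])
  finally have main: "256 * r * (4 ^ N * (6 + real N)\<^sup>2) \<le> 147456 * exp (65 * r)" .
  define X where "X = 4 ^ N * (6 + real N)\<^sup>2"
  have X: "0 < X" by (simp add: X_def add_pos_nonneg)
  have "(threshold \<Delta> lam \<delta>)\<^sup>2 = lam\<^sup>2 / (64 * X * L\<^sup>2)"
    unfolding threshold_def N_def[symmetric] L_def[symmetric] X_def
    by (simp add: power_divide power_mult_distrib power_mult[symmetric] mult.commute[of N] power_mult)
  moreover have "1 / 147456 * (lam / (L\<^sup>2 * exp (65 * r))) * (4 * real \<Delta>) \<le> lam\<^sup>2 / (64 * X * L\<^sup>2)"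
  proof -
    have "4 * (lam * r) * (64 * X) \<le> lam * (147456 * exp (65 * r))"
      using mult_left_mono[OF main, of lam] lam by (simp add: X_def mult_ac)
    then have "4 * real \<Delta> * (64 * X) \<le> lam * (147456 * exp (65 * r))"
      using lam by (simp add: r_def)
    then have "(4 * real \<Delta> * (64 * X)) * (lam * L\<^sup>2) \<le> (lam * (147456 * exp (65 * r))) * (lam * L\<^sup>2)"
      using lam by (intro mult_right_mono) auto
    then show ?thesis using X L(1) by (simp add: field_simps power2_eq_square)
  qed
  ultimately show ?thesis unfolding L(2) r_def by simp
qed

context sdp_solution
begin

text \<open>For a singleton the factor in \<open>bd_ge\<close> is 1, and each of the
  \<open>\<Delta>\<close> incident edges carries at most the weight of the vertex.\<close>

lemma lam_le_degree: "lam \<le> \<Delta>"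
proof -
  have "\<exists>u\<in>V. weight u > 0"
  proof (rule ccontr)
    assume "\<not> ?thesis"
    then have "vol V \<le> 0" by (intro sum_nonpos) (auto simp: not_less)
    then show False using vol_pos by simp
  qed
  then obtain u where u: "u < n" "weight u > 0" by auto
  have "lam * weight u \<le> bd {u}" using bd_ge[of "{u}"] u by simp
  also have "cut E {u} = {e \<in> E. u \<in> e}"
  proof -
    have "card (e \<inter> {u}) = 1 \<longleftrightarrow> u \<in> e" for e :: "nat set" by (cases "u \<in> e") auto
    then show ?thesis by (simp add: cut_def)
  qed
  also have "sum x {e \<in> E. u \<in> e} \<le> (\<Sum>e\<in>{e \<in> E. u \<in> e}. weight u)" by (intro sum_mono) (auto intro: x_le_weight)
  also have "\<dots> = \<Delta> * weight u" using degree u by simp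
  finally show ?thesis using u by simp
qed

lemma degree_pos: "0 < \<Delta>" and degree_le: "\<Delta> \<le> n" and n_ge_2: "2 \<le> n"
proof -
  show d: "0 < \<Delta>" using lam lam_le_degree by simp
  have fin: "finite {e \<in> E. 0 \<in> e}" using finite_E by simp
  have sub: "{e \<in> E. 0 \<in> e} \<subseteq> (\<lambda>v. {0, v}) ` ({..<n} - {0})"
  proof
    fix e assume "e \<in> {e \<in> E. 0 \<in> e}"
    then obtain u v where "u \<noteq> v" "e = {u, v}" "u \<in> V" "v \<in> V" "0 \<in> e" using E_pairs by (blast elim: pairsE)
    then show "e \<in> (\<lambda>v. {0, v}) ` ({..<n} - {0})" by (auto simp: insert_commute)
  qed
  have "\<Delta> = card {e \<in> E. 0 \<in> e}" using degree n_pos by simp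
  also have "\<dots> \<le> card ((\<lambda>v. {0, v}) ` ({..<n} - {0}))" by (rule card_mono[OF _ sub]) simp
  also have "\<dots> \<le> card ({..<n} - {0})" by (rule card_image_le) simp
  also have "\<dots> = n - 1" using n_pos by simp
  finally show "\<Delta> \<le> n" "2 \<le> n" using d by linarith+
qed

lemma threshold_pos: "0 < threshold \<Delta> lam \<delta>"
  using lam by (simp add: threshold_def add_pos_nonneg less_max_iff_disj)

lemma threshold_le_degree: "threshold \<Delta> lam \<delta> \<le> \<Delta>"
proof -
  define N where "N = window_exponent \<Delta> lam"
  have "1 * 1 * 1 * 1 \<le> 8 * 2 ^ N * (6 + real N) * max 1 \<bar>ln \<delta>\<bar>" by (intro mult_mono) auto
  then have "threshold \<Delta> lam \<delta> \<le> lam"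
    unfolding threshold_def N_def[symmetric] using lam by (simp add: divide_le_eq mult_le_cancel_left1)
  then show ?thesis using lam_le_degree by simp
qed

text \<open>Common end of the existence proof and of the analysis of the program: both only have to
  exhibit a large set whose finitely many sweep cuts are dense.\<close>

lemma good_set_if_sweeps_expand:
  assumes S: "S \<subseteq> {..<n}" "2 \<le> card S" "3 * \<delta> * n / 8 \<le> card S"
    and sweeps: "\<And>i j v. i \<in> S \<Longrightarrow> j \<in> S \<Longrightarrow>
      v = (shift_op S (induced_edges E S) (2 * real n + 1) ^^ (n ^ 6)) (\<lambda>u. if u = i then 1 else 0) \<Longrightarrow>
      expanding E (threshold \<Delta> lam \<delta>) S (sweep S v j)"
  shows "good_set (1 / 147456) 65 n E \<Delta> \<delta> lam S"
proof -
  let ?F = "induced_edges E S" and ?h = "threshold \<Delta> lam \<delta>"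
  have finS: "finite S" "S \<noteq> {}" using finite_subset[OF S(1)] S(2) by auto
  have F: "?F \<subseteq> pairs S" by (rule induced_edges_pairs[OF E_pairs])
  have deg: "card {e \<in> ?F. u \<in> e} \<le> \<Delta>" if "u \<in> S" for u
  proof -
    have "{e \<in> ?F. u \<in> e} \<subseteq> {e \<in> E. u \<in> e}" by (auto simp: induced_edges_def)
    then have "card {e \<in> ?F. u \<in> e} \<le> card {e \<in> E. u \<in> e}" using finite_E by (intro card_mono) auto
    then show ?thesis using degree[of u] that S by auto
  qed
  interpret G: shifted_graph S ?F \<Delta> "2 * real n + 1"
    by unfold_locales (use finS F deg degree_le in simp_all)
  have cardn: "card S \<le> n" using card_mono[of "{..<n}" S] S by simp
  have gap: "?h\<^sup>2 / (4 * \<Delta>) * (\<Sum>a\<in>S. (z a)\<^sup>2) \<le> (\<Sum>e\<in>?F. (edge_diff z e)\<^sup>2)" if "(\<Sum>a\<in>S. z a) = 0" for z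
  proof -
    have sw: "?h * real (min (card (sweep S v j)) (card (S - sweep S v j))) \<le> real (card (cut ?F (sweep S v j)))"
      if "i \<in> S" "j \<in> S" "v = (G.M ^^ (n ^ 6)) (\<lambda>u. if u = i then 1 else 0)" for i j v
      using sweeps[OF that] unfolding expanding_def .
    have "?h\<^sup>2 / (4 * \<Delta>) * G.inner z z \<le> G.energy z"
      by (rule G.sweep_expansion_imp_gap[OF degree_pos degree_le n_ge_2 cardn refl order_refl threshold_pos
        threshold_le_degree sw that])
    moreover have "G.inner z z = (\<Sum>a\<in>S. (z a)\<^sup>2)" "G.energy z = (\<Sum>e\<in>?F. (edge_diff z e)\<^sup>2)"
      by (simp_all add: edge_diff_sdiff power2_eq_square[symmetric])
    ultimately show ?thesis by simp
  qed
  have lap: "laplacian ?F = weighted_laplacian ?F (\<lambda>_. 1)"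
    by (simp add: laplacian_def weighted_laplacian_def fun_eq_iff)
  have sym: "edge_mat e a b = edge_mat e b a" for e a b by (simp add: edge_mat_def pair_mat_def mult.commute)
  have row: "(\<Sum>b\<in>S. edge_mat e a b) = 0" if "e \<in> ?F" for e a
  proof -
    have "e \<in> pairs S" using that F by (rule rev_subsetD)
    then obtain u v where uv: "u \<noteq> v" "e = {u, v}" "u \<in> S" "v \<in> S" by (rule pairsE)
    have "(\<Sum>b\<in>S. pair_vec u v b) = (\<Sum>b\<in>S. (if b = v then 1 else 0) - (if b = u then 1 else 0))"
      using uv(1) by (intro sum.cong refl) (simp add: pair_vec_def)
    also have "\<dots> = 0" using uv(3,4) finS(1) by (simp add: sum_subtractf)
    finally have s: "(\<Sum>b\<in>S. pair_vec u v b) = 0" .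
    have "(\<Sum>b\<in>S. pair_vec u v a * pair_vec u v b) = 0" unfolding sum_distrib_left[symmetric] s by (rule mult_zero_right)
    then show ?thesis unfolding uv(2) edge_mat_doubleton[OF uv(1)] pair_mat_def .
  qed
  have "?h\<^sup>2 / (4 * \<Delta>) \<le> lambda2 S (laplacian ?F)"
  proof (rule lambda2_ge[OF finS(1) S(2)])
    show "0 < ?h\<^sup>2 / (4 * \<Delta>)" using threshold_pos degree_pos by simp
    show "laplacian ?F a b = laplacian ?F b a" for a b by (simp add: laplacian_def sym)
    show "(\<Sum>b\<in>S. laplacian ?F a b) = 0" for a
      unfolding laplacian_def by (subst sum.swap) (simp add: row)
    show "?h\<^sup>2 / (4 * \<Delta>) * (\<Sum>a\<in>S. (z a)\<^sup>2) \<le> (\<Sum>a\<in>S. \<Sum>b\<in>S. z a * laplacian ?F a b * z b)"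
      if "(\<Sum>a\<in>S. z a) = 0" for z
      unfolding lap weighted_laplacian_form[OF finS(1) F] mult_1 by (rule gap[OF that])
  qed
  moreover have "1 / 147456 * (lam / (max 1 ((ln \<delta>)\<^sup>2) * exp (65 * (real \<Delta> / lam)))) \<le> ?h\<^sup>2 / (4 * \<Delta>)"
    using threshold_bound[OF lam] degree_pos by (simp add: pos_le_divide_eq)
  ultimately show ?thesis using S by (simp add: good_set_def)
qed

text \<open>\<open>Q\<close> is the criterion for stopping and \<open>C\<close> the rule for
  cutting. Leaving both open lets the existence proof cut along arbitrary sparse sets and the
  program along sweep cuts.\<close>

lemma window_walk:
  assumes cuts: "\<And>S. S \<subseteq> {..<n} \<Longrightarrow> 2 \<le> card S \<Longrightarrow> \<not> Q S \<Longrightarrow> C S \<subseteq> S \<and> \<not> expanding E (threshold \<Delta> lam \<delta>) S (C S)"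
  obtains p q z j S where "p < n" "q < n" "z < n" "j < n"
    "S = (side C z ^^ j) {u. u < n \<and> weight p \<le> weight u \<and> weight u \<le> weight q}"
    "S \<subseteq> {..<n}" "2 \<le> card S" "3 * \<delta> * n / 8 \<le> card S" "Q S"
proof -
  define N where "N = window_exponent \<Delta> lam"
  have N: "16 * real \<Delta> / lam \<le> real N"
    unfolding N_def window_exponent_def using lam by (simp add: real_nat_ceiling_ge)
  obtain t p q where w: "t > 0" "p < n" "q < n"
    "\<And>u. u < n \<Longrightarrow> weight p \<le> weight u \<Longrightarrow> weight u \<le> weight q \<Longrightarrow> t \<le> weight u \<and> weight u \<le> 2 ^ N * t"
    "weight p \<le> weight q"
    "bd {u. u < n \<and> weight p \<le> weight u \<and> weight u \<le> weight q} \<le>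
      lam / 8 * vol {u. u < n \<and> weight p \<le> weight u \<and> weight u \<le> weight q}"
    by (rule window[OF N]) blast
  define L where "L = max 1 \<bar>ln \<delta>\<bar>"
  have h: "threshold \<Delta> lam \<delta> = lam / (8 * 2 ^ N * (6 + real N) * L)"
    by (simp add: threshold_def N_def L_def)
  have "ln (16 * 2 ^ N / (3 * \<delta>)) = ln (16 / 3) + real N * ln 2 - ln \<delta>"
    using \<delta> by (simp add: ln_div ln_mult ln_realpow)
  also have "\<dots> \<le> 5 + real N * 1 + L"
  proof -
    have a: "ln (16 / 3 :: real) \<le> 5" "ln (2 :: real) \<le> 1"
      using ln_le_minus_one[of "16 / 3 :: real"] ln_le_minus_one[of "2 :: real"] by auto
    have "- ln \<delta> \<le> L" unfolding L_def by linarith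
    moreover have "real N * ln 2 \<le> real N * 1" by (rule mult_left_mono[OF a(2)]) simp
    ultimately show ?thesis using a(1) by linarith
  qed
  also have "\<dots> \<le> (6 + real N) * L"
  proof -
    have "1 \<le> L" by (simp add: L_def)
    then have "(5 + real N) * 1 \<le> (5 + real N) * L" by (rule mult_left_mono) simp
    then have "5 + real N + L \<le> (5 + real N) * L + L" by simp
    then show ?thesis by (simp add: algebra_simps)
  qed
  finally have ln: "ln (16 * 2 ^ N / (3 * \<delta>)) \<le> (6 + real N) * L" .
  have L: "0 < L" by (simp add: L_def)
  have hK: "4 * (threshold \<Delta> lam \<delta> * 2 ^ N) = lam / (2 * ((6 + real N) * L))"
  proof -
    have "4 * (a / (8 * b * c * d) * b) = a / (2 * (c * d))" if "b > 0" for a b c d :: real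
      using that by simp
    then show ?thesis unfolding h by simp
  qed
  interpret W: narrow_window n E \<Delta> \<delta> lam x y "{u. u < n \<and> weight p \<le> weight u \<and> weight u \<le> weight q}" "2 ^ N" t "threshold \<Delta> lam \<delta>"
  proof unfold_locales
    show "{u. u < n \<and> weight p \<le> weight u \<and> weight u \<le> weight q} \<subseteq> {..<n}" by auto
    show "{u. u < n \<and> weight p \<le> weight u \<and> weight u \<le> weight q} \<noteq> {}" using w(2,5) by auto
    show "t \<le> weight u" if "u \<in> {u. u < n \<and> weight p \<le> weight u \<and> weight u \<le> weight q}" for u
      using w(4)[of u] that by simp
    show "weight u \<le> 2 ^ N * t" if "u \<in> {u. u < n \<and> weight p \<le> weight u \<and> weight u \<le> weight q}" for u
      using w(4)[of u] that by simp
    show "4 * (threshold \<Delta> lam \<delta> * 2 ^ N) * ln (16 * 2 ^ N / (3 * \<delta>)) \<le> lam / 2"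
    proof -
      have "lam / (2 * ((6 + real N) * L)) * ln (16 * 2 ^ N / (3 * \<delta>)) \<le> lam / (2 * ((6 + real N) * L)) * ((6 + real N) * L)"
        using ln lam L by (intro mult_left_mono) auto
      also have "\<dots> = lam / 2"
      proof -
        have "(6 + real N) * L \<noteq> 0" using L by (simp add: add_nonneg_eq_0_iff)
        then show ?thesis by (simp add: field_simps)
      qed
      finally show ?thesis unfolding hK .
    qed
    show "0 < t" by (rule w(1))
    show "(1 :: real) \<le> 2 ^ N" by simp
    show "0 < threshold \<Delta> lam \<delta>" by (rule threshold_pos)
    show "bd {u. u < n \<and> weight p \<le> weight u \<and> weight u \<le> weight q} \<le>
      lam / 8 * vol {u. u < n \<and> weight p \<le> weight u \<and> weight u \<le> weight q}" by (rule w(6))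
  qed
  have QC: "C T \<subseteq> T \<and> \<not> expanding E (threshold \<Delta> lam \<delta>) T (C T)" if "W.balanced T" "\<not> Q T" for T
    using cuts[OF W.balanced_card(3,1)[OF that(1)] that(2)] .
  obtain z j where zj: "z < n" "j < n" "W.balanced ((side C z ^^ j) {u. u < n \<and> weight p \<le> weight u \<and> weight u \<le> weight q})"
    "Q ((side C z ^^ j) {u. u < n \<and> weight p \<le> weight u \<and> weight u \<le> weight q})"
    by (rule W.balanced_walk[of Q C, OF QC])
  show ?thesis
    by (rule that[OF w(2,3) zj(1,2) refl W.balanced_card(3,1,2)[OF zj(3)] zj(4)])
qed

text \<open>Real data have no exact encoding as integers, so the cuts are chosen by
  \<open>SOME\<close> here; a set without any sparse cut has in particular no sparse sweep
  cut.\<close>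

lemma good_set_exists: "\<exists>S. good_set (1 / 147456) 65 n E \<Delta> \<delta> lam S"
proof -
  let ?h = "threshold \<Delta> lam \<delta>"
  define Q where "Q S \<longleftrightarrow> (\<forall>A\<subseteq>S. expanding E ?h S A)" for S
  define C where "C S = (SOME A. A \<subseteq> S \<and> \<not> expanding E ?h S A)" for S
  have "C S \<subseteq> S \<and> \<not> expanding E ?h S (C S)" if "\<not> Q S" for S
    using that unfolding Q_def C_def by (intro someI_ex[of "\<lambda>A. A \<subseteq> S \<and> \<not> expanding E ?h S A"]) auto
  note C = this
  obtain S where S: "S \<subseteq> {..<n}" "2 \<le> card S" "3 * \<delta> * n / 8 \<le> card S" "Q S"
    by (rule window_walk[of Q C, OF C])
  have "good_set (1 / 147456) 65 n E \<Delta> \<delta> lam S"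
    by (rule good_set_if_sweeps_expand[OF S(1-3)]) (use S(4) in \<open>simp add: Q_def\<close>)
  then show ?thesis by blast
qed

end

section \<open>The program and its semantics\<close>

text \<open>A round may assume the value of its counter and that arrays which the loop does not
  write are as at the start, so \<open>P\<close> only has to describe what changes.\<close>

lemma den_for_inv:
  assumes n: "m 0 0 = int n" and U: "U \<notin> writes c"
    and base: "P 0 (upd m U 0 0)"
    and step: "\<And>k m'. k < n \<Longrightarrow> P k m' \<Longrightarrow> m' U 0 = int k \<Longrightarrow> (\<And>a. a \<notin> writes (LFor U c) \<Longrightarrow> m' a = m a) \<Longrightarrow>
      P (Suc k) (upd (den c m') U 0 (int (Suc k)))"
  shows "P n (den (LFor U c) m)"
proof -
  let ?M = "\<lambda>k. for_loop (den c) U k m"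
  have frame: "?M k a = m a" if "a \<notin> writes (LFor U c)" for k a
    using that by (intro for_loop_frame den_frame) auto
  have "P k (?M k)" if "k \<le> n" for k
    using that
  proof (induction k)
    case (Suc k)
    then show ?case using step[of k "?M k"] frame for_loop_counter by simp
  qed (use base in simp)
  then show ?thesis using n by simp
qed

lemma den_for_sum:
  assumes n: "m 0 0 = int n" and U: "U \<notin> writes c" "X \<noteq> U"
    and step: "\<And>k m'. k < n \<Longrightarrow> m' U 0 = int k \<Longrightarrow> (\<And>a. a \<notin> writes (LFor U c) \<Longrightarrow> m' a = m a) \<Longrightarrow>
      den c m' X j = m' X j + g k"
  shows "den (LFor U c) m X j = m X j + (\<Sum>k<n. g k)"
  by (rule den_for_inv[where m = m and n = n and P = "\<lambda>k m'. m' X j = m X j + (\<Sum>l<k. g l)", OF n U(1)])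
    (use U(2) step in \<open>simp_all add: upd_apply\<close>)

text \<open>Round \<open>k\<close> may also assume that cell \<open>k\<close> has its initial value,
  since other rounds leave it alone. Updates in place, such as the removal in
  \<open>descend\<close>, depend on this.\<close>

lemma den_for_map:
  assumes n: "m 0 0 = int n" and U: "U \<notin> writes c" "X \<noteq> U"
    and step: "\<And>k m'. k < n \<Longrightarrow> m' U 0 = int k \<Longrightarrow> (\<And>a. a \<notin> writes (LFor U c) \<Longrightarrow> m' a = m a) \<Longrightarrow>
      m' X (int k) = m X (int k) \<Longrightarrow> den c m' X (int k) = g k"
    and other: "\<And>k l m'. k < n \<Longrightarrow> m' U 0 = int k \<Longrightarrow> l \<noteq> k \<Longrightarrow> (\<And>a. a \<notin> writes (LFor U c) \<Longrightarrow> m' a = m a) \<Longrightarrow>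
      den c m' X (int l) = m' X (int l)"
    and u: "u < n"
  shows "den (LFor U c) m X (int u) = g u"
proof -
  have "\<forall>u<n. den (LFor U c) m X (int u) = (if u < n then g u else m X (int u))"
  proof (rule den_for_inv[where m = m and n = n and P = "\<lambda>k m'. \<forall>u<n. m' X (int u) = (if u < k then g u else m X (int u))", OF n U(1)])
    show "\<forall>u<n. upd m U 0 0 X (int u) = (if u < 0 then g u else m X (int u))" using U(2) by (simp add: upd_apply)
    fix k m'
    assume k: "k < n" and P: "\<forall>u<n. m' X (int u) = (if u < k then g u else m X (int u))"
      and c: "m' U 0 = int k" and fr: "\<And>a. a \<notin> writes (LFor U c) \<Longrightarrow> m' a = m a"
    show "\<forall>u<n. upd (den c m') U 0 (int (Suc k)) X (int u) = (if u < Suc k then g u else m X (int u))"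
    proof (intro allI impI)
      fix u assume u: "u < n"
      have "m' X (int k) = m X (int k)" using P k by simp
      then have "den c m' X (int k) = g k" using step[OF k c fr] by simp
      moreover have "u \<noteq> k \<Longrightarrow> den c m' X (int u) = m' X (int u)" using other[OF k c _ fr] by simp
      ultimately show "upd (den c m') U 0 (int (Suc k)) X (int u) = (if u < Suc k then g u else m X (int u))"
        using P u U(2) by (cases "u = k") (auto simp: upd_apply)
    qed
  qed
  then show ?thesis using u by simp
qed

text \<open>A loop makes exactly \<open>n\<close> rounds, so \<open>n ^ 6\<close> applications of
  the operator take six nested loops.\<close>

fun nest :: "nat list \<Rightarrow> lcom \<Rightarrow> lcom" where
  "nest [] c = c"
| "nest (U # Us) c = LFor U (nest Us c)"

lemma writes_nest: "writes (nest Us c) = set Us \<union> writes c"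
  by (induction Us) auto

lemma den_nest:
  assumes "P k m" and "distinct Us" "set Us \<inter> writes c = {}" "0 \<notin> writes c" "0 \<notin> set Us"
    and size: "\<And>k m. P k m \<Longrightarrow> m 0 0 = int n"
    and ins: "\<And>k m U v. P k m \<Longrightarrow> U \<in> set Us \<Longrightarrow> P k (upd m U 0 v)"
    and step: "\<And>k m. P k m \<Longrightarrow> P (Suc k) (den c m)"
  shows "P (k + n ^ length Us) (den (nest Us c) m)"
  using assms(1,2,3,5) ins
proof (induction Us arbitrary: k m)
  case Nil
  then show ?case using step by simp
next
  case (Cons U Us)
  have m0: "m 0 0 = int n" using Cons.prems(1) size by blast
  have U: "U \<notin> writes (nest Us c)" using Cons.prems(2,3) by (auto simp: writes_nest)
  have "P (k + n * n ^ length Us) (den (LFor U (nest Us c)) m)"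
  proof (rule den_for_inv[where m = m and n = n and P = "\<lambda>l m'. P (k + l * n ^ length Us) m'", OF m0 U])
    show "P (k + 0 * n ^ length Us) (upd m U 0 0)" using Cons.prems(1,5) by simp
    fix l m' assume "P (k + l * n ^ length Us) m'"
    then have "P (k + l * n ^ length Us + n ^ length Us) (den (nest Us c) m')"
      using Cons.prems by (intro Cons.IH) auto
    then show "P (k + Suc l * n ^ length Us) (upd (den (nest Us c) m') U 0 (int (Suc l)))"
      using Cons.prems(5) by (simp add: add_ac)
  qed
  then show ?case by simp
qed

definition graph_mem :: "nat \<Rightarrow> nat set set \<Rightarrow> memory \<Rightarrow> bool" where
  "graph_mem n E m \<longleftrightarrow> m 0 0 = int n \<and>
     (\<forall>u<n. \<forall>w<n. m 1 (int u * int n + int w) = (if {u, w} \<in> E then 1 else 0))"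

lemma graph_mem_cong: "m' 0 = m 0 \<Longrightarrow> m' 1 = m 1 \<Longrightarrow> graph_mem n E m' = graph_mem n E m"
  by (simp add: graph_mem_def)

lemma graph_mem_edge:
  "graph_mem n E m \<Longrightarrow> u < n \<Longrightarrow> w < n \<Longrightarrow> 0 < m 1 (int u * int n + int w) \<longleftrightarrow> {u, w} \<in> E"
  by (simp add: graph_mem_def)

lemma graph_mem_size: "graph_mem n E m \<Longrightarrow> m 0 0 = int n"
  by (simp add: graph_mem_def)

definition members :: "nat \<Rightarrow> nat \<Rightarrow> memory \<Rightarrow> nat set" where
  "members n a m = {u. u < n \<and> 0 < m a (int u)}"

lemma members_cong: "m' a = m b \<Longrightarrow> members n a m' = members n b m"
  by (simp add: members_def)

text \<open>
  Arrays of the program: 20 the current set, 21 a sweep cut of it, 22 its best cut so far, 23 and 24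
  the iterated vector, 30 and 31 the number of edges and the smaller side of the best cut, 32 and 33
  the same for the set in the output array 6, 34 to 37 the edges, the sides and the smaller side
  of the sweep cut, 38 the size of the current set, 50 the scaled weights and 51 the common
  denominator; 10 to 17 and 40 to 45 are loop counters, and 60 is never read.
\<close>

abbreviation skip :: lcom where "skip \<equiv> LStore 60 (Const 0) (Const 0)"
abbreviation incr :: "nat \<Rightarrow> lcom" where "incr x \<equiv> LStore x (Const 0) (Add (var x) (Const 1))"
abbreviation at_u :: "nat \<Rightarrow> aexp" where "at_u a \<equiv> Get a (var 16)"
abbreviation at_w :: "nat \<Rightarrow> aexp" where "at_w a \<equiv> Get a (var 17)"
abbreviation at_uw :: "nat \<Rightarrow> aexp" where "at_uw a \<equiv> Get a (Add (Mul (var 16) (var 0)) (var 17))"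
abbreviation if_pos :: "aexp \<Rightarrow> lcom \<Rightarrow> lcom" where "if_pos e c \<equiv> LIf (Const 0) e c skip"

text \<open>The language only has strict comparison, so equality of 14 and 16 is the failure of both
  orders.\<close>

definition init_vec :: lcom where
  "init_vec = LFor 16 (LIf (var 16) (var 14) (LStore 23 (var 16) (Const 0))
     (LIf (var 14) (var 16) (LStore 23 (var 16) (Const 0)) (LStore 23 (var 16) (Const 1))))"

text \<open>Adding \<open>2 * v u\<close> in each of the \<open>n\<close> rounds, whether or not
  there is an edge, produces the summand \<open>2 * n\<close> of the shift \<open>2 * n + 1\<close>;
  the remaining 1 is the initial copy in \<open>mul_row\<close>.\<close>

definition mul_entry :: lcom where
  "mul_entry = LSeq (LStore 24 (var 16) (Add (at_u 24) (Add (at_u 23) (at_u 23))))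
     (if_pos (at_u 20) (if_pos (at_w 20) (if_pos (at_uw 1)
       (LStore 24 (var 16) (Add (at_u 24) (Sub (at_w 23) (at_u 23)))))))"

definition mul_row :: lcom where
  "mul_row = LSeq (LStore 24 (var 16) (at_u 23)) (LFor 17 mul_entry)"

definition mul_vec :: lcom where
  "mul_vec = LSeq (LFor 16 mul_row) (LFor 16 (LStore 23 (var 16) (at_u 24)))"

definition power_vec :: lcom where
  "power_vec = LSeq init_vec (nest [40, 41, 42, 43, 44, 45] mul_vec)"

definition sweep_set :: lcom where
  "sweep_set = LFor 16 (LIf (Const 0) (at_u 20)
     (LIf (Get 23 (var 15)) (at_u 23) (LStore 21 (var 16) (Const 0)) (LStore 21 (var 16) (Const 1)))
     (LStore 21 (var 16) (Const 0)))"

definition count_in :: lcom where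
  "count_in = LSeq (LStore 35 (Const 0) (Const 0)) (LFor 16 (if_pos (at_u 21) (incr 35)))"

definition count_out :: lcom where
  "count_out = LSeq (LStore 36 (Const 0) (Const 0))
     (LFor 16 (LIf (Const 0) (at_u 21) skip (if_pos (at_u 20) (incr 36))))"

definition count_edge :: lcom where
  "count_edge = if_pos (at_u 21) (LIf (Const 0) (at_w 21) skip (if_pos (at_w 20) (if_pos (at_uw 1) (incr 34))))"

definition count_edges :: lcom where
  "count_edges = LSeq (LStore 34 (Const 0) (Const 0)) (LFor 16 (LFor 17 count_edge))"

definition smaller_side :: lcom where
  "smaller_side = LIf (var 35) (var 36) (LStore 37 (Const 0) (var 35)) (LStore 37 (Const 0) (var 36))"

text \<open>Densities are compared by cross-multiplication. The products of two program variables
  occur in the test only and are never stored, so they do not affect the growth of bit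
  lengths.\<close>

definition improve :: lcom where
  "improve = LIf (Mul (var 34) (var 31)) (Mul (var 30) (var 37))
     (LSeq (LStore 30 (Const 0) (var 34)) (LSeq (LStore 31 (Const 0) (var 37))
       (LFor 16 (LStore 22 (var 16) (at_u 21))))) skip"

definition try_sweep :: lcom where
  "try_sweep = LSeq sweep_set (LSeq count_in (LSeq count_out (LSeq count_edges (LSeq smaller_side improve))))"

text \<open>The initial ratio 1 / 0 plays the role of infinity: every cut with two nonempty sides
  beats it, and a cut with an empty side never does.\<close>

definition find_cut :: lcom where
  "find_cut = LSeq (LStore 30 (Const 0) (Const 1)) (LSeq (LStore 31 (Const 0) (Const 0))
     (LSeq (LFor 16 (LStore 22 (var 16) (Const 0))) (LFor 14 (LSeq power_vec (LFor 15 try_sweep)))))"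

definition record_set :: lcom where
  "record_set = LSeq (LStore 38 (Const 0) (Const 0)) (LSeq (LFor 16 (if_pos (at_u 20) (incr 38)))
     (LIf (Const 1) (var 38)
       (LIf (Mul (Mul (Const 8) (Get 0 (Const 2))) (var 38)) (Mul (Mul (Const 3) (Get 0 (Const 1))) (var 0)) skip
         (LIf (Mul (var 32) (var 31)) (Mul (var 30) (var 33))
           (LSeq (LStore 32 (Const 0) (var 30)) (LSeq (LStore 33 (Const 0) (var 31))
             (LFor 16 (LIf (Const 0) (at_u 20) (LStore 6 (var 16) (Const 1)) (LStore 6 (var 16) (Const 0)))))) skip)) skip))"

definition descend :: lcom where
  "descend = LIf (Const 0) (Get 22 (var 12)) (LFor 16 (LStore 20 (var 16) (at_u 22)))
     (LFor 16 (if_pos (at_u 22) (LStore 20 (var 16) (Const 0))))"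

definition init_window :: lcom where
  "init_window = LFor 16 (LIf (at_u 50) (Get 50 (var 10)) (LStore 20 (var 16) (Const 0))
     (LIf (Get 50 (var 11)) (at_u 50) (LStore 20 (var 16) (Const 0)) (LStore 20 (var 16) (Const 1))))"

definition walk :: lcom where
  "walk = LSeq init_window (LFor 13 (LSeq find_cut (LSeq record_set descend)))"

text \<open>Weights are only compared with each other, so a positive common factor may clear all
  denominators. Each multiplier is an input value, as \<open>tame\<close> demands, and the diagonal,
  where array 5 holds 0, is skipped.\<close>

definition common_denominator :: lcom where
  "common_denominator = LSeq (LStore 51 (Const 0) (Const 1))
     (LFor 16 (LFor 17 (if_pos (at_uw 5) (LStore 51 (Const 0) (Mul (var 51) (at_uw 5))))))"

definition scaled_weights :: lcom where
  "scaled_weights = LFor 16 (LSeq (LStore 50 (var 16) (Const 0)) (LFor 17 (if_pos (at_uw 5)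
     (LStore 50 (var 16) (Add (at_u 50) (Mul (Div (var 51) (at_uw 5)) (at_uw 4)))))))"

definition main_program :: lcom where
  "main_program = LSeq common_denominator (LSeq scaled_weights (LSeq (LStore 32 (Const 0) (Const 0))
     (LSeq (LStore 33 (Const 0) (Const 1)) (LFor 10 (LFor 11 (LFor 12 walk))))))"

lemmas program_defs = init_vec_def mul_entry_def mul_row_def mul_vec_def power_vec_def sweep_set_def count_in_def
  count_out_def count_edge_def count_edges_def smaller_side_def improve_def try_sweep_def find_cut_def record_set_def descend_def
  init_window_def walk_def common_denominator_def scaled_weights_def main_program_def

lemma well_formed_main: "well_formed main_program"
  by (simp add: program_defs)

section \<open>Semantics of the power iteration\<close>

lemma shift_op_cong:
  assumes "S \<subseteq> {..<n}" "\<And>w. w < n \<Longrightarrow> v w = v' w" "u < n"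
  shows "shift_op S F d v u = shift_op S F d v' u"
  unfolding shift_op_def using assms by (intro arg_cong2[of _ _ _ _ "(-)"] sum.cong refl) auto

definition mul_summand :: "nat \<Rightarrow> memory \<Rightarrow> int \<Rightarrow> int \<Rightarrow> int" where
  "mul_summand n m u w = 2 * m 23 u +
     (if 0 < m 20 u \<and> 0 < m 20 w \<and> 0 < m 1 (u * int n + w) then m 23 w - m 23 u else 0)"

lemma mul_summand_cong:
  "m' 1 = m 1 \<Longrightarrow> m' 20 = m 20 \<Longrightarrow> m' 23 = m 23 \<Longrightarrow> mul_summand n m' = mul_summand n m"
  by (simp add: mul_summand_def fun_eq_iff)

lemma den_mul_entry:
  assumes "m 0 0 = int n"
  shows "den mul_entry m 24 j = m 24 j + (if j = m 16 0 then mul_summand n m (m 16 0) (m 17 0) else 0)"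
  using assms by (simp add: mul_entry_def upd_apply mul_summand_def)

lemma den_mul_row:
  assumes m0: "m 0 0 = int n"
  shows "den mul_row m 24 j =
    (if j = m 16 0 then m 23 (m 16 0) + (\<Sum>w<n. mul_summand n m (m 16 0) (int w)) else m 24 j)"
proof -
  define m1 where "m1 = upd m 24 (m 16 0) (m 23 (m 16 0))"
  define g where "g w = (if j = m 16 0 then mul_summand n m (m 16 0) (int w) else 0)" for w
  have "den (LFor 17 mul_entry) m1 24 j = m1 24 j + (\<Sum>w<n. g w)"
  proof (rule den_for_sum)
    show "m1 0 0 = int n" using m0 by (simp add: m1_def upd_apply)
    show "17 \<notin> writes mul_entry" by (simp add: mul_entry_def)
    fix k m' assume k: "m' 17 0 = int k" and fr: "\<And>a. a \<notin> writes (LFor 17 mul_entry) \<Longrightarrow> m' a = m1 a"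
    have eq: "m' a = m a" if "a \<in> {0, 1, 16, 20, 23}" for a
      using fr[of a] that by (auto simp: mul_entry_def m1_def upd_def)
    have "mul_summand n m' = mul_summand n m" by (rule mul_summand_cong) (rule eq, simp)+
    moreover have "m' 0 0 = int n" "m' 16 = m 16" using eq m0 by simp_all
    ultimately show "den mul_entry m' 24 j = m' 24 j + g k" using k by (simp add: den_mul_entry[of m' n] g_def)
  qed simp
  then show ?thesis by (simp add: mul_row_def m1_def g_def upd_apply)
qed

lemma den_mul_vec:
  assumes g: "graph_mem n E m" and E: "E \<subseteq> pairs {..<n}" and u: "u < n"
  shows "den mul_vec m 23 (int u) =
    shift_op (members n 20 m) (induced_edges E (members n 20 m)) (2 * int n + 1) (\<lambda>w. m 23 (int w)) u"
proof -
  let ?S = "members n 20 m" and ?s = "\<lambda>u w. mul_summand n m (int u) (int w)"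
  have m0: "m 0 0 = int n" using g by (rule graph_mem_size)
  define m1 where "m1 = den (LFor 16 mul_row) m"
  have m1: "m1 24 (int u) = m 23 (int u) + (\<Sum>w<n. ?s u w)" if "u < n" for u
    unfolding m1_def
  proof (rule den_for_map[where g = "\<lambda>u. m 23 (int u) + (\<Sum>w<n. ?s u w)"])
    show "m 0 0 = int n" by (rule m0)
    show "16 \<notin> writes mul_row" by (simp add: mul_row_def mul_entry_def)
    show "u < n" by (rule that)
    fix k l m' assume k: "m' 16 0 = int k" and fr: "\<And>a. a \<notin> writes (LFor 16 mul_row) \<Longrightarrow> m' a = m a"
    have eq: "m' a = m a" if "a \<in> {0, 1, 20, 23}" for a
      using fr[of a] that by (auto simp: mul_row_def mul_entry_def)
    then have m0': "m' 0 0 = int n" using m0 by simp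
    have "mul_summand n m' = mul_summand n m" by (rule mul_summand_cong) (rule eq, simp)+
    moreover have "m' 23 = m 23" by (rule eq) simp
    ultimately show "den mul_row m' 24 (int k) = m 23 (int k) + (\<Sum>w<n. ?s k w)"
      using den_mul_row[where m = m' and n = n and j = "int k", OF m0'] k by simp
    show "den mul_row m' 24 (int l) = m' 24 (int l)" if "l \<noteq> k"
      using den_mul_row[where m = m' and n = n and j = "int l", OF m0'] k that by simp
  qed simp
  have "den mul_vec m 23 (int u) = den (LFor 16 (LStore 23 (var 16) (at_u 24))) m1 23 (int u)"
    by (simp add: mul_vec_def m1_def)
  also have "\<dots> = m1 24 (int u)"
  proof (rule den_for_map[where g = "\<lambda>u. m1 24 (int u)"])
    have "m1 0 = m 0" unfolding m1_def by (rule den_frame) (simp add: mul_row_def mul_entry_def)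
    then show "m1 0 0 = int n" using m0 by simp
  qed (use u in \<open>simp_all add: upd_apply\<close>)
  also have "\<dots> = (2 * int n + 1) * m 23 (int u) +
      (\<Sum>w<n. if w \<in> ?S \<and> {u, w} \<in> induced_edges E ?S then m 23 (int w) - m 23 (int u) else 0)"
  proof -
    have "?s u w = 2 * m 23 (int u) +
        (if w \<in> ?S \<and> {u, w} \<in> induced_edges E ?S then m 23 (int w) - m 23 (int u) else 0)" if "w < n" for w
      using u that graph_mem_edge[OF g u that] by (auto simp: mul_summand_def members_def induced_edges_def)
    then show ?thesis unfolding m1[OF u] by (simp add: sum.distrib algebra_simps)
  qed
  also have "(\<Sum>w<n. if w \<in> ?S \<and> {u, w} \<in> induced_edges E ?S then m 23 (int w) - m 23 (int u) else 0)
      = (\<Sum>w | w \<in> {..<n} \<and> (w \<in> ?S \<and> {u, w} \<in> induced_edges E ?S). m 23 (int w) - m 23 (int u))"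
    by (rule sum.inter_filter[symmetric]) simp
  also have "{w. w \<in> {..<n} \<and> (w \<in> ?S \<and> {u, w} \<in> induced_edges E ?S)} = {w. w \<in> ?S \<and> {u, w} \<in> induced_edges E ?S}"
    by (auto simp: members_def)
  also have "(2 * int n + 1) * m 23 (int u) + (\<Sum>w | w \<in> ?S \<and> {u, w} \<in> induced_edges E ?S. m 23 (int w) - m 23 (int u)) =
      shift_op ?S (induced_edges E ?S) (2 * int n + 1) (\<lambda>w. m 23 (int w)) u"
    by (simp add: shift_op_def sum_subtractf)
  finally show ?thesis .
qed

definition iterated_vec :: "nat \<Rightarrow> nat set set \<Rightarrow> nat set \<Rightarrow> nat \<Rightarrow> nat \<Rightarrow> int" where
  "iterated_vec n E S i =
     (shift_op S (induced_edges E S) (2 * int n + 1) ^^ (n ^ 6)) (\<lambda>u. if u = i then 1 else 0)"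

lemma den_power_vec:
  assumes g: "graph_mem n E m" and E: "E \<subseteq> pairs {..<n}" and i: "m 14 0 = int i" and u: "u < n"
  shows "den power_vec m 23 (int u) = iterated_vec n E (members n 20 m) i u"
proof -
  let ?S = "members n 20 m" and ?e = "\<lambda>u. if u = i then 1 else 0 :: int"
  let ?M = "shift_op ?S (induced_edges E ?S) (2 * int n + 1)"
  have m0: "m 0 0 = int n" using g by (rule graph_mem_size)
  define m1 where "m1 = den init_vec m"
  have fr: "m1 a = m a" if "a \<in> {0, 1, 20}" for a
    unfolding m1_def using that by (intro den_frame) (auto simp: init_vec_def)
  have m1: "m1 23 (int u) = ?e u" if "u < n" for u
    unfolding m1_def init_vec_def by (rule den_for_map) (use m0 i that in \<open>auto simp: upd_apply\<close>)
  define P where "P k m' \<longleftrightarrow> graph_mem n E m' \<and> members n 20 m' = ?S \<and> (\<forall>u<n. m' 23 (int u) = (?M ^^ k) ?e u)" for k m'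
  have "P (0 + n ^ length [40::nat, 41, 42, 43, 44, 45]) (den (nest [40, 41, 42, 43, 44, 45] mul_vec) m1)"
  proof (rule den_nest)
    show "P 0 m1" using g m1 fr graph_mem_cong[of m1 m n E] members_cong[of m1 20 m 20 n] by (simp add: P_def)
    show "m 0 0 = int n" if "P k m" for k m using that graph_mem_size by (auto simp: P_def)
    show "P k (upd m U 0 v)" if "P k m" "U \<in> set [40, 41, 42, 43, 44, 45]" for k m U v
    proof -
      have "upd m U 0 v a = m a" if "a \<in> {0, 1, 20, 23}" for a using that \<open>U \<in> _\<close> by (auto simp: upd_def)
      then show ?thesis using that graph_mem_cong[of "upd m U 0 v" m n E] members_cong[of "upd m U 0 v" 20 m 20 n]
        by (simp add: P_def)
    qed
    show "P (Suc k) (den mul_vec m')" if P: "P k m'" for k m'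
    proof -
      have "den mul_vec m' a = m' a" if "a \<in> {0, 1, 20}" for a
        using that by (intro den_frame) (auto simp: mul_vec_def mul_row_def mul_entry_def)
      moreover have "den mul_vec m' 23 (int u) = (?M ^^ Suc k) ?e u" if "u < n" for u
      proof -
        have "den mul_vec m' 23 (int u) = ?M (\<lambda>w. m' 23 (int w)) u"
          using den_mul_vec[OF _ E that, of m'] P by (simp add: P_def)
        also have "\<dots> = ?M ((?M ^^ k) ?e) u"
          by (rule shift_op_cong[of _ n]) (use P that in \<open>auto simp: P_def members_def\<close>)
        finally show ?thesis by simp
      qed
      ultimately show ?thesis using P graph_mem_cong[of "den mul_vec m'" m' n E] members_cong[of "den mul_vec m'" 20 m' 20 n]
        by (simp add: P_def)
    qed
  qed (auto simp: mul_vec_def mul_row_def mul_entry_def)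
  moreover have "length [40::nat, 41, 42, 43, 44, 45] = 6" by simp
  ultimately have Q: "P (n ^ 6) (den (nest [40, 41, 42, 43, 44, 45] mul_vec) m1)" by (simp only: add_0)
  have "den power_vec m = den (nest [40, 41, 42, 43, 44, 45] mul_vec) m1"
    by (simp only: power_vec_def den.simps m1_def)
  then show ?thesis using Q u by (simp only: P_def iterated_vec_def)
qed

section \<open>Semantics of counting and of choosing a cut\<close>

lemma card_members:
  fixes n :: nat
  shows "int (card {u. u < n \<and> P u}) = (\<Sum>k<n. if P k then 1 else 0)"
proof -
  have "(\<Sum>k<n. if P k then 1 else 0 :: int) = (\<Sum>k | k \<in> {..<n} \<and> P k. 1)"
    by (rule sum.inter_filter[symmetric]) simp
  then show ?thesis by simp
qed

lemma members_subset: "members n a m \<subseteq> {..<n}"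
  by (auto simp: members_def)

lemma den_sweep_set:
  assumes m0: "m 0 0 = int n" and j: "m 15 0 = int j"
  shows "members n 21 (den sweep_set m) = sweep (members n 20 m) (\<lambda>u. m 23 (int u)) j"
proof -
  have "den sweep_set m 21 (int u) = (if 0 < m 20 (int u) \<and> m 23 (int u) \<le> m 23 (int j) then 1 else 0)" if "u < n" for u
    unfolding sweep_set_def by (rule den_for_map) (use m0 j that in \<open>auto simp: upd_apply\<close>)
  then show ?thesis by (auto simp: members_def split: if_splits)
qed

lemma den_count_in:
  assumes m0: "m 0 0 = int n"
  shows "den count_in m 35 0 = int (card (members n 21 m))"
proof -
  let ?m = "upd m 35 0 0"
  have "den (LFor 16 (if_pos (at_u 21) (incr 35))) ?m 35 0 = ?m 35 0 + (\<Sum>k<n. if 0 < m 21 (int k) then 1 else 0)"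
  proof (rule den_for_sum)
    fix k m' assume "m' 16 0 = int k" and fr: "\<And>a. a \<notin> writes (LFor 16 (if_pos (at_u 21) (incr 35))) \<Longrightarrow> m' a = ?m a"
    moreover have "m' 21 = m 21" using fr[of 21] by (simp add: upd_def)
    ultimately show "den (if_pos (at_u 21) (incr 35)) m' 35 0 = m' 35 0 + (if 0 < m 21 (int k) then 1 else 0)"
      by (simp add: upd_apply)
  qed (use m0 in \<open>simp_all add: upd_apply\<close>)
  then show ?thesis by (simp only: count_in_def den.simps aval.simps members_def card_members) (simp add: upd_apply)
qed

lemma den_count_out:
  assumes m0: "m 0 0 = int n"
  shows "den count_out m 36 0 = int (card (members n 20 m - members n 21 m))"
proof -
  let ?m = "upd m 36 0 0" and ?c = "LIf (Const 0) (at_u 21) skip (if_pos (at_u 20) (incr 36))"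
  have "den (LFor 16 ?c) ?m 36 0 = ?m 36 0 + (\<Sum>k<n. if 0 < m 20 (int k) \<and> \<not> 0 < m 21 (int k) then 1 else 0)"
  proof (rule den_for_sum)
    fix k m' assume "m' 16 0 = int k" and fr: "\<And>a. a \<notin> writes (LFor 16 ?c) \<Longrightarrow> m' a = ?m a"
    moreover have "m' 21 = m 21" "m' 20 = m 20" using fr[of 21] fr[of 20] by (simp_all add: upd_def)
    ultimately show "den ?c m' 36 0 = m' 36 0 + (if 0 < m 20 (int k) \<and> \<not> 0 < m 21 (int k) then 1 else 0)"
      by (simp add: upd_apply)
  qed (use m0 in \<open>simp_all add: upd_apply\<close>)
  moreover have "members n 20 m - members n 21 m = {u. u < n \<and> (0 < m 20 (int u) \<and> \<not> 0 < m 21 (int u))}"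
    by (auto simp: members_def)
  ultimately show ?thesis by (simp only: count_out_def den.simps aval.simps card_members) (simp add: upd_apply)
qed

text \<open>The program counts ordered pairs of vertices. Requiring the first in \<open>A\<close>
  and the second outside fixes the orientation, so no edge is counted twice.\<close>

lemma card_cut_ordered:
  assumes E: "E \<subseteq> pairs V" and A: "A \<subseteq> S"
  shows "card (cut (induced_edges E S) A) = card {(u, w). u \<in> A \<and> w \<in> S - A \<and> {u, w} \<in> E}"
proof -
  have "bij_betw (\<lambda>(u, w). {u, w}) {(u, w). u \<in> A \<and> w \<in> S - A \<and> {u, w} \<in> E} (between E A (S - A))"
    unfolding bij_betw_def
  proof
    show "inj_on (\<lambda>(u, w). {u, w}) {(u, w). u \<in> A \<and> w \<in> S - A \<and> {u, w} \<in> E}"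
      by (auto simp: inj_on_def doubleton_eq_iff)
    show "(\<lambda>(u, w). {u, w}) ` {(u, w). u \<in> A \<and> w \<in> S - A \<and> {u, w} \<in> E} = between E A (S - A)"
    proof
      show "between E A (S - A) \<subseteq> (\<lambda>(u, w). {u, w}) ` {(u, w). u \<in> A \<and> w \<in> S - A \<and> {u, w} \<in> E}"
      proof
        fix e assume e: "e \<in> between E A (S - A)"
        then have "e \<in> pairs V" using E by (auto simp: between_def)
        then obtain u v where uv: "u \<noteq> v" "e = {u, v}" by (rule pairsE)
        have "(u \<in> A \<and> v \<in> S - A) \<or> (v \<in> A \<and> u \<in> S - A)" "e \<in> E" using e uv(2) by (auto simp: between_def)
        then show "e \<in> (\<lambda>(u, w). {u, w}) ` {(u, w). u \<in> A \<and> w \<in> S - A \<and> {u, w} \<in> E}"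
        proof (elim disjE)
          assume "u \<in> A \<and> v \<in> S - A"
          then show ?thesis using \<open>e \<in> E\<close> unfolding uv(2) by (intro image_eqI[of _ _ "(u, v)"]) auto
        next
          assume "v \<in> A \<and> u \<in> S - A"
          then show ?thesis using \<open>e \<in> E\<close> unfolding uv(2) by (intro image_eqI[of _ _ "(v, u)"]) (auto simp: insert_commute)
        qed
      qed
    qed (auto simp: between_def)
  qed
  then show ?thesis unfolding cut_induced_edges[OF E A] by (simp add: bij_betw_same_card)
qed

lemma den_count_edge:
  "den count_edge m 34 0 = m 34 0 +
    (if 0 < m 21 (m 16 0) \<and> \<not> 0 < m 21 (m 17 0) \<and> 0 < m 20 (m 17 0) \<and> 0 < m 1 (m 16 0 * m 0 0 + m 17 0) then 1 else 0)"
  by (simp add: count_edge_def upd_apply)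

lemma den_count_edges:
  assumes g: "graph_mem n E m" and E: "E \<subseteq> pairs {..<n}" and A: "members n 21 m \<subseteq> members n 20 m"
  shows "den count_edges m 34 0 = int (card (cut (induced_edges E (members n 20 m)) (members n 21 m)))"
proof -
  let ?m = "upd m 34 0 0" and ?A = "members n 21 m" and ?S = "members n 20 m"
  define g where "g u w = (if u \<in> ?A \<and> w \<in> ?S - ?A \<and> {u, w} \<in> E then 1 else 0 :: int)" for u w
  have m0: "m 0 0 = int n" using g by (rule graph_mem_size)
  have inner: "den (LFor 17 count_edge) m' 34 0 = m' 34 0 + (\<Sum>w<n. g u w)"
    if u: "u < n" "m' 16 0 = int u" and eq: "\<And>a. a \<in> {0, 1, 20, 21} \<Longrightarrow> m' a = m a" for m' u
  proof (rule den_for_sum)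
    show "m' 0 0 = int n" using eq[of 0] m0 by simp
    fix k m'' assume k: "k < n" "m'' 17 0 = int k" and fr: "\<And>a. a \<notin> writes (LFor 17 count_edge) \<Longrightarrow> m'' a = m' a"
    have "m'' a = m' a" if "a \<in> {0, 1, 16, 20, 21}" for a using fr[of a] that by (auto simp: count_edge_def)
    then show "den count_edge m'' 34 0 = m'' 34 0 + g u k"
      using u k eq m0 graph_mem_edge[OF assms(1) u(1) k(1)] by (simp add: den_count_edge g_def members_def)
  qed (simp_all add: count_edge_def)
  have "den (LFor 16 (LFor 17 count_edge)) ?m 34 0 = ?m 34 0 + (\<Sum>u<n. \<Sum>w<n. g u w)"
  proof (rule den_for_sum)
    fix k m' assume k: "k < n" "m' 16 0 = int k" and fr: "\<And>a. a \<notin> writes (LFor 16 (LFor 17 count_edge)) \<Longrightarrow> m' a = ?m a"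
    have "m' a = m a" if "a \<in> {0, 1, 20, 21}" for a using fr[of a] that by (auto simp: count_edge_def upd_def)
    then show "den (LFor 17 count_edge) m' 34 0 = m' 34 0 + (\<Sum>w<n. g k w)" by (intro inner k)
  qed (use m0 in \<open>simp_all add: upd_apply count_edge_def\<close>)
  also have "(\<Sum>u<n. \<Sum>w<n. g u w) = (\<Sum>p\<in>{..<n} \<times> {..<n}. if fst p \<in> ?A \<and> snd p \<in> ?S - ?A \<and> {fst p, snd p} \<in> E then 1 else 0)"
    unfolding sum.cartesian_product by (simp add: g_def case_prod_unfold)
  also have "\<dots> = (\<Sum>p | p \<in> {..<n} \<times> {..<n} \<and> (fst p \<in> ?A \<and> snd p \<in> ?S - ?A \<and> {fst p, snd p} \<in> E). 1)"
    by (rule sum.inter_filter[symmetric]) simp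
  also have "{p. p \<in> {..<n} \<times> {..<n} \<and> (fst p \<in> ?A \<and> snd p \<in> ?S - ?A \<and> {fst p, snd p} \<in> E)}
      = {(u, w). u \<in> ?A \<and> w \<in> ?S - ?A \<and> {u, w} \<in> E}"
    by (auto simp: members_def)
  also have "(\<Sum>p\<in>\<dots>. 1 :: int) = int (card (cut (induced_edges E ?S) ?A))"
    unfolding card_cut_ordered[OF E A] by simp
  finally show ?thesis by (simp only: count_edges_def den.simps aval.simps) (simp add: upd_apply)
qed

definition cut_size :: "nat set set \<Rightarrow> nat set \<Rightarrow> nat set \<Rightarrow> int" where
  "cut_size E S A = int (card (cut (induced_edges E S) A))"

definition small_side :: "nat set \<Rightarrow> nat set \<Rightarrow> int" where
  "small_side S A = int (min (card A) (card (S - A)))"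

definition update_cut :: "nat set set \<Rightarrow> nat set \<Rightarrow> nat set \<Rightarrow> int \<times> int \<times> nat set \<Rightarrow> int \<times> int \<times> nat set" where
  "update_cut E S A st = (case st of (e, b, C) \<Rightarrow>
     if cut_size E S A * b < e * small_side S A then (cut_size E S A, small_side S A, A) else st)"

definition cut_state :: "nat \<Rightarrow> memory \<Rightarrow> int \<times> int \<times> nat set" where
  "cut_state n m = (m 30 0, m 31 0, members n 22 m)"

lemma cut_state_cong: "m' 30 = m 30 \<Longrightarrow> m' 31 = m 31 \<Longrightarrow> m' 22 = m 22 \<Longrightarrow> cut_state n m' = cut_state n m"
  by (simp add: cut_state_def members_def)

lemma den_improve:
  assumes m0: "m 0 0 = int n"
  shows "cut_state n (den improve m) =
    (if m 34 0 * m 31 0 < m 30 0 * m 37 0 then (m 34 0, m 37 0, members n 21 m) else cut_state n m)"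
proof (cases "m 34 0 * m 31 0 < m 30 0 * m 37 0")
  case True
  define m1 where "m1 = upd (upd m 30 0 (m 34 0)) 31 0 (m 37 0)"
  define m2 where "m2 = den (LFor 16 (LStore 22 (var 16) (at_u 21))) m1"
  have "m2 22 (int u) = m1 21 (int u)" if "u < n" for u
    unfolding m2_def by (rule den_for_map) (use m0 that in \<open>auto simp: upd_apply m1_def\<close>)
  then have "members n 22 m2 = members n 21 m1" by (auto simp: members_def)
  also have "members n 21 m1 = members n 21 m" by (simp add: m1_def upd_def members_def)
  finally have "members n 22 m2 = members n 21 m" .
  moreover have "m2 a = m1 a" if "a \<in> {30, 31}" for a unfolding m2_def using that by (intro den_frame) auto
  moreover have "den improve m = m2" using True by (simp add: improve_def m1_def m2_def upd_apply)
  ultimately show ?thesis using True by (simp add: cut_state_def m1_def upd_apply)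
next
  case False
  then show ?thesis by (simp add: improve_def cut_state_def members_def upd_def)
qed

lemma den_try_sweep:
  assumes g: "graph_mem n E m" and E: "E \<subseteq> pairs {..<n}" and j: "m 15 0 = int j"
  shows "cut_state n (den try_sweep m) =
    update_cut E (members n 20 m) (sweep (members n 20 m) (\<lambda>u. m 23 (int u)) j) (cut_state n m)"
proof -
  let ?S = "members n 20 m"
  let ?A = "sweep ?S (\<lambda>u. m 23 (int u)) j"
  define m1 where "m1 = den sweep_set m"
  define m2 where "m2 = den count_in m1"
  define m3 where "m3 = den count_out m2"
  define m4 where "m4 = den count_edges m3"
  define m5 where "m5 = den smaller_side m4"
  have f1: "m1 a = m a" if "a \<in> {0, 1, 20, 22, 30, 31}" for a
    unfolding m1_def using that by (intro den_frame) (auto simp: sweep_set_def)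
  have f2: "m2 a = m1 a" if "a \<in> {0, 1, 20, 21, 22, 30, 31}" for a
    unfolding m2_def using that by (intro den_frame) (auto simp: count_in_def)
  have f3: "m3 a = m2 a" if "a \<in> {0, 1, 20, 21, 22, 30, 31, 35}" for a
    unfolding m3_def using that by (intro den_frame) (auto simp: count_out_def)
  have f4: "m4 a = m3 a" if "a \<in> {0, 1, 20, 21, 22, 30, 31, 35, 36}" for a
    unfolding m4_def using that by (intro den_frame) (auto simp: count_edges_def count_edge_def)
  have f5: "m5 a = m4 a" if "a \<in> {0, 1, 20, 21, 22, 30, 31, 34}" for a
    unfolding m5_def using that by (intro den_frame) (auto simp: smaller_side_def)
  have m0: "m 0 0 = int n" using g by (rule graph_mem_size)
  have A1: "members n 21 m1 = ?A" unfolding m1_def by (rule den_sweep_set[where m = m and n = n and j = j, OF m0 j])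
  have A: "members n 21 m2 = ?A" "members n 21 m3 = ?A" "members n 21 m5 = ?A"
    using A1 f2 f3 f4 f5 by (simp_all add: members_def)
  have S: "members n 20 m1 = ?S" "members n 20 m2 = ?S" "members n 20 m3 = ?S"
    using f1 f2 f3 by (simp_all add: members_def)
  have 35: "m4 35 0 = int (card ?A)"
    using den_count_in[of m1 n] m0 f1 f3 f4 A1 by (simp add: m2_def[symmetric])
  have 36: "m4 36 0 = int (card (?S - ?A))"
    using den_count_out[of m2 n] m0 f1 f2 f4 A S by (simp add: m3_def[symmetric])
  have "graph_mem n E m3" using g f1 f2 f3 graph_mem_cong[of m3 m n E] by simp
  then have "m4 34 0 = cut_size E ?S ?A"
    unfolding cut_size_def using den_count_edges[of n E m3] E A S by (simp add: m4_def[symmetric])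
  then have 34: "m5 34 0 = cut_size E ?S ?A" using f5 by simp
  have 37: "m5 37 0 = small_side ?S ?A"
    using 35 36 by (auto simp: m5_def smaller_side_def upd_apply small_side_def min_def)
  have st: "cut_state n m5 = cut_state n m" using f1 f2 f3 f4 f5 by (intro cut_state_cong) simp_all
  have "cut_state n (den try_sweep m) = cut_state n (den improve m5)"
    by (simp only: try_sweep_def den.simps m1_def m2_def m3_def m4_def m5_def)
  also have "\<dots> = (if m5 34 0 * m5 31 0 < m5 30 0 * m5 37 0 then (m5 34 0, m5 37 0, members n 21 m5) else cut_state n m5)"
    by (rule den_improve) (use m0 f1 f2 f3 f4 f5 in simp)
  also have "\<dots> = update_cut E ?S ?A (cut_state n m5)"
    by (simp add: update_cut_def cut_state_def 34 37 A)
  finally show ?thesis by (simp only: st)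
qed

fun sweep_row :: "nat set set \<Rightarrow> nat set \<Rightarrow> (nat \<Rightarrow> int) \<Rightarrow> nat \<Rightarrow> int \<times> int \<times> nat set \<Rightarrow> int \<times> int \<times> nat set" where
  "sweep_row E S v 0 st = st"
| "sweep_row E S v (Suc k) st = update_cut E S (sweep S v k) (sweep_row E S v k st)"

text \<open>\<open>i\<close> runs over all vertices, since membership in \<open>S\<close> need not
  be tested: other starting vectors also yield subsets of \<open>S\<close>, and further candidates
  can only make the best cut sparser.\<close>

fun sweep_rows :: "nat \<Rightarrow> nat set set \<Rightarrow> nat set \<Rightarrow> nat \<Rightarrow> int \<times> int \<times> nat set" where
  "sweep_rows n E S 0 = (1, 0, {})"
| "sweep_rows n E S (Suc i) = sweep_row E S (iterated_vec n E S i) n (sweep_rows n E S i)"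

definition best_cut :: "nat \<Rightarrow> nat set set \<Rightarrow> nat set \<Rightarrow> int \<times> int \<times> nat set" where
  "best_cut n E S = sweep_rows n E S n"

lemma sweep_row_cong:
  assumes "S \<subseteq> {..<n}" "\<And>u. u < n \<Longrightarrow> v u = v' u" "k \<le> n"
  shows "sweep_row E S v k st = sweep_row E S v' k st"
  using assms(3)
proof (induction k)
  case (Suc k)
  have "sweep S v k = sweep S v' k" using assms(1,2) Suc.prems by auto
  then show ?case using Suc by simp
qed simp

lemma den_sweep_row:
  assumes g: "graph_mem n E m" and E: "E \<subseteq> pairs {..<n}"
  shows "cut_state n (den (LFor 15 try_sweep) m) = sweep_row E (members n 20 m) (\<lambda>u. m 23 (int u)) n (cut_state n m)"
proof (rule den_for_inv[where m = m and n = n and P = "\<lambda>k m'. cut_state n m' = sweep_row E (members n 20 m) (\<lambda>u. m 23 (int u)) k (cut_state n m)"])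
  show "m 0 0 = int n" using g by (rule graph_mem_size)
  show "15 \<notin> writes try_sweep" by (simp add: program_defs)
  show "cut_state n (upd m 15 0 0) = sweep_row E (members n 20 m) (\<lambda>u. m 23 (int u)) 0 (cut_state n m)"
    by (simp add: cut_state_def members_def upd_def)
  fix k m' assume IH: "cut_state n m' = sweep_row E (members n 20 m) (\<lambda>u. m 23 (int u)) k (cut_state n m)"
    and k: "m' 15 0 = int k" and fr: "\<And>a. a \<notin> writes (LFor 15 try_sweep) \<Longrightarrow> m' a = m a"
  have eq: "m' a = m a" if "a \<in> {0, 1, 20, 23}" for a using fr[of a] that by (auto simp: program_defs)
  then have "graph_mem n E m'" using g graph_mem_cong[of m' m n E] by simp
  from den_try_sweep[OF this E k] show "cut_state n (upd (den try_sweep m') 15 0 (int (Suc k))) =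
      sweep_row E (members n 20 m) (\<lambda>u. m 23 (int u)) (Suc k) (cut_state n m)"
    using IH eq by (simp add: cut_state_def members_def upd_def)
qed

lemma den_find_cut:
  assumes g: "graph_mem n E m" and E: "E \<subseteq> pairs {..<n}"
  shows "cut_state n (den find_cut m) = best_cut n E (members n 20 m)"
proof -
  let ?S = "members n 20 m"
  define m1 where "m1 = upd (upd m 30 0 1) 31 0 0"
  define m2 where "m2 = den (LFor 16 (LStore 22 (var 16) (Const 0))) m1"
  have m0: "m 0 0 = int n" using g by (rule graph_mem_size)
  have "m2 22 (int u) = 0" if "u < n" for u
    unfolding m2_def by (rule den_for_map[where g = "\<lambda>u. 0"]) (use m0 that in \<open>auto simp: upd_apply m1_def\<close>)
  moreover have f2: "m2 a = m1 a" if "a \<noteq> 16" "a \<noteq> 22" for a unfolding m2_def using that by (intro den_frame) auto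
  ultimately have st: "cut_state n m2 = (1, 0, {})"
    by (auto simp: cut_state_def members_def m1_def upd_apply)
  have f: "m2 a = m a" if "a \<in> {0, 1, 20}" for a using f2[of a] that by (auto simp: m1_def upd_def)
  have "cut_state n (den (LFor 14 (LSeq power_vec (LFor 15 try_sweep))) m2) = sweep_rows n E ?S n"
  proof (rule den_for_inv[where m = m2 and n = n and P = "\<lambda>k m'. cut_state n m' = sweep_rows n E ?S k"])
    show "m2 0 0 = int n" using f m0 by simp
    show "14 \<notin> writes (LSeq power_vec (LFor 15 try_sweep))" by (simp add: program_defs)
    show "cut_state n (upd m2 14 0 0) = sweep_rows n E ?S 0"
      using st by (simp add: cut_state_def members_def upd_def)
    fix k m' assume IH: "cut_state n m' = sweep_rows n E ?S k" and k: "m' 14 0 = int k"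
      and fr: "\<And>a. a \<notin> writes (LFor 14 (LSeq power_vec (LFor 15 try_sweep))) \<Longrightarrow> m' a = m2 a"
    define m'' where "m'' = den power_vec m'"
    have eq: "m' a = m a" if "a \<in> {0, 1, 20}" for a using fr[of a] f[of a] that by (auto simp: program_defs)
    have f'': "m'' a = m' a" if "a \<in> {0, 1, 20, 22, 30, 31}" for a
      unfolding m''_def using that by (intro den_frame) (auto simp: program_defs)
    have g': "graph_mem n E m'" "graph_mem n E m''"
      using g eq f'' graph_mem_cong[of m' m n E] graph_mem_cong[of m'' m' n E] by simp_all
    have S: "members n 20 m' = ?S" "members n 20 m'' = ?S" using eq f'' by (simp_all add: members_def)
    have v: "m'' 23 (int u) = iterated_vec n E ?S k u" if "u < n" for u
      using den_power_vec[OF g'(1) E k that] S by (simp add: m''_def)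
    have "cut_state n (den (LFor 15 try_sweep) m'') = sweep_row E ?S (\<lambda>u. m'' 23 (int u)) n (cut_state n m'')"
      using den_sweep_row[OF g'(2) E] S by simp
    also have "\<dots> = sweep_row E ?S (iterated_vec n E ?S k) n (cut_state n m'')"
      by (rule sweep_row_cong[OF members_subset v]) auto
    also have "cut_state n m'' = cut_state n m'" using f'' by (intro cut_state_cong) simp_all
    finally have "cut_state n (den (LFor 15 try_sweep) m'') = sweep_rows n E ?S (Suc k)" using IH by simp
    then show "cut_state n (upd (den (LSeq power_vec (LFor 15 try_sweep)) m') 14 0 (int (Suc k))) = sweep_rows n E ?S (Suc k)"
      unfolding den.simps(2) m''_def[symmetric] by (simp only: cut_state_def members_def upd_apply) simp
  qed
  moreover have "den find_cut m = den (LFor 14 (LSeq power_vec (LFor 15 try_sweep))) m2"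
    by (simp only: find_cut_def den.simps aval.simps m1_def m2_def)
  ultimately show ?thesis by (simp only: best_cut_def)
qed

section \<open>Correctness of the search\<close>

text \<open>Transitivity of the order on ratios that may be infinite. The condition on the middle
  one excludes 0 / 0, which would be comparable with everything.\<close>

lemma ratio_trans:
  fixes e1 e2 e3 b1 b2 b3 :: int
  assumes "e1 * b2 \<le> e2 * b1" "e2 * b3 \<le> e3 * b2" "0 \<le> b1" "0 \<le> b3" "0 \<le> e3" "0 < b2 \<or> b2 = 0 \<and> e2 = 1"
  shows "e1 * b3 \<le> e3 * b1"
proof (cases "b2 = 0")
  case True
  then have "b3 = 0" using assms(2,4,6) by simp
  then show ?thesis using assms(3,5) by simp
next
  case False
  then have b2: "0 < b2" using assms(6) by simp
  have "e1 * b2 * b3 \<le> e2 * b1 * b3" using assms(1,4) by (rule mult_right_mono)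
  also have "\<dots> = e2 * b3 * b1" by simp
  also have "\<dots> \<le> e3 * b2 * b1" using assms(2,3) by (rule mult_right_mono)
  finally have "(e1 * b3) * b2 \<le> (e3 * b1) * b2" by (simp add: mult_ac)
  then show ?thesis using b2 by simp
qed

text \<open>The state is the minimum density over the cuts in \<open>T\<close>, attained by its
  third component unless no cut has two nonempty sides, in which case it is 1 / 0.\<close>

definition cut_ok :: "nat set set \<Rightarrow> nat set \<Rightarrow> nat set set \<Rightarrow> int \<times> int \<times> nat set \<Rightarrow> bool" where
  "cut_ok E S T st \<longleftrightarrow> (case st of (e, b, C) \<Rightarrow>
     (b = 0 \<and> e = 1 \<or> 0 < b \<and> C \<subseteq> S \<and> e = cut_size E S C \<and> b = small_side S C) \<and>
     (\<forall>A\<in>T. e * small_side S A \<le> cut_size E S A * b))"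

lemma cut_size_nonneg: "0 \<le> cut_size E S A" and small_side_nonneg: "0 \<le> small_side S A"
  by (simp_all add: cut_size_def small_side_def)

lemma cut_ok_update:
  assumes "cut_ok E S T st" "A \<subseteq> S"
  shows "cut_ok E S (insert A T) (update_cut E S A st)"
proof -
  obtain e b C where st: "st = (e, b, C)" by (cases st)
  let ?c = "cut_size E S A" and ?s = "small_side S A"
  have v: "0 < b \<or> b = 0 \<and> e = 1" and T: "\<And>A'. A' \<in> T \<Longrightarrow> e * small_side S A' \<le> cut_size E S A' * b"
    using assms(1) by (auto simp: cut_ok_def st)
  show ?thesis
  proof (cases "?c * b < e * ?s")
    case True
    have "?s \<noteq> 0"
    proof
      assume "?s = 0"
      then have "?c * b < 0" using True by simp
      moreover have "0 \<le> ?c * b" using v cut_size_nonneg by (intro mult_nonneg_nonneg) auto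
      ultimately show False by simp
    qed
    then have s: "0 < ?s" using small_side_nonneg[of S A] by simp
    have "?c * small_side S A' \<le> cut_size E S A' * ?s" if "A' \<in> T" for A'
      using True T[OF that] v by (intro ratio_trans[of ?c b e ?s "small_side S A'" "cut_size E S A'"])
        (simp_all add: cut_size_nonneg small_side_nonneg)
    then show ?thesis using True s assms(2) by (simp add: cut_ok_def update_cut_def st)
  next
    case False
    then show ?thesis using assms(1) by (simp add: cut_ok_def update_cut_def st)
  qed
qed

lemma cut_ok_sweep_row: "cut_ok E S T st \<Longrightarrow> cut_ok E S (T \<union> {sweep S v j |j. j < k}) (sweep_row E S v k st)"
proof (induction k)
  case (Suc k)
  have "T \<union> {sweep S v j |j. j < Suc k} = insert (sweep S v k) (T \<union> {sweep S v j |j. j < k})"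
    by (auto simp: less_Suc_eq)
  then show ?case using cut_ok_update[OF Suc.IH[OF Suc.prems], of "sweep S v k"] by simp
qed simp

lemma cut_ok_sweep_rows:
  "cut_ok E S {sweep S (iterated_vec n E S i) j |i j. i < k \<and> j < n} (sweep_rows n E S k)"
proof (induction k)
  case 0
  then show ?case by (simp add: cut_ok_def)
next
  case (Suc k)
  have "{sweep S (iterated_vec n E S i) j |i j. i < Suc k \<and> j < n} =
      {sweep S (iterated_vec n E S i) j |i j. i < k \<and> j < n} \<union> {sweep S (iterated_vec n E S k) j |j. j < n}"
    by (auto simp: less_Suc_eq)
  then show ?case using cut_ok_sweep_row[OF Suc.IH] by simp
qed

lemma cut_ok_best_cut:
  "cut_ok E S {sweep S (iterated_vec n E S i) j |i j. i < n \<and> j < n} (best_cut n E S)"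
  unfolding best_cut_def by (rule cut_ok_sweep_rows)

definition large :: "int \<Rightarrow> int \<Rightarrow> nat \<Rightarrow> nat set \<Rightarrow> bool" where
  "large nu de n S \<longleftrightarrow> 1 < int (card S) \<and> \<not> 8 * de * int (card S) < 3 * nu * int n"

definition best_state :: "nat \<Rightarrow> memory \<Rightarrow> int \<times> int \<times> nat set" where
  "best_state n m = (m 32 0, m 33 0, output_set n m)"

lemma best_state_cong: "m' 32 = m 32 \<Longrightarrow> m' 33 = m 33 \<Longrightarrow> m' 6 = m 6 \<Longrightarrow> best_state n m' = best_state n m"
  by (simp add: best_state_def output_set_def)

definition update_best ::
    "int \<Rightarrow> int \<Rightarrow> nat \<Rightarrow> nat set \<Rightarrow> int \<times> int \<times> nat set \<Rightarrow> int \<times> int \<times> nat set \<Rightarrow> int \<times> int \<times> nat set" where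
  "update_best nu de n S cs gs = (case cs of (e, b, C) \<Rightarrow> case gs of (ge, gb, R) \<Rightarrow>
     if large nu de n S \<and> ge * b < e * gb then (e, b, S) else gs)"

text \<open>The recorded ratio is a maximum over large sets of a minimum over their sweep cuts. The
  alternative 0 / 1 is the state before a set of positive density has been found.\<close>

definition best_ok :: "int \<Rightarrow> int \<Rightarrow> nat \<Rightarrow> nat set set \<Rightarrow> nat set set \<Rightarrow> int \<times> int \<times> nat set \<Rightarrow> bool" where
  "best_ok nu de n E T gs \<longleftrightarrow> (case gs of (ge, gb, R) \<Rightarrow>
     (ge = 0 \<and> gb = 1 \<or> R \<subseteq> {..<n} \<and> large nu de n R \<and> (\<exists>C. best_cut n E R = (ge, gb, C))) \<and>
     (\<forall>S\<in>T. \<forall>e b C. large nu de n S \<longrightarrow> best_cut n E S = (e, b, C) \<longrightarrow> e * gb \<le> ge * b))"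

lemma best_cut_valid:
  assumes "best_cut n E S = (e, b, C)"
  shows "0 \<le> e" "0 \<le> b" "0 < b \<or> b = 0 \<and> e = 1"
  using cut_ok_best_cut[of E S n] cut_size_nonneg[of E S C] unfolding assms cut_ok_def by auto

lemma best_ok_update:
  assumes ok: "best_ok nu de n E T gs" and S: "S \<subseteq> {..<n}"
  shows "best_ok nu de n E (insert S T) (update_best nu de n S (best_cut n E S) gs)"
proof -
  obtain ge gb R where gs: "gs = (ge, gb, R)" by (cases gs)
  obtain e b C where cs: "best_cut n E S = (e, b, C)" by (cases "best_cut n E S")
  have v: "0 < gb \<or> gb = 0 \<and> ge = 1"
    using ok best_cut_valid[of n E R ge gb] by (auto simp: best_ok_def gs)
  note val = best_cut_valid[OF cs]
  have T: "e' * gb \<le> ge * b'" if "S' \<in> T" "large nu de n S'" "best_cut n E S' = (e', b', C')" for S' e' b' C'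
    using ok that by (auto simp: best_ok_def gs)
  show ?thesis
  proof (cases "large nu de n S \<and> ge * b < e * gb")
    case True
    have "e' * b \<le> e * b'" if "S' \<in> T" "large nu de n S'" "best_cut n E S' = (e', b', C')" for S' e' b' C'
      using T[OF that] True v val best_cut_valid[OF that(3)] by (intro ratio_trans[of e' gb ge b' b e]) auto
    then show ?thesis using True S cs by (simp add: best_ok_def update_best_def gs) blast
  next
    case False
    have "e' * gb \<le> ge * b'" if "S' \<in> insert S T" "large nu de n S'" "best_cut n E S' = (e', b', C')" for S' e' b' C'
      using T[of S' e' b' C'] that False cs by (auto simp: not_less)
    moreover have "update_best nu de n S (best_cut n E S) gs = gs"
      using False cs by (auto simp: update_best_def gs)
    ultimately show ?thesis using ok unfolding best_ok_def gs prod.case by auto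
  qed
qed

lemma den_record_set:
  assumes m0: "m 0 0 = int n"
  shows "best_state n (den record_set m) = update_best (m 0 1) (m 0 2) n (members n 20 m) (cut_state n m) (best_state n m)"
proof -
  let ?S = "members n 20 m"
  define m1 where "m1 = den (LFor 16 (if_pos (at_u 20) (incr 38))) (upd m 38 0 0)"
  have f1: "m1 a = m a" if "a \<notin> {16, 38, 60}" for a
  proof -
    have "m1 a = upd m 38 0 0 a" unfolding m1_def using that by (intro den_frame) auto
    then show ?thesis using that by (simp add: upd_def)
  qed
  have 38: "m1 38 0 = int (card ?S)"
  proof -
    have "m1 38 0 = upd m 38 0 0 38 0 + (\<Sum>k<n. if 0 < m 20 (int k) then 1 else 0)"
      unfolding m1_def
    proof (rule den_for_sum)
      fix k m' assume "m' 16 0 = int k" and fr: "\<And>a. a \<notin> writes (LFor 16 (if_pos (at_u 20) (incr 38))) \<Longrightarrow> m' a = upd m 38 0 0 a"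
      moreover have "m' 20 = m 20" using fr[of 20] by (simp add: upd_def)
      ultimately show "den (if_pos (at_u 20) (incr 38)) m' 38 0 = m' 38 0 + (if 0 < m 20 (int k) then 1 else 0)"
        by (simp add: upd_apply)
    qed (use m0 in \<open>simp_all add: upd_apply\<close>)
    then show ?thesis by (simp add: members_def card_members upd_apply)
  qed
  define m2 where "m2 = upd (upd m1 32 0 (m1 30 0)) 33 0 (m1 31 0)"
  define copy where "copy = LFor 16 (LIf (Const 0) (at_u 20) (LStore 6 (var 16) (Const 1)) (LStore 6 (var 16) (Const 0)))"
  have "den copy m2 6 (int u) = (if 0 < m 20 (int u) then 1 else 0)" if "u < n" for u
    unfolding copy_def
    by (rule den_for_map) (use m0 f1 that in \<open>auto simp: upd_apply m2_def\<close>)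
  then have out: "output_set n (den copy m2) = ?S" by (auto simp: output_set_def members_def split: if_splits)
  have "den copy m2 a = m2 a" if "a \<in> {32, 33}" for a unfolding copy_def using that by (intro den_frame) auto
  then have copied: "best_state n (den copy m2) = (m 30 0, m 31 0, ?S)"
    using out f1 by (simp add: best_state_def m2_def upd_apply)
  have skipped: "best_state n (upd m1 60 0 0) = best_state n m"
    using f1 by (intro best_state_cong) (simp_all add: upd_def)
  have "den record_set m = (if large (m 0 1) (m 0 2) n ?S \<and> m 32 0 * m 31 0 < m 30 0 * m 33 0
      then den copy m2 else upd m1 60 0 0)"
  proof -
    have eqs: "m1 0 = m 0" "m1 30 = m 30" "m1 31 = m 31" "m1 32 = m 32" "m1 33 = m 33" by (rule f1, simp)+
    show ?thesis
      using 38 m0 by (simp add: record_set_def m1_def[symmetric] m2_def copy_def[symmetric] large_def eqs upd_apply del: den.simps(4))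
  qed
  then show ?thesis using copied skipped by (simp add: update_best_def cut_state_def best_state_def)
qed

lemma den_descend:
  assumes m0: "m 0 0 = int n" and z: "m 12 0 = int z" "z < n"
  shows "members n 20 (den descend m) =
    (if z \<in> members n 22 m then members n 22 m else members n 20 m - members n 22 m)"
proof (cases "z \<in> members n 22 m")
  case True
  have "den (LFor 16 (LStore 20 (var 16) (at_u 22))) m 20 (int u) = m 22 (int u)" if "u < n" for u
    by (rule den_for_map) (use m0 that in \<open>auto simp: upd_apply\<close>)
  moreover have "0 < m 22 (m 12 0)" using True z by (simp add: members_def)
  ultimately show ?thesis using True by (auto simp: descend_def members_def simp del: den.simps(4))
next
  case False
  have "den (LFor 16 (if_pos (at_u 22) (LStore 20 (var 16) (Const 0)))) m 20 (int u) =
      (if 0 < m 22 (int u) then 0 else m 20 (int u))" if "u < n" for u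
    by (rule den_for_map) (use m0 that in \<open>auto simp: upd_apply\<close>)
  moreover have "\<not> 0 < m 22 (m 12 0)" using False z by (simp add: members_def)
  ultimately show ?thesis using False by (auto simp: descend_def members_def simp del: den.simps(4) split: if_splits)
qed

definition window_set :: "nat \<Rightarrow> (nat \<Rightarrow> int) \<Rightarrow> nat \<Rightarrow> nat \<Rightarrow> nat set" where
  "window_set n W p q = {u. u < n \<and> W p \<le> W u \<and> W u \<le> W q}"

lemma den_init_window:
  assumes m0: "m 0 0 = int n" and p: "m 10 0 = int p" and q: "m 11 0 = int q"
  shows "members n 20 (den init_window m) = window_set n (\<lambda>u. m 50 (int u)) p q"
proof -
  have "den init_window m 20 (int u) = (if m 50 (int p) \<le> m 50 (int u) \<and> m 50 (int u) \<le> m 50 (int q) then 1 else 0)" if "u < n" for u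
    unfolding init_window_def by (rule den_for_map) (use m0 p q that in \<open>auto simp: upd_apply\<close>)
  then show ?thesis by (auto simp: members_def window_set_def split: if_splits)
qed

definition split_set :: "nat \<Rightarrow> nat set set \<Rightarrow> nat set \<Rightarrow> nat set" where
  "split_set n E S = snd (snd (best_cut n E S))"

definition branch :: "nat \<Rightarrow> nat set set \<Rightarrow> (nat \<Rightarrow> int) \<Rightarrow> nat \<Rightarrow> nat \<Rightarrow> nat \<Rightarrow> nat set set" where
  "branch n E W p q z = {(side (split_set n E) z ^^ j) (window_set n W p q) |j. j < n}"

lemma den_walk:
  assumes g: "graph_mem n E m" and E: "E \<subseteq> pairs {..<n}"
    and p: "m 10 0 = int p" and q: "m 11 0 = int q" and z: "m 12 0 = int z" "z < n"
    and ok: "best_ok (m 0 1) (m 0 2) n E T (best_state n m)"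
  shows "best_ok (m 0 1) (m 0 2) n E (T \<union> branch n E (\<lambda>u. m 50 (int u)) p q z) (best_state n (den walk m))"
proof -
  let ?W = "\<lambda>u. m 50 (int u)" and ?nx = "side (split_set n E) z"
  define m1 where "m1 = den init_window m"
  have m0: "m 0 0 = int n" using g by (rule graph_mem_size)
  have f1: "m1 a = m a" if "a \<in> {0, 1, 6, 12, 32, 33}" for a
    unfolding m1_def using that by (intro den_frame) (auto simp: init_window_def)
  define P where "P k m' \<longleftrightarrow> members n 20 m' = (?nx ^^ k) (window_set n ?W p q) \<and>
    best_ok (m 0 1) (m 0 2) n E (T \<union> {(?nx ^^ j) (window_set n ?W p q) |j. j < k}) (best_state n m')" for k m'
  have Pupd: "P k (upd m' 13 0 v)" if "P k m'" for k m' v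
  proof -
    have "upd m' 13 0 v a = m' a" if "a \<noteq> 13" for a using that by (simp add: upd_def)
    then show ?thesis using that members_cong[of "upd m' 13 0 v" 20 m' 20 n] best_state_cong[of "upd m' 13 0 v" m' n]
      by (simp add: P_def)
  qed
  have "P n (den (LFor 13 (LSeq find_cut (LSeq record_set descend))) m1)"
  proof (rule den_for_inv[where m = m1 and n = n and P = P])
    show "m1 0 0 = int n" using f1 m0 by simp
    show "13 \<notin> writes (LSeq find_cut (LSeq record_set descend))" by (simp add: program_defs writes_nest)
    have "P 0 m1" using ok den_init_window[where m = m and n = n and p = p and q = q, OF m0 p q] best_state_cong[of m1 m n] f1 by (simp add: P_def m1_def[symmetric])
    then show "P 0 (upd m1 13 0 0)" by (rule Pupd)
    fix k m' assume IH: "P k m'" and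
      fr: "\<And>a. a \<notin> writes (LFor 13 (LSeq find_cut (LSeq record_set descend))) \<Longrightarrow> m' a = m1 a"
    let ?S = "(?nx ^^ k) (window_set n ?W p q)"
    have eq: "m' a = m a" if "a \<in> {0, 1, 12}" for a
      using fr[of a] f1[of a] that by (auto simp: program_defs writes_nest)
    define m2 where "m2 = den find_cut m'"
    define m3 where "m3 = den record_set m2"
    have f2: "m2 a = m' a" if "a \<in> {0, 1, 6, 12, 20, 32, 33}" for a
      unfolding m2_def using that by (intro den_frame) (auto simp: program_defs writes_nest)
    have f3: "m3 a = m2 a" if "a \<in> {0, 12, 20, 22}" for a
      unfolding m3_def using that by (intro den_frame) (auto simp: program_defs)
    have f4: "den descend m3 a = m3 a" if "a \<in> {6, 32, 33}" for a
      using that by (intro den_frame) (auto simp: program_defs)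
    have S: "members n 20 m' = ?S" "members n 20 m2 = ?S" "members n 20 m3 = ?S"
      using IH f2 f3 by (simp_all add: P_def members_def)
    have Sn: "?S \<subseteq> {..<n}" unfolding S(1)[symmetric] by (rule members_subset)
    have "graph_mem n E m'" using g eq graph_mem_cong[of m' m n E] by simp
    then have cs: "cut_state n m2 = best_cut n E ?S" using den_find_cut[OF _ E, of m'] S by (simp add: m2_def)
    have "best_state n m3 = update_best (m2 0 1) (m2 0 2) n ?S (best_cut n E ?S) (best_state n m2)"
      using den_record_set[of m2 n] eq f2 m0 S cs by (simp add: m3_def)
    also have "best_state n m2 = best_state n m'" using f2 by (intro best_state_cong) simp_all
    finally have bs: "best_state n m3 = update_best (m 0 1) (m 0 2) n ?S (best_cut n E ?S) (best_state n m')"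
      using f2 eq by simp
    have ins: "T \<union> {(?nx ^^ j) (window_set n ?W p q) |j. j < Suc k} = insert ?S (T \<union> {(?nx ^^ j) (window_set n ?W p q) |j. j < k})"
      by (auto simp: less_Suc_eq)
    have "best_ok (m 0 1) (m 0 2) n E (T \<union> {(?nx ^^ j) (window_set n ?W p q) |j. j < Suc k}) (best_state n m3)"
      unfolding ins bs using IH Sn by (intro best_ok_update) (auto simp: P_def)
    moreover have "best_state n (den descend m3) = best_state n m3" using f4 by (intro best_state_cong) simp_all
    moreover have "members n 20 (den descend m3) = (?nx ^^ Suc k) (window_set n ?W p q)"
    proof -
      have "members n 22 m3 = members n 22 m2" using f3 by (simp add: members_def)
      also have "\<dots> = split_set n E ?S" using cs by (simp add: cut_state_def split_set_def) (metis snd_conv)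
      finally have "members n 22 m3 = split_set n E ?S" .
      moreover have "m3 0 0 = int n" "m3 12 0 = int z" using f3 f2 eq m0 z by simp_all
      ultimately show ?thesis using den_descend[of m3 n z] z(2) S by (simp add: side_def)
    qed
    ultimately have "P (Suc k) (den descend m3)" by (simp only: P_def)
    then have "P (Suc k) (upd (den descend m3) 13 0 (int (Suc k)))" by (rule Pupd)
    then show "P (Suc k) (upd (den (LSeq find_cut (LSeq record_set descend)) m') 13 0 (int (Suc k)))"
      by (simp only: den.simps m2_def m3_def)
  qed
  then show ?thesis by (simp only: walk_def den.simps(2) m1_def P_def branch_def)
qed

lemma walk_frame: "a \<in> {0, 1, 10, 11, 12, 50} \<Longrightarrow> a \<notin> writes walk"
  by (auto simp: program_defs writes_nest)

text \<open>The family \<open>T\<close> of sets seen so far is arbitrary in the premise on a round,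
  so the rule can be applied to each of the three nested loops in turn.\<close>

lemma den_for_best_ok:
  assumes m0: "m 0 0 = int n" and U: "U \<notin> writes c" "U \<notin> {6, 32, 33}"
    and ok: "best_ok nu de n E T (best_state n m)"
    and step: "\<And>k m' T. k < n \<Longrightarrow> m' U 0 = int k \<Longrightarrow> (\<And>a. a \<notin> writes (LFor U c) \<Longrightarrow> m' a = m a) \<Longrightarrow>
      best_ok nu de n E T (best_state n m') \<Longrightarrow> best_ok nu de n E (T \<union> f k) (best_state n (den c m'))"
  shows "best_ok nu de n E (T \<union> (\<Union>k<n. f k)) (best_state n (den (LFor U c) m))"
proof (rule den_for_inv[where m = m and n = n and
      P = "\<lambda>k m'. best_ok nu de n E (T \<union> (\<Union>l<k. f l)) (best_state n m')", OF m0 U(1)])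
  have st: "best_state n (upd m' U 0 v) = best_state n m'" for m' v
    using U(2) by (intro best_state_cong) (simp_all add: upd_def)
  show "best_ok nu de n E (T \<union> (\<Union>l<0. f l)) (best_state n (upd m U 0 0))" using ok by (simp add: st)
  fix k m' assume "k < n" "best_ok nu de n E (T \<union> (\<Union>l<k. f l)) (best_state n m')" "m' U 0 = int k"
    "\<And>a. a \<notin> writes (LFor U c) \<Longrightarrow> m' a = m a"
  then have "best_ok nu de n E (T \<union> (\<Union>l<k. f l) \<union> f k) (best_state n (den c m'))" by (intro step)
  then show "best_ok nu de n E (T \<union> (\<Union>l<Suc k. f l)) (best_state n (upd (den c m') U 0 (int (Suc k))))"
    unfolding st by (simp add: lessThan_Suc Un_commute Un_left_commute)
qed

lemma den_walks:
  assumes g: "graph_mem n E m" and E: "E \<subseteq> pairs {..<n}"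
    and ok: "best_ok (m 0 1) (m 0 2) n E {} (best_state n m)"
  shows "best_ok (m 0 1) (m 0 2) n E (\<Union>p<n. \<Union>q<n. \<Union>z<n. branch n E (\<lambda>u. m 50 (int u)) p q z)
    (best_state n (den (LFor 10 (LFor 11 (LFor 12 walk))) m))"
proof -
  let ?W = "\<lambda>u. m 50 (int u)" and ?ok = "best_ok (m 0 1) (m 0 2) n E"
  have m0: "m 0 0 = int n" using g by (rule graph_mem_size)
  have keep: "a \<notin> writes walk" if "a \<in> {0, 1, 10, 11, 12, 50}" for a using walk_frame[OF that] .
  have "?ok ({} \<union> (\<Union>p<n. \<Union>q<n. \<Union>z<n. branch n E ?W p q z)) (best_state n (den (LFor 10 (LFor 11 (LFor 12 walk))) m))"
  proof (rule den_for_best_ok[OF m0 _ _ ok])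
    show "10 \<notin> writes (LFor 11 (LFor 12 walk))" using keep by simp
    fix p m1 T1 assume p: "m1 10 0 = int p" and fr1: "\<And>a. a \<notin> writes (LFor 10 (LFor 11 (LFor 12 walk))) \<Longrightarrow> m1 a = m a"
      and ok1: "?ok T1 (best_state n m1)"
    have eq1: "m1 a = m a" if "a \<in> {0, 1, 50}" for a using that keep[of a] by (intro fr1) auto
    show "?ok (T1 \<union> (\<Union>q<n. \<Union>z<n. branch n E ?W p q z)) (best_state n (den (LFor 11 (LFor 12 walk)) m1))"
    proof (rule den_for_best_ok[OF _ _ _ ok1])
      show "m1 0 0 = int n" using eq1 m0 by simp
      show "11 \<notin> writes (LFor 12 walk)" using keep by simp
      fix q m2 T2 assume q: "m2 11 0 = int q" and fr2: "\<And>a. a \<notin> writes (LFor 11 (LFor 12 walk)) \<Longrightarrow> m2 a = m1 a"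
        and ok2: "?ok T2 (best_state n m2)"
      have eq2: "m2 a = m1 a" if "a \<in> {0, 1, 10, 50}" for a using that keep[of a] by (intro fr2) auto
      show "?ok (T2 \<union> (\<Union>z<n. branch n E ?W p q z)) (best_state n (den (LFor 12 walk) m2))"
      proof (rule den_for_best_ok[OF _ _ _ ok2])
        show "m2 0 0 = int n" using eq1 eq2 m0 by simp
        show "12 \<notin> writes walk" using keep by simp
        fix z m3 T3 assume z: "z < n" "m3 12 0 = int z" and fr3: "\<And>a. a \<notin> writes (LFor 12 walk) \<Longrightarrow> m3 a = m2 a"
          and ok3: "?ok T3 (best_state n m3)"
        have eq3: "m3 a = m2 a" if "a \<in> {0, 1, 10, 11, 50}" for a using that keep[of a] by (intro fr3) auto
        have eq: "m3 0 = m 0" "m3 1 = m 1" "m3 50 = m 50" using eq1 eq2 eq3 by simp_all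
        have "graph_mem n E m3" using g eq graph_mem_cong[of m3 m n E] by simp
        moreover have "m3 10 0 = int p" "m3 11 0 = int q" using p q eq2 eq3 by simp_all
        ultimately show "?ok (T3 \<union> branch n E ?W p q z) (best_state n (den walk m3))"
          using den_walk[where m = m3 and n = n and E = E and p = p and q = q and z = z and T = T3] E z ok3
          unfolding eq by blast
      qed simp
    qed simp
  qed simp
  then show ?thesis by (simp only: Un_empty_left)
qed

section \<open>Clearing the denominators of the weights\<close>

lemma den_common_denominator:
  assumes m0: "m 0 0 = int n"
  shows "0 < den common_denominator m 51 0"
    "\<And>u w. u < n \<Longrightarrow> w < n \<Longrightarrow> 0 < m 5 (int u * int n + int w) \<Longrightarrow>
      m 5 (int u * int n + int w) dvd den common_denominator m 51 0"
proof -
  let ?d = "\<lambda>u w. m 5 (int u * int n + int w)"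
  define c where "c = if_pos (at_uw 5) (LStore 51 (Const 0) (Mul (var 51) (at_uw 5)))"
  have wr: "writes c = {51, 60}" by (auto simp: c_def)
  \<comment> \<open>That the old value divides the new one preserves the divisibility obtained in
    earlier rows.\<close>
  have row: "m' 51 0 dvd den (LFor 17 c) m' 51 0 \<and> 0 < den (LFor 17 c) m' 51 0 \<and>
      (\<forall>w<n. 0 < ?d u w \<longrightarrow> ?d u w dvd den (LFor 17 c) m' 51 0)"
    if "m' 0 = m 0" "m' 5 = m 5" "m' 16 0 = int u" "0 < m' 51 0" for m' u
  proof (rule den_for_inv[where m = m' and n = n and P = "\<lambda>k m''. m' 51 0 dvd m'' 51 0 \<and> 0 < m'' 51 0 \<and> (\<forall>w<k. 0 < ?d u w \<longrightarrow> ?d u w dvd m'' 51 0)"])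
    show "m' 0 0 = int n" using that m0 by simp
    show "17 \<notin> writes c" by (simp add: wr)
    show "m' 51 0 dvd upd m' 17 0 0 51 0 \<and> 0 < upd m' 17 0 0 51 0 \<and> (\<forall>w<0. 0 < ?d u w \<longrightarrow> ?d u w dvd upd m' 17 0 0 51 0)"
      using that by (simp add: upd_apply)
    fix k m'' assume IH: "m' 51 0 dvd m'' 51 0 \<and> 0 < m'' 51 0 \<and> (\<forall>w<k. 0 < ?d u w \<longrightarrow> ?d u w dvd m'' 51 0)"
      and k: "m'' 17 0 = int k" and fr: "\<And>a. a \<notin> writes (LFor 17 c) \<Longrightarrow> m'' a = m' a"
    have eq: "m'' 0 = m 0" "m'' 5 = m 5" "m'' 16 = m' 16" using fr[of 0] fr[of 5] fr[of 16] that by (auto simp: wr)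
    have "den c m'' 51 0 = m'' 51 0 * (if 0 < ?d u k then ?d u k else 1)"
      using eq k m0 that by (simp add: c_def upd_apply)
    then show "m' 51 0 dvd upd (den c m'') 17 0 (int (Suc k)) 51 0 \<and> 0 < upd (den c m'') 17 0 (int (Suc k)) 51 0 \<and>
        (\<forall>w<Suc k. 0 < ?d u w \<longrightarrow> ?d u w dvd upd (den c m'') 17 0 (int (Suc k)) 51 0)"
      using IH by (auto simp: upd_apply less_Suc_eq)
  qed
  let ?m = "upd m 51 0 1"
  have "0 < den (LFor 16 (LFor 17 c)) ?m 51 0 \<and> (\<forall>u<n. \<forall>w<n. 0 < ?d u w \<longrightarrow> ?d u w dvd den (LFor 16 (LFor 17 c)) ?m 51 0)"
  proof (rule den_for_inv[where m = ?m and n = n and P = "\<lambda>k m''. 0 < m'' 51 0 \<and> (\<forall>u<k. \<forall>w<n. 0 < ?d u w \<longrightarrow> ?d u w dvd m'' 51 0)"])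
    show "?m 0 0 = int n" using m0 by (simp add: upd_apply)
    show "16 \<notin> writes (LFor 17 c)" by (simp add: wr)
    show "0 < upd ?m 16 0 0 51 0 \<and> (\<forall>u<0. \<forall>w<n. 0 < ?d u w \<longrightarrow> ?d u w dvd upd ?m 16 0 0 51 0)"
      by (simp add: upd_apply)
    fix k m' assume IH: "0 < m' 51 0 \<and> (\<forall>u<k. \<forall>w<n. 0 < ?d u w \<longrightarrow> ?d u w dvd m' 51 0)"
      and k: "m' 16 0 = int k" and fr: "\<And>a. a \<notin> writes (LFor 16 (LFor 17 c)) \<Longrightarrow> m' a = ?m a"
    have "m' 0 = m 0" "m' 5 = m 5" using fr[of 0] fr[of 5] by (auto simp: wr upd_def)
    note row[OF this k]
    then show "0 < upd (den (LFor 17 c) m') 16 0 (int (Suc k)) 51 0 \<and>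
        (\<forall>u<Suc k. \<forall>w<n. 0 < ?d u w \<longrightarrow> ?d u w dvd upd (den (LFor 17 c) m') 16 0 (int (Suc k)) 51 0)"
      using IH by (auto simp: upd_apply less_Suc_eq simp del: den.simps intro: dvd_trans)
  qed
  moreover have "den common_denominator m = den (LFor 16 (LFor 17 c)) ?m"
    by (simp only: common_denominator_def c_def den.simps aval.simps)
  ultimately show "0 < den common_denominator m 51 0"
    "\<And>u w. u < n \<Longrightarrow> w < n \<Longrightarrow> 0 < ?d u w \<Longrightarrow> ?d u w dvd den common_denominator m 51 0"
    by simp_all
qed

lemma den_scaled_weights:
  assumes m0: "m 0 0 = int n" and u: "u < n"
  shows "den scaled_weights m 50 (int u) = (\<Sum>w<n. if 0 < m 5 (int u * int n + int w)
    then m 51 0 div m 5 (int u * int n + int w) * m 4 (int u * int n + int w) else 0)"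
proof -
  define g where "g u w = (if 0 < m 5 (int u * int n + int w)
    then m 51 0 div m 5 (int u * int n + int w) * m 4 (int u * int n + int w) else 0)" for u w :: nat
  define c where "c = if_pos (at_uw 5) (LStore 50 (var 16) (Add (at_u 50) (Mul (Div (var 51) (at_uw 5)) (at_uw 4))))"
  have wr: "writes c = {50, 60}" by (auto simp: c_def)
  have inner: "den (LFor 17 c) m' 50 (int l) = m' 50 (int l) + (\<Sum>w<n. if l = k then g k w else 0)"
    if eq: "m' 0 = m 0" "m' 5 = m 5" "m' 4 = m 4" "m' 51 = m 51" and k: "m' 16 0 = int k" for m' k l
  proof (rule den_for_sum)
    show "m' 0 0 = int n" using eq m0 by simp
    fix w m'' assume w: "m'' 17 0 = int w" and fr: "\<And>a. a \<notin> writes (LFor 17 c) \<Longrightarrow> m'' a = m' a"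
    have "m'' 0 = m 0" "m'' 5 = m 5" "m'' 4 = m 4" "m'' 51 = m 51" "m'' 16 = m' 16"
      using fr[of 0] fr[of 5] fr[of 4] fr[of 51] fr[of 16] eq by (auto simp: wr)
    then show "den c m'' 50 (int l) = m'' 50 (int l) + (if l = k then g k w else 0)"
      using w k m0 by (simp add: c_def upd_apply g_def)
  qed (simp_all add: wr)
  have "den (LFor 16 (LSeq (LStore 50 (var 16) (Const 0)) (LFor 17 c))) m 50 (int u) = (\<Sum>w<n. g u w)"
  proof (rule den_for_map[where g = "\<lambda>u. \<Sum>w<n. g u w"])
    fix k l m' assume k: "m' 16 0 = int k" and fr: "\<And>a. a \<notin> writes (LFor 16 (LSeq (LStore 50 (var 16) (Const 0)) (LFor 17 c))) \<Longrightarrow> m' a = m a"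
    have eq: "upd m' 50 (int k) 0 0 = m 0" "upd m' 50 (int k) 0 5 = m 5" "upd m' 50 (int k) 0 4 = m 4"
      "upd m' 50 (int k) 0 51 = m 51" "upd m' 50 (int k) 0 16 0 = int k"
      using fr[of 0] fr[of 5] fr[of 4] fr[of 51] k by (auto simp: wr upd_def)
    note inner[OF eq]
    then have val: "den (LSeq (LStore 50 (var 16) (Const 0)) (LFor 17 c)) m' 50 (int l) =
        upd m' 50 (int k) 0 50 (int l) + (\<Sum>w<n. if l = k then g k w else 0)" for l
      using k by (simp del: den.simps(4))
    show "den (LSeq (LStore 50 (var 16) (Const 0)) (LFor 17 c)) m' 50 (int k) = (\<Sum>w<n. g k w)"
      unfolding val by (simp add: upd_apply)
    show "den (LSeq (LStore 50 (var 16) (Const 0)) (LFor 17 c)) m' 50 (int l) = m' 50 (int l)" if "l \<noteq> k"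
      unfolding val using that by (simp add: upd_apply)
  qed (use m0 u in \<open>simp_all add: wr\<close>)
  then show ?thesis by (simp only: scaled_weights_def c_def[symmetric] g_def)
qed

lemma pair_array_at:
  assumes "u < n" "w < n"
  shows "pair_array n F f d (int u * int n + int w) = (if {u, w} \<in> F then f {u, w} else d)"
proof -
  have i: "nat (int u * int n + int w) = u * n + w" by (simp add: nat_add_distrib nat_mult_distrib)
  have "u * n + w < n * n"
  proof -
    have "Suc u * n \<le> n * n" using assms by (intro mult_right_mono) auto
    then show ?thesis using assms by simp
  qed
  then have "int u * int n + int w < int n * int n" by (metis of_nat_add of_nat_less_iff of_nat_mult)
  then show ?thesis unfolding pair_array_def i using assms by simp
qed

lemma numer_denom: "of_rat q = real_of_int (numer q) / real_of_int (denom q)" "0 < denom q"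
proof -
  obtain a b where ab: "quotient_of q = (a, b)" by (cases "quotient_of q")
  show "0 < denom q" using quotient_of_denom_pos[OF ab] by (simp add: denom_def ab)
  have "q = of_int a / of_int b" by (rule quotient_of_div[OF ab])
  then have "of_rat q = (of_rat (of_int a / of_int b) :: real)" by simp
  then show "of_rat q = real_of_int (numer q) / real_of_int (denom q)"
    by (simp add: numer_def denom_def ab of_rat_divide)
qed

text \<open>The integer iteration is exact, so its sweep cuts are those of the real vectors in the
  spectral argument.\<close>

lemma shift_op_pow_of_int:
  "real_of_int ((shift_op S F d ^^ k) v u) =
    (shift_op S F (real_of_int d) ^^ k) (\<lambda>u. real_of_int (v u)) u"
proof (induction k arbitrary: u)
  case (Suc k)
  then show ?case by (simp add: shift_op_def)
qed simp

text \<open>The threshold occurs in the proof only. Some branch contains a large set whose sweep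
  cuts all have density at least the threshold, so the recorded maximum has this property as well.
  \<open>W\<close> may be any integer function that orders the vertices like
  \<open>weight\<close>.\<close>

lemma (in sdp_solution) good_set_if_best_ok:
  assumes \<delta>q: "\<delta> = real_of_int nu / real_of_int de" "0 < de"
    and order: "\<And>u w. u < n \<Longrightarrow> w < n \<Longrightarrow> W u \<le> W w \<longleftrightarrow> weight u \<le> weight w"
    and ok: "best_ok nu de n E (\<Union>p<n. \<Union>q<n. \<Union>z<n. branch n E W p q z) (ge, gb, R)"
  shows "good_set (1 / 147456) 65 n E \<Delta> \<delta> lam R"
proof -
  let ?h = "threshold \<Delta> lam \<delta>"
  have h: "0 < ?h" by (rule threshold_pos)
  have large: "large nu de n S \<longleftrightarrow> 2 \<le> card S \<and> 3 * \<delta> * n / 8 \<le> card S" for S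
  proof -
    have "3 * nu * int n \<le> 8 * de * int (card S) \<longleftrightarrow> real_of_int (3 * nu * int n) \<le> real_of_int (8 * de * int (card S))"
      by (simp only: of_int_le_iff)
    also have "\<dots> \<longleftrightarrow> 3 * \<delta> * n / 8 \<le> card S" unfolding \<delta>q(1) using \<delta>q(2) by (simp add: field_simps)
    finally show ?thesis by (auto simp: large_def not_less)
  qed
  \<comment> \<open>Stopping when the best sweep cut is dense. If it is not, that very cut is sparse
    and is the one along which the program descends.\<close>
  define Q where "Q S \<longleftrightarrow> (\<exists>e b C. best_cut n E S = (e, b, C) \<and> ?h * b \<le> e)" for S
  have cuts: "split_set n E S \<subseteq> S \<and> \<not> expanding E ?h S (split_set n E S)" if "\<not> Q S" for S
  proof -
    obtain e b C where cs: "best_cut n E S = (e, b, C)" by (cases "best_cut n E S")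
    then have less: "real_of_int e < ?h * b" using that by (auto simp: Q_def not_le)
    have "\<not> (b = 0 \<and> e = 1)" using less by auto
    then have "C \<subseteq> S" "e = cut_size E S C" "b = small_side S C"
      using cut_ok_best_cut[of E S n] by (auto simp: cut_ok_def cs)
    then show ?thesis using less by (simp add: split_set_def cs expanding_def cut_size_def small_side_def)
  qed
  obtain p q z j S where w: "p < n" "q < n" "z < n" "j < n"
    "S = (side (split_set n E) z ^^ j) {u. u < n \<and> weight p \<le> weight u \<and> weight u \<le> weight q}"
    "S \<subseteq> {..<n}" "2 \<le> card S" "3 * \<delta> * n / 8 \<le> card S" "Q S"
    by (rule window_walk[of Q "split_set n E", OF cuts])
  have win: "window_set n W p q = {u. u < n \<and> weight p \<le> weight u \<and> weight u \<le> weight q}"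
    unfolding window_set_def using order w(1,2) by auto
  have "S \<in> branch n E W p q z" unfolding branch_def win using w(4,5) by blast
  then have mem: "S \<in> (\<Union>p<n. \<Union>q<n. \<Union>z<n. branch n E W p q z)" using w(1-3) by blast
  obtain e b C where cs: "best_cut n E S = (e, b, C)" "?h * b \<le> e" using w(9) by (auto simp: Q_def)
  note val = best_cut_valid[OF cs(1)]
  have le: "e * gb \<le> ge * b" using ok mem cs(1) w(7,8) large[of S] by (auto simp: best_ok_def)
  \<comment> \<open>A positive density on a branch excludes that the output is still the initial
    record 0 / 1.\<close>
  have epos: "0 < e"
  proof (cases "b = 0")
    case False
    then have "0 < ?h * b" using val(2) h by simp
    then show ?thesis using cs(2) by linarith
  qed (use val(3) in simp)
  have "\<not> (ge = 0 \<and> gb = 1)" using le epos by auto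
  then obtain C' where R: "R \<subseteq> {..<n}" "large nu de n R" "best_cut n E R = (ge, gb, C')"
    using ok by (auto simp: best_ok_def)
  note valR = best_cut_valid[OF R(3)]
  \<comment> \<open>If the set on the branch has infinite density 1 / 0, the recorded one must be
    infinite too; otherwise the comparison can be divided by \<open>b\<close>.\<close>
  have ratio: "?h * gb \<le> ge"
  proof (cases "b = 0")
    case True
    then have "e * gb \<le> 0" using le by simp
    then have "gb = 0" using epos valR(2) by (simp add: mult_le_0_iff)
    then show ?thesis using valR(1) by simp
  next
    case False
    then have b: "0 < real_of_int b" using val(2) by simp
    have "(?h * b) * gb \<le> real_of_int e * real_of_int gb" using cs(2) valR(2) by (intro mult_right_mono) auto
    also have "\<dots> \<le> real_of_int ge * real_of_int b" using le unfolding of_int_mult[symmetric] of_int_le_iff .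
    finally have "(?h * gb) * b \<le> real_of_int ge * b" by (simp add: mult_ac)
    then show ?thesis using b by simp
  qed
  show ?thesis
  proof (rule good_set_if_sweeps_expand)
    show "R \<subseteq> {..<n}" "2 \<le> card R" "3 * \<delta> * n / 8 \<le> card R" using R large[of R] by auto
    fix i j v assume ij: "i \<in> R" "j \<in> R"
      and v: "v = (shift_op R (induced_edges E R) (2 * real n + 1) ^^ (n ^ 6)) (\<lambda>u. if u = i then 1 else 0)"
    have "v u = real_of_int (iterated_vec n E R i u)" for u
    proof -
      have "(\<lambda>u. real_of_int (if u = i then 1 else 0)) = (\<lambda>u. if u = i then 1 else 0)" by (rule ext) simp
      then show ?thesis unfolding v iterated_vec_def shift_op_pow_of_int by simp
    qed
    then have sw: "sweep R v j = sweep R (iterated_vec n E R i) j" by simp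
    have "\<exists>i' j'. sweep R v j = sweep R (iterated_vec n E R i') j' \<and> i' < n \<and> j' < n"
      unfolding sw using ij R(1) by (intro exI[of _ i] exI[of _ j]) auto
    then have mem': "sweep R v j \<in> {sweep R (iterated_vec n E R i) j |i j. i < n \<and> j < n}" by (rule CollectI)
    have all: "\<forall>A\<in>{sweep R (iterated_vec n E R i) j |i j. i < n \<and> j < n}. ge * small_side R A \<le> cut_size E R A * gb"
      using cut_ok_best_cut[of E R n] unfolding cut_ok_def R(3) prod.case by (rule conjunct2)
    have c: "ge * small_side R (sweep R v j) \<le> cut_size E R (sweep R v j) * gb" by (rule bspec[OF all mem'])
    let ?s = "real_of_int (small_side R (sweep R v j))" and ?c = "real_of_int (cut_size E R (sweep R v j))"
    have c': "real_of_int ge * ?s \<le> ?c * real_of_int gb" using c unfolding of_int_mult[symmetric] of_int_le_iff .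
    have "?h * ?s \<le> ?c"
    proof (cases "gb = 0")
      case True
      then have "?s = 0" using valR(3) c small_side_nonneg[of R "sweep R v j"] by simp
      then show ?thesis using cut_size_nonneg[of E R "sweep R v j"] by simp
    next
      case False
      then have gb: "0 < real_of_int gb" using valR(2) by simp
      have "(?h * gb) * ?s \<le> real_of_int ge * ?s" using ratio small_side_nonneg by (intro mult_right_mono) auto
      also have "\<dots> \<le> ?c * gb" by (rule c')
      finally have "(?h * ?s) * gb \<le> ?c * gb" by (simp add: mult_ac)
      then show ?thesis using gb by simp
    qed
    then show "expanding E ?h R (sweep R v j)" by (simp add: expanding_def small_side_def cut_size_def)
  qed
qed

text \<open>After scaling, array 50 holds a positive multiple of the weights, hence their exact
  order, and this is all that the windows depend on.\<close>

lemma main_program_correct: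
  fixes x y :: "nat set \<Rightarrow> rat"
  assumes reg: "regular_graph n E \<Delta>" and pos: "\<delta> > 0" "lam > 0"
    and feas: "sdp_feasible n E (of_rat \<delta>) (of_rat lam) (\<lambda>e. of_rat (x e)) (\<lambda>q. of_rat (y q))"
  shows "good_set (1 / 147456) 65 n E \<Delta> (of_rat \<delta>) (of_rat lam)
    (output_set n (den main_program (input_memory n E \<delta> lam x y)))"
proof -
  interpret sdp_solution n E \<Delta> "of_rat \<delta>" "of_rat lam" "\<lambda>e. of_rat (x e)" "\<lambda>q. of_rat (y q)"
    by unfold_locales (use reg pos feas in simp_all)
  define m where "m = input_memory n E \<delta> lam x y"
  define m1 where "m1 = den common_denominator m"
  define m2 where "m2 = den scaled_weights m1"
  define m3 where "m3 = upd (upd m2 32 0 0) 33 0 1"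
  have inp: "m 0 0 = int n" "m 0 1 = numer \<delta>" "m 0 2 = denom \<delta>" "m 1 = pair_array n E (\<lambda>_. 1) 0"
    "m 4 = pair_array n (pairs {..<n}) (\<lambda>p. numer (y p)) 0" "m 5 = pair_array n (pairs {..<n}) (\<lambda>p. denom (y p)) 0"
    by (simp_all add: m_def input_memory_def)
  have f1: "m1 a = m a" if "a < 6" for a
    unfolding m1_def using that by (intro den_frame) (auto simp: program_defs)
  have f2: "m2 a = m1 a" if "a < 6" for a
    unfolding m2_def using that by (intro den_frame) (auto simp: program_defs)
  have f3: "m3 a = m2 a" if "a \<noteq> 32" "a \<noteq> 33" for a using that by (simp add: m3_def upd_def)
  have in3: "m3 a = m a" if "a < 6" for a using f1 f2 f3 that by simp
  let ?D = "m1 51 0" and ?d = "\<lambda>u w. m 5 (int u * int n + int w)"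
  have D: "0 < ?D" and dvd: "\<And>u w. u < n \<Longrightarrow> w < n \<Longrightarrow> 0 < ?d u w \<Longrightarrow> ?d u w dvd ?D"
    using den_common_denominator[of m n] inp(1) by (auto simp: m1_def)
  have W: "real_of_int (m3 50 (int u)) = ?D * weight u" if u: "u < n" for u
  proof -
    have "m3 50 (int u) = (\<Sum>w<n. if 0 < ?d u w then ?D div ?d u w * m 4 (int u * int n + int w) else 0)"
    proof -
      have eqs: "m1 0 = m 0" "m1 4 = m 4" "m1 5 = m 5" by (rule f1, simp)+
      have "m3 50 (int u) = den scaled_weights m1 50 (int u)" using f3 by (simp add: m2_def)
      then show ?thesis using den_scaled_weights[of m1 n u] inp(1) u unfolding eqs by simp
    qed
    also have "real_of_int \<dots> = (\<Sum>w<n. if w \<noteq> u then ?D * of_rat (y {u, w}) else 0)"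
      unfolding of_int_sum
    proof (rule sum.cong[OF refl])
      fix w assume "w \<in> {..<n}"
      then have w: "w < n" by simp
      show "real_of_int (if 0 < ?d u w then ?D div ?d u w * m 4 (int u * int n + int w) else 0) =
          (if w \<noteq> u then ?D * of_rat (y {u, w}) else 0)"
      proof (cases "w = u")
        \<comment> \<open>The diagonal entry of the denominators is the default 0, because a
          singleton is not a pair, and so the summand is skipped.\<close>
        case True
        then show ?thesis using u by (simp add: inp(6) pair_array_at pairs_def)
      next
        case False
        then have p: "{u, w} \<in> pairs {..<n}" using u w by (simp add: pairs_def)
        have d: "?d u w = denom (y {u, w})" "m 4 (int u * int n + int w) = numer (y {u, w})"
          using p by (simp_all add: inp(5,6) pair_array_at[OF u w])
        have pos: "0 < ?d u w" using d(1) numer_denom(2) by simp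
        have "real_of_int (?D div ?d u w) = ?D / ?d u w" using dvd[OF u w pos] by (rule real_of_int_div)
        then show ?thesis using False pos d numer_denom(1)[of "y {u, w}"] by simp
      qed
    qed
    also have "\<dots> = (\<Sum>w | w \<in> {..<n} \<and> w \<noteq> u. ?D * of_rat (y {u, w}))"
      by (rule sum.inter_filter[symmetric]) simp
    also have "{w. w \<in> {..<n} \<and> w \<noteq> u} = {..<n} - {u}" by auto
    finally show ?thesis by (simp add: weight_def sum_distrib_left)
  qed
  have order: "m3 50 (int u) \<le> m3 50 (int w) \<longleftrightarrow> weight u \<le> weight w" if "u < n" "w < n" for u w
  proof -
    have "m3 50 (int u) \<le> m3 50 (int w) \<longleftrightarrow> real_of_int ?D * weight u \<le> real_of_int ?D * weight w"
      unfolding W[OF that(1), symmetric] W[OF that(2), symmetric] by simp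
    then show ?thesis using D by simp
  qed
  have g: "graph_mem n E m3" using in3 inp(1,4) by (simp add: graph_mem_def pair_array_at)
  have "best_state n m3 = (0, 1, output_set n m3)" by (simp add: best_state_def m3_def upd_apply)
  then have "best_ok (m3 0 1) (m3 0 2) n E {} (best_state n m3)" by (simp add: best_ok_def)
  from den_walks[OF g E_pairs this]
  have ok: "best_ok (numer \<delta>) (denom \<delta>) n E (\<Union>p<n. \<Union>q<n. \<Union>z<n. branch n E (\<lambda>u. m3 50 (int u)) p q z)
      (best_state n (den (LFor 10 (LFor 11 (LFor 12 walk))) m3))"
    using in3 inp by simp
  have "den main_program m = den (LFor 10 (LFor 11 (LFor 12 walk))) m3"
    by (simp only: main_program_def den.simps(1,2) aval.simps m1_def m2_def m3_def)
  with ok have "best_ok (numer \<delta>) (denom \<delta>) n E (\<Union>p<n. \<Union>q<n. \<Union>z<n. branch n E (\<lambda>u. m3 50 (int u)) p q z)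
      (den main_program m 32 0, den main_program m 33 0, output_set n (den main_program m))"
    by (simp only: best_state_def)
  from good_set_if_best_ok[OF numer_denom order this]
  show ?thesis by (simp only: m_def)
qed

theorem theorem1p4:
  shows "\<exists>c > 0. \<exists>C > 0.
    (\<forall>(n :: nat) E \<Delta> (\<delta> :: real) (lam :: real) (x :: nat set \<Rightarrow> real) (y :: nat set \<Rightarrow> real).
       regular_graph n E \<Delta> \<and> \<delta> > 0 \<and> lam > 0 \<and> sdp_feasible n E \<delta> lam x y \<longrightarrow>
       (\<exists>S. good_set c C n E \<Delta> \<delta> lam S)) \<and>
    (\<exists>(P :: com) (p :: nat poly).
       \<forall>(n :: nat) E \<Delta> (\<delta> :: rat) (lam :: rat) (x :: nat set \<Rightarrow> rat) (y :: nat set \<Rightarrow> rat).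
         regular_graph n E \<Delta> \<and> \<delta> > 0 \<and> lam > 0 \<and>
         sdp_feasible n E (of_rat \<delta>) (of_rat lam) (\<lambda>e. of_rat (x e)) (\<lambda>q. of_rat (y q)) \<longrightarrow>
         (\<exists>t m. exec P (input_memory n E \<delta> lam x y) t m \<and>
                t \<le> poly p (input_size n E \<delta> lam x y) \<and>
                good_set c C n E \<Delta> (of_rat \<delta>) (of_rat lam) (output_set n m)))"
proof (rule exI[of _ "1 / 147456"], rule conjI, simp, rule exI[of _ 65], intro conjI allI impI)
  show "(0 :: real) < 65" by simp
next
  fix n E \<Delta> and \<delta> lam :: real and x y :: "nat set \<Rightarrow> real"
  assume "regular_graph n E \<Delta> \<and> \<delta> > 0 \<and> lam > 0 \<and> sdp_feasible n E \<delta> lam x y"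
  then interpret sdp_solution n E \<Delta> \<delta> lam x y by unfold_locales auto
  show "\<exists>S. good_set (1 / 147456) 65 n E \<Delta> \<delta> lam S" by (rule good_set_exists)
next
  obtain p :: "nat poly" where p: "\<And>n E \<delta> lam x y. \<exists>t.
      exec (compile main_program) (input_memory n E \<delta> lam x y) t (den main_program (input_memory n E \<delta> lam x y)) \<and>
      t \<le> poly p (input_size n E \<delta> lam x y)"
    using polynomial_time[OF well_formed_main] by blast
  show "\<exists>(P :: com) (p :: nat poly).
       \<forall>(n :: nat) E \<Delta> (\<delta> :: rat) (lam :: rat) (x :: nat set \<Rightarrow> rat) (y :: nat set \<Rightarrow> rat).
         regular_graph n E \<Delta> \<and> \<delta> > 0 \<and> lam > 0 \<and>
         sdp_feasible n E (of_rat \<delta>) (of_rat lam) (\<lambda>e. of_rat (x e)) (\<lambda>q. of_rat (y q)) \<longrightarrow>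
         (\<exists>t m. exec P (input_memory n E \<delta> lam x y) t m \<and>
                t \<le> poly p (input_size n E \<delta> lam x y) \<and>
                good_set (1 / 147456) 65 n E \<Delta> (of_rat \<delta>) (of_rat lam) (output_set n m))"
  proof (rule exI[of _ "compile main_program"], rule exI[of _ p], intro allI impI)
    fix n E \<Delta> and \<delta> lam :: rat and x y :: "nat set \<Rightarrow> rat"
    assume a: "regular_graph n E \<Delta> \<and> \<delta> > 0 \<and> lam > 0 \<and>
      sdp_feasible n E (of_rat \<delta>) (of_rat lam) (\<lambda>e. of_rat (x e)) (\<lambda>q. of_rat (y q))"
    let ?m = "input_memory n E \<delta> lam x y"
    obtain t where t: "exec (compile main_program) ?m t (den main_program ?m)"
      "t \<le> poly p (input_size n E \<delta> lam x y)"
      using p[of n E \<delta> lam x y] by blast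
    have "good_set (1 / 147456) 65 n E \<Delta> (of_rat \<delta>) (of_rat lam) (output_set n (den main_program ?m))"
      using a by (intro main_program_correct) auto
    with t show "\<exists>t m. exec (compile main_program) ?m t m \<and> t \<le> poly p (input_size n E \<delta> lam x y) \<and>
        good_set (1 / 147456) 65 n E \<Delta> (of_rat \<delta>) (of_rat lam) (output_set n m)"
      by blast
  qed
qed

end
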